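(* Let $L\ge1$ be an integer and let $v,a,b\in\{0,1\}^L$ with $b\notin\{a,a^R,\bar a,\bar a^R\}$. Let \[\psi^v_n(a,b)=\mathrm{P}\{C_n(a)>C_n(b)\mid (X)^L_L=v\}-\tfrac12,\qquad p^v_c=\mathrm{P}\{Y_1=c\mid (X)^L_L=v\},\quad c=\pm1,\] and \[\beta^v_{a,b}=\Bigl(\frac p2-p^v_{-1}\Bigr)2^L+\frac{\mu_{1,-1}-\mu_{-1,1}}2 .\] Then, as $n\to\infty$, \[\psi^v_n(a,b)=\frac{\beta^v_{a,b}}{\sqrt{2^{L+2}\,p\,q\,\pi n}}+o(1/\sqrt n).\]
   Context: $(X_i,i\ge1)$ is a symmetric Bernoulli process: i.i.d. random variables with $\mathrm{P}\{X_i=0\}=\mathrm{P}\{X_i=1\}=1/2$. For a word $x=(x_1,\dots,x_L)\in\{0,1\}^L$, $x^R=(x_L,\dots,x_1)$ is its reversal, $\bar x=(1-x_1,\dots,1-x_L)$ its conjugate, and $\bar x^R$ the reversal of $\bar x$. For a word $y$ of length $m\ge 1$, $C_n(y)=\sum_{k=m}^n \mathbf 1\{(X_{k-m+1},\dots,X_k)=y\}$ is the number of (possibly overlapping) occurrences of $y$ in $X_1,\dots,X_n$ (equal to $0$ if $n<m$). For $t\ge L$ let $(X)^L_t=(X_{t-L+1},\dots,X_t)$ (so $(X)^L_L=(X_1,\dots,X_L)$); for $t<L$ let $(X)^L_t$ be the empty word. Let $T_0=0$ and $T_k=\min\{t>T_{k-1}:(X)^L_t\in\{a,b\}\}$ for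 $k\ge1$ (almost surely finite). Let $Y_k=1$ if $(X)^L_{T_k}=a$ and $Y_k=-1$ if $(X)^L_{T_k}=b$. The sequence $(Y_k)_{k\ge1}$ is a time-homogeneous Markov chain on $\{\pm1\}$ and $\mathrm{P}\{Y_2=1\mid Y_1=1\}=\mathrm{P}\{Y_2=-1\mid Y_1=-1\}$; this common value is denoted $p$, and $q=1-p$. For $c,e=\pm1$, $\mu_{c,e}=\mathrm{E}[(T_2-T_1)\mathbf 1\{Y_2=e\}\mid Y_1=c]$. *)

theory Defs
  imports "HOL-Probability.Probability"
begin

text \<open>Words over \<open>{0,1}\<close> are boolean lists, with \<open>True\<close> for the letter 1.\<close>

definition conjugate :: "bool list \<Rightarrow> bool list" where
  "conjugate x = map Not x"

text \<open>The process is \<open>X 1, X 2, \<dots>\<close>; the value \<open>X 0\<close> is never used.\<close>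

definition symmetric_bernoulli_process :: "'w measure \<Rightarrow> (nat \<Rightarrow> 'w \<Rightarrow> bool) \<Rightarrow> bool" where
  "symmetric_bernoulli_process M X \<longleftrightarrow>
     prob_space M \<and>
     prob_space.indep_vars M (\<lambda>_. count_space UNIV) X {1..} \<and>
     (\<forall>i\<ge>1. \<P>(\<omega> in M. X i \<omega> = False) = 1/2 \<and> \<P>(\<omega> in M. X i \<omega> = True) = 1/2)"

definition window :: "(nat \<Rightarrow> 'w \<Rightarrow> bool) \<Rightarrow> nat \<Rightarrow> nat \<Rightarrow> 'w \<Rightarrow> bool list" where
  "window X L t \<omega> = (if t < L then [] else map (\<lambda>i. X i \<omega>) [t + 1 - L..<t + 1])"

definition occurrences :: "(nat \<Rightarrow> 'w \<Rightarrow> bool) \<Rightarrow> nat \<Rightarrow> bool list \<Rightarrow> 'w \<Rightarrow> nat" where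
  "occurrences X n y \<omega> = (\<Sum>k = length y..n. of_bool (window X (length y) k \<omega> = y))"

text \<open>On the null event that \<open>{a,b}\<close> is hit only finitely often, \<open>LEAST\<close> returns an
  arbitrary number.\<close>

primrec hit_time ::
  "(nat \<Rightarrow> 'w \<Rightarrow> bool) \<Rightarrow> nat \<Rightarrow> bool list \<Rightarrow> bool list \<Rightarrow> nat \<Rightarrow> 'w \<Rightarrow> nat" where
  "hit_time X L a b 0 \<omega> = 0"
| "hit_time X L a b (Suc k) \<omega> =
     (LEAST t. t > hit_time X L a b k \<omega> \<and> window X L t \<omega> \<in> {a, b})"

text \<open>The value 0 can occur only on that null event.\<close>

definition hit_sign ::
  "(nat \<Rightarrow> 'w \<Rightarrow> bool) \<Rightarrow> nat \<Rightarrow> bool list \<Rightarrow> bool list \<Rightarrow> nat \<Rightarrow> 'w \<Rightarrow> int" where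
  "hit_sign X L a b k \<omega> =
     (if window X L (hit_time X L a b k \<omega>) \<omega> = a then 1
      else if window X L (hit_time X L a b k \<omega>) \<omega> = b then - 1
      else 0)"

text \<open>Elementary conditional expectation given an event of positive probability.\<close>

definition cond_expectation_event ::
  "'w measure \<Rightarrow> ('w \<Rightarrow> real) \<Rightarrow> ('w \<Rightarrow> bool) \<Rightarrow> real" where
  "cond_expectation_event M Z Q =
     (\<integral>\<omega>. Z \<omega> * indicator {\<omega> \<in> space M. Q \<omega>} \<omega> \<partial>M) / \<P>(\<omega> in M. Q \<omega>)"

text \<open>The chain \<open>Y\<close> is stationary in its transitions and keeps its current state with the same
  probability in both states, so conditioning on \<open>Y 1 = 1\<close> involves no choice.\<close>

definition stay_prob ::
  "'w measure \<Rightarrow> (nat \<Rightarrow> 'w \<Rightarrow> bool) \<Rightarrow> nat \<Rightarrow> bool list \<Rightarrow> bool list \<Rightarrow> real" where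
  "stay_prob M X L a b =
     \<P>(\<omega> in M. hit_sign X L a b 2 \<omega> = 1 \<bar> hit_sign X L a b 1 \<omega> = 1)"

definition mu ::
  "'w measure \<Rightarrow> (nat \<Rightarrow> 'w \<Rightarrow> bool) \<Rightarrow> nat \<Rightarrow> bool list \<Rightarrow> bool list \<Rightarrow> int \<Rightarrow> int \<Rightarrow> real" where
  "mu M X L a b c e =
     cond_expectation_event M
       (\<lambda>\<omega>. (real (hit_time X L a b 2 \<omega>) - real (hit_time X L a b 1 \<omega>)) *
             of_bool (hit_sign X L a b 2 \<omega> = e))
       (\<lambda>\<omega>. hit_sign X L a b 1 \<omega> = c)"

definition start_prob ::
  "'w measure \<Rightarrow> (nat \<Rightarrow> 'w \<Rightarrow> bool) \<Rightarrow> nat \<Rightarrow> bool list \<Rightarrow> bool list \<Rightarrow> bool list \<Rightarrow> int \<Rightarrow> real" where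
  "start_prob M X L v a b c =
     \<P>(\<omega> in M. hit_sign X L a b 1 \<omega> = c \<bar> window X L L \<omega> = v)"

definition psi ::
  "'w measure \<Rightarrow> (nat \<Rightarrow> 'w \<Rightarrow> bool) \<Rightarrow> nat \<Rightarrow> bool list \<Rightarrow> bool list \<Rightarrow> bool list \<Rightarrow> nat \<Rightarrow> real" where
  "psi M X L v a b n =
     \<P>(\<omega> in M. occurrences X n a \<omega> > occurrences X n b \<omega> \<bar> window X L L \<omega> = v) - 1/2"

definition beta ::
  "'w measure \<Rightarrow> (nat \<Rightarrow> 'w \<Rightarrow> bool) \<Rightarrow> nat \<Rightarrow> bool list \<Rightarrow> bool list \<Rightarrow> bool list \<Rightarrow> real" where
  "beta M X L v a b =
     (stay_prob M X L a b / 2 - start_prob M X L v a b (- 1)) * 2 ^ L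
     + (mu M X L a b 1 (- 1) - mu M X L a b (- 1) 1) / 2"

end

theory Submission
  imports Defs "HOL-Complex_Analysis.Complex_Analysis" "HOL-Real_Asymp.Real_Asymp"
begin

text \<open>
  Let \<open>D\<close> be the count of \<open>a\<close> minus the count of \<open>b\<close>. Given the first \<open>L\<close> letters, \<open>D\<close> is a
  walk on the integers that goes up when the window becomes \<open>a\<close> and down when it becomes \<open>b\<close>.
  Between two hits of \<open>{a, b}\<close> it rests, and the type of a hit together with the waiting time for
  the next one is governed by a two-state Markov renewal kernel. Let \<open>al\<close>, \<open>be\<close>, \<open>ga\<close>, \<open>de\<close> be
  the generating functions in time of this kernel for \<open>a \<rightarrow> a\<close>, \<open>a \<rightarrow> b\<close>, \<open>b \<rightarrow> a\<close>, \<open>b \<rightarrow> b\<close>,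
  and let \<open>U k\<close>, \<open>V k\<close> be those of the probabilities that the walk exceeds level \<open>- k\<close>, started
  after a hit of \<open>a\<close> or of \<open>b\<close>. Decomposing at the first hit gives linear recursions in the
  level \<open>k\<close> whose coefficients do not depend on \<open>k\<close> (\<open>exceed_gf_first_hit\<close>). For \<open>\<bar>z\<bar> < 1\<close> they have
  a single bounded solution, which is constant plus geometric above level 0 and geometric below
  it; the ratios come from the roots of \<open>m\<^sup>2 - K m + al de = 0\<close> with \<open>K = 1 + al de - be ga\<close>
  (\<open>level_system_values\<close>).

  At \<open>z = 1\<close> the two roots merge, so that the solution has a square-root singularity there:
  \<open>U 1\<close> and \<open>V (- 1)\<close> both have the form \<open>1 / (2 (1 - z)) + c / sqrt (1 - z) + remainder\<close>, with a
  constant \<open>c\<close> that depends on the type of the hit (\<open>A_expansion\<close>, \<open>B_expansion\<close>). The derivative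
  of the remainder is \<open>O(\<bar>1 - z\<bar> powr (- 1/2))\<close>, which makes its coefficients \<open>O(1/n)\<close>
  (\<open>tame_coeff_bigo\<close>), while the coefficients of \<open>1 / sqrt (1 - z)\<close> are asymptotic to
  \<open>1 / sqrt (pi n)\<close>. The first term yields the probability 1/2 and the second one the claim.

  Three properties of the words enter. The stay probability \<open>p\<close> lies strictly between 0 and 1;
  it vanishes only if every run from \<open>a\<close> to \<open>a\<close> meets \<open>b\<close>, and this forces \<open>b\<close> to be the
  reversal of \<open>a\<close> (\<open>return_possible\<close>). The point 1 is the only singularity on the unit circle: as
  \<open>b\<close> is not the conjugate of \<open>a\<close>, one of the two constant words lies outside \<open>{a, b}\<close>, and
  staying there one step longer shows that some kernel entry charges two consecutive waiting
  times (\<open>consecutive_hits\<close>). Finally, the four mean waiting times add up to \<open>2 ^ L\<close>, and \<open>p\<close> is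
  the same for \<open>a\<close> and \<open>b\<close>; both follow by summation over all words of length \<open>L\<close>, each of which
  has exactly two predecessors (\<open>hitmean_total\<close>, \<open>hitprob_stationary\<close>).
\<close>

section \<open>Coefficients of functions with a square-root singularity at 1\<close>

text \<open>
  The chords of the concave sine on \<open>[0, pi/2]\<close> give Jordan's inequality; the other half follows by
  reflection.
\<close>
lemma sin_pi_ge_min:
  assumes "0 \<le> t" "t \<le> (1::real)"
  shows "2 * min t (1 - t) \<le> sin (pi * t)"
proof -
  have conc: "concave_on {0..pi/2} sin"
  proof (rule f''_le0_imp_concave[where f' = cos and f'' = "\<lambda>x. - sin x"])
    show "convex {0..pi/2}" by simp
  qed (auto intro!: derivative_eq_intros sin_ge_zero)
  have half: "2 * u \<le> sin (pi * u)" if "0 \<le> u" "u \<le> 1/2" for u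
  proof -
    have "sin ((1 - 2*u) *\<^sub>R 0 + (2*u) *\<^sub>R (pi/2)) \<ge> (1 - 2*u) * sin 0 + (2*u) * sin (pi/2)"
      using that by (intro concave_onD[OF conc]) auto
    thus ?thesis by (simp add: mult.commute)
  qed
  show ?thesis
  proof (cases "t \<le> 1/2")
    case True thus ?thesis using half[of t] assms by auto
  next
    case False
    have "sin (pi * t) = sin (pi * (1 - t))" by (simp add: algebra_simps sin_diff)
    thus ?thesis using half[of "1-t"] assms False by auto
  qed
qed

text \<open>
  On a circle of radius close to 1 the distance to the point 1 is at least of the order of the
  angle, uniformly in the radius. This makes \<open>\<bar>1 - z\<bar> powr (- 1/2)\<close> integrable along all these
  circles with one common bound.
\<close>
lemma norm_one_minus_circle_ge:
  assumes "0 \<le> t" "t \<le> 1" "1/2 \<le> r" "r < 1"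
  shows "min t (1 - t) \<le> norm (1 - complex_of_real r * exp (2 * of_real pi * \<i> * of_real t))"
proof -
  let ?u = "complex_of_real r * exp (2 * of_real pi * \<i> * of_real t)"
  have u: "?u = rcis r (2 * (pi * t))"
    by (simp add: rcis_def cis_conv_exp mult_ac)
  have "norm (1 - ?u) ^ 2 = (1 - r * cos (2 * (pi * t)))^2 + (r * sin (2 * (pi * t)))^2"
    unfolding u cmod_power2 by (simp add: rcis_def)
  also have "\<dots> = 1 - 2 * r * cos (2 * (pi * t)) + r^2 * ((sin (2 * (pi * t)))^2 + (cos (2 * (pi * t)))^2)"
    by (simp only: power2_eq_square) algebra
  also have "\<dots> = (1 - r)^2 + 4 * r * (sin (pi * t))^2"
    unfolding sin_cos_squared_add unfolding cos_double_sin by algebra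
  finally have e: "norm (1 - ?u) ^ 2 = (1 - r)^2 + 4 * r * (sin (pi * t))^2" .
  define \<mu> where "\<mu> = min t (1 - t)"
  have "0 \<le> \<mu>" "2 * \<mu> \<le> sin (pi * t)"
    using sin_pi_ge_min[OF assms(1,2)] assms(1,2) by (auto simp: \<mu>_def)
  hence "(min t (1 - t))^2 \<le> (sin (pi * t))^2"
    unfolding \<mu>_def[symmetric] by (intro power_mono) linarith+
  also have "\<dots> \<le> 4 * r * (sin (pi * t))^2"
    using assms by (simp add: mult_le_cancel_right1)
  finally have "(min t (1 - t))^2 \<le> norm (1 - ?u) ^ 2" unfolding e by (smt (verit) zero_le_power2)
  thus ?thesis by (rule power2_le_imp_le) simp
qed

lemma has_integral_endpoint_singularities:
  "((\<lambda>t. 1 / sqrt t + 1 / sqrt (1 - t)) has_integral 4) {0<..<1::real}"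
proof -
  have "((\<lambda>t. 1 / sqrt t + 1 / sqrt (1 - t)) has_integral
      ((2 * sqrt 1 - 2 * sqrt (1 - 1)) - (2 * sqrt 0 - 2 * sqrt (1 - 0)))) {0..1::real}"
    by (rule fundamental_theorem_of_calculus_interior)
       (auto intro!: continuous_intros derivative_eq_intros
         simp: has_real_derivative_iff_has_vector_derivative[symmetric] field_simps)
  thus ?thesis by (simp add: has_integral_Icc_iff_Ioo)
qed

text \<open>
  This class serves as the remainder in a singular expansion at 1: it contains \<open>csqrt (1 - z)\<close> and
  everything holomorphic on a larger disc, and it is closed under the ring operations and under
  inversion of functions bounded away from 0, so that membership of composite expressions can be
  read off their form.
\<close>
definition tame :: "(complex \<Rightarrow> complex) \<Rightarrow> bool" where
  "tame f \<longleftrightarrow> f holomorphic_on ball 0 1 \<and>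
     (\<exists>C. \<forall>z\<in>ball 0 1. norm (f z) \<le> C \<and> norm (deriv f z) * sqrt (norm (1 - z)) \<le> C)"

text \<open>
  Apply Cauchy's formula to the derivative, whose coefficients are \<open>n * c n\<close>, on circles of radius
  \<open>r < 1\<close>. The bound \<open>\<bar>f'\<bar> \<le> C / sqrt \<bar>1 - z\<bar>\<close> has an integral bounded independently of \<open>r\<close>,
  and \<open>r \<rightarrow> 1\<close> removes the factor \<open>r ^ n\<close>.
\<close>
lemma tame_coeff_bigo:
  assumes "tame f" and sums: "\<And>z. norm z < 1 \<Longrightarrow> (\<lambda>n. c n * z ^ n) sums f z"
  shows "(\<lambda>n. norm (c n)) \<in> O(\<lambda>n. 1 / real n)"
proof -
  from assms(1) obtain C where hol: "f holomorphic_on ball 0 1"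
    and C: "\<And>z. z \<in> ball 0 1 \<Longrightarrow> norm (deriv f z) * sqrt (norm (1 - z)) \<le> C"
    unfolding tame_def by blast
  have C0: "0 \<le> C" using C[of 0] by (smt (verit) centre_in_ball norm_ge_zero real_sqrt_ge_0_iff zero_less_one mult_nonneg_nonneg)
  have fps: "f has_fps_expansion Abs_fps c"
    by (rule has_fps_expansionI, rule eventually_mono[OF eventually_nhds_in_open[of "ball 0 1"]])
       (auto intro: sums)
  have coef: "c n = (deriv ^^ n) f 0 / fact n" for n
    using fps_nth_fps_expansion[OF fps, of n] by simp
  have hold: "deriv f holomorphic_on ball 0 1" using hol by (simp add: holomorphic_deriv)
  have bound: "norm (c (Suc k)) * real (Suc k) \<le> 4 * C" for k
  proof -
    \<comment> \<open>the constant 4 is the integral of \<open>1 / sqrt t + 1 / sqrt (1 - t)\<close> over the unit interval\<close>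
    have r: "norm (c (Suc k)) * real (Suc k) * r ^ k \<le> 4 * C" if r: "1/2 \<le> r" "r < 1" for r
    proof -
      define g where "g = (\<lambda>u. deriv f u / (u - 0) ^ Suc k)"
      have sub: "cball 0 r \<subseteq> ball (0::complex) 1" using r by auto
      have "(g has_contour_integral ((2 * pi * \<i>) / (fact k) * (deriv ^^ k) (deriv f) 0)) (circlepath 0 r)"
        unfolding g_def
      proof (rule Cauchy_has_contour_integral_higher_derivative_circlepath)
        show "continuous_on (cball 0 r) (deriv f)"
          using holomorphic_on_imp_continuous_on[OF hold] sub continuous_on_subset by blast
        show "deriv f holomorphic_on ball 0 r"
          using hold sub ball_subset_cball holomorphic_on_subset by (metis subset_trans)
        show "0 \<in> ball (0::complex) r" using r by simp
      qed
      hence I: "((\<lambda>t. g (circlepath 0 r t) * vector_derivative (circlepath 0 r) (at t))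
          has_integral ((2 * pi * \<i>) / (fact k) * (deriv ^^ k) (deriv f) 0)) {0<..<1}"
        unfolding has_contour_integral has_integral_Icc_iff_Ioo[symmetric] .
      have "norm ((2 * pi * \<i>) / (fact k) * (deriv ^^ k) (deriv f) 0)
          \<le> (2 * pi * C / r ^ k) * 4"
      proof -
        have "norm (integral {0<..<1} (\<lambda>t. g (circlepath 0 r t) * vector_derivative (circlepath 0 r) (at t)))
          \<le> integral {0<..<1} (\<lambda>t. (2 * pi * C / r ^ k) * (1 / sqrt t + 1 / sqrt (1 - t)))"
        proof (rule integral_norm_bound_integral)
          show "(\<lambda>t. g (circlepath 0 r t) * vector_derivative (circlepath 0 r) (at t)) integrable_on {0<..<1}"
            using I by blast
          show "(\<lambda>t. (2 * pi * C / r ^ k) * (1 / sqrt t + 1 / sqrt (1 - t))) integrable_on {0<..<1}"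
            using has_integral_mult_right[OF has_integral_endpoint_singularities] by blast
          fix t :: real assume t: "t \<in> {0<..<1}"
          define u where "u = complex_of_real r * exp (2 * of_real pi * \<i> * of_real t)"
          have nu: "norm u = r" unfolding u_def using r by (simp add: norm_mult)
          have vd: "norm (vector_derivative (circlepath 0 r) (at t)) = 2 * pi * r"
            using r by (simp add: vector_derivative_circlepath norm_mult)
          have gu: "g (circlepath 0 r t) = deriv f u / u ^ Suc k"
            unfolding g_def circlepath_def part_circlepath_def linepath_def u_def by (simp add: mult_ac scaleR_conv_of_real)
          have mpos: "0 < min t (1 - t)" using t by auto
          have ge: "min t (1 - t) \<le> norm (1 - u)"
            unfolding u_def using t r by (intro norm_one_minus_circle_ge) auto
          have "norm (deriv f u) \<le> C / sqrt (norm (1 - u))"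
            using C[of u] nu r ge mpos by (subst pos_le_divide_eq) auto
          also have "\<dots> \<le> C / sqrt (min t (1 - t))"
            using ge mpos C0 by (intro divide_left_mono mult_pos_pos) auto
          also have "\<dots> \<le> C * (1 / sqrt t + 1 / sqrt (1 - t))"
            using t C0 by (cases "t \<le> 1 - t") (simp_all add: distrib_left min_def)
          finally have d: "norm (deriv f u) \<le> C * (1 / sqrt t + 1 / sqrt (1 - t))" .
          have "norm (g (circlepath 0 r t) * vector_derivative (circlepath 0 r) (at t))
              = norm (deriv f u) * (2 * pi / r ^ k)"
            using r by (simp add: norm_mult vd gu norm_divide norm_power nu)
          also have "\<dots> \<le> C * (1 / sqrt t + 1 / sqrt (1 - t)) * (2 * pi / r ^ k)"
            using d r by (intro mult_right_mono) auto
          finally show "norm (g (circlepath 0 r t) * vector_derivative (circlepath 0 r) (at t))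
              \<le> (2 * pi * C / r ^ k) * (1 / sqrt t + 1 / sqrt (1 - t))"
            by (simp add: mult_ac)
        qed
        also have "\<dots> = (2 * pi * C / r ^ k) * 4"
          using has_integral_mult_right[OF has_integral_endpoint_singularities] by blast
        finally show ?thesis using I by (simp only: integral_unique)
      qed
      moreover have "(deriv ^^ k) (deriv f) 0 / fact k = c (Suc k) * of_nat (Suc k)"
        proof -
        have "fact (Suc k) = of_nat (Suc k) * (fact k :: complex)" by (rule fact_Suc)
        thus ?thesis unfolding coef by (simp add: funpow_Suc_right del: funpow.simps of_nat_Suc fact_Suc)
      qed
      hence "(2 * pi * \<i>) / (fact k) * (deriv ^^ k) (deriv f) 0
           = 2 * pi * \<i> * (c (Suc k) * of_nat (Suc k))"
        by (metis times_divide_eq_left times_divide_eq_right)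
      ultimately have "2 * pi * (norm (c (Suc k)) * real (Suc k)) \<le> (2 * pi) * (C / r ^ k * 4)"
        by (simp add: norm_mult del: of_nat_Suc)
      hence "norm (c (Suc k)) * real (Suc k) \<le> C / r ^ k * 4"
        by (subst (asm) mult_le_cancel_left_pos) auto
      thus ?thesis using r by (simp add: field_simps)
    qed
    have lim: "((\<lambda>r. norm (c (Suc k)) * real (Suc k) * r ^ k) \<longlongrightarrow> norm (c (Suc k)) * real (Suc k) * 1 ^ k) (at_left 1)"
      by (intro tendsto_intros)
    have "eventually (\<lambda>r. r \<in> {1/2<..<1}) (at_left (1::real))"
      by (rule eventually_at_leftI[of "1/2"]) auto
    hence "eventually (\<lambda>r. norm (c (Suc k)) * real (Suc k) * r ^ k \<le> 4 * C) (at_left 1)"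
      by eventually_elim (use r in \<open>auto simp del: of_nat_Suc\<close>)
    from tendsto_upperbound[OF lim this] show ?thesis by simp
  qed
  show ?thesis
  proof (rule bigoI[where c = "4 * C"])
    show "eventually (\<lambda>n. norm (norm (c n)) \<le> 4 * C * norm (1 / real n)) sequentially"
      using eventually_gt_at_top[of 0]
    proof eventually_elim
      case (elim n)
      then obtain k where "n = Suc k" using gr0_implies_Suc by blast
      with bound[of k] show ?case by (simp add: field_simps)
    qed
  qed
qed

lemma tame_cong:
  assumes "tame f" "\<And>z. norm z < 1 \<Longrightarrow> f z = g z"
  shows "tame g"
proof -
  have eq: "deriv f z = deriv g z" if "z \<in> ball 0 1" for z
    using that assms(2)
    by (intro deriv_cong_ev refl eventually_mono[OF eventually_nhds_in_open[of "ball 0 1"]]) auto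
  show ?thesis
    using assms holomorphic_cong[of "ball 0 1" "ball 0 1" f g] eq unfolding tame_def
    by (metis mem_ball_0)
qed

lemma tameI:
  assumes "f holomorphic_on ball 0 1" "\<And>z. norm z < 1 \<Longrightarrow> norm (f z) \<le> C"
    "\<And>z. norm z < 1 \<Longrightarrow> norm (deriv f z) * sqrt (norm (1 - z)) \<le> D"
  shows "tame f"
  unfolding tame_def using assms by (auto intro!: exI[of _ "max C D"] simp: le_max_iff_disj)

lemma tameE:
  assumes "tame f"
  obtains C where "\<forall>z. norm z < 1 \<longrightarrow> norm (f z) \<le> C \<and> norm (deriv f z) * sqrt (norm (1 - z)) \<le> C" "C \<ge> 0"
proof -
  from assms obtain C where C: "\<forall>z. norm z < 1 \<longrightarrow> norm (f z) \<le> C \<and> norm (deriv f z) * sqrt (norm (1 - z)) \<le> C"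
    unfolding tame_def by (metis mem_ball_0)
  have "norm (f 0) \<le> C" using C by simp
  hence "C \<ge> 0" by (rule order_trans[OF norm_ge_zero])
  thus ?thesis using that C by blast
qed

lemma tame_imp_holomorphic: "tame f \<Longrightarrow> f holomorphic_on ball 0 1"
  by (auto simp: tame_def)

lemma tame_imp_differentiable: "tame f \<Longrightarrow> norm z < 1 \<Longrightarrow> f field_differentiable (at z)"
  using holomorphic_on_imp_differentiable_at[OF tame_imp_holomorphic open_ball] by simp

lemma norm_one_minus_le: "norm z < 1 \<Longrightarrow> sqrt (norm (1 - z :: complex)) \<le> 2"
  using norm_triangle_ineq4[of 1 z] real_sqrt_le_mono[of "norm (1 - z)" "2\<^sup>2"] by simp

lemma tame_holomorphic:
  assumes "f holomorphic_on ball 0 r" "r > 1"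
  shows "tame f"
proof -
  have sub: "cball 0 1 \<subseteq> ball (0::complex) r" using assms by auto
  have "continuous_on (cball 0 1) f"
    using assms(1) sub by (meson continuous_on_subset holomorphic_on_imp_continuous_on)
  then obtain C where C: "\<And>z. z \<in> cball 0 1 \<Longrightarrow> norm (f z) \<le> C"
    by (metis compact_cball compact_continuous_image bounded_iff compact_imp_bounded imageI)
  have "continuous_on (cball 0 1) (deriv f)"
    using assms(1) sub by (meson continuous_on_subset holomorphic_on_imp_continuous_on holomorphic_deriv open_ball)
  then obtain D where D: "\<And>z. z \<in> cball 0 1 \<Longrightarrow> norm (deriv f z) \<le> D"
    by (metis compact_cball compact_continuous_image bounded_iff compact_imp_bounded imageI)
  show ?thesis
  proof (rule tameI[where C = C and D = "D * 2"])
    show "f holomorphic_on ball 0 1" using assms holomorphic_on_subset by (metis ball_subset_cball order_trans sub)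
    fix z :: complex assume "norm z < 1"
    thus "norm (f z) \<le> C" "norm (deriv f z) * sqrt (norm (1 - z)) \<le> D * 2"
      using C[of z] D[of z] norm_one_minus_le[of z]
      by (auto intro!: mult_mono intro: order_trans[OF norm_ge_zero])
  qed
qed

lemma tame_const: "tame (\<lambda>_. c)"
  by (rule tame_holomorphic[where r = 2]) auto

lemma tame_add:
  assumes "tame f" "tame g" shows "tame (\<lambda>z. f z + g z)"
proof -
  obtain C where C: "\<forall>z. norm z < 1 \<longrightarrow> norm (f z) \<le> C \<and> norm (deriv f z) * sqrt (norm (1 - z)) \<le> C"
    using tameE[OF assms(1)] by blast
  obtain D where D: "\<forall>z. norm z < 1 \<longrightarrow> norm (g z) \<le> D \<and> norm (deriv g z) * sqrt (norm (1 - z)) \<le> D"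
    using tameE[OF assms(2)] by blast
  show ?thesis
  proof (rule tameI)
    show "(\<lambda>z. f z + g z) holomorphic_on ball 0 1" using assms by (intro holomorphic_intros tame_imp_holomorphic)
    fix z :: complex assume z: "norm z < 1"
    show "norm (f z + g z) \<le> C + D" using C D z norm_triangle_le add_mono by blast
    have "norm (deriv (\<lambda>z. f z + g z) z) * sqrt (norm (1 - z))
       \<le> (norm (deriv f z) + norm (deriv g z)) * sqrt (norm (1 - z))"
      using tame_imp_differentiable[OF _ z] assms by (intro mult_right_mono) (auto simp: norm_triangle_ineq)
    also have "\<dots> \<le> C + D" unfolding distrib_right using C D z by (intro add_mono) auto
    finally show "norm (deriv (\<lambda>z. f z + g z) z) * sqrt (norm (1 - z)) \<le> C + D" .
  qed
qed

lemma tame_mult: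
  assumes "tame f" "tame g" shows "tame (\<lambda>z. f z * g z)"
proof -
  obtain C where C: "\<forall>z. norm z < 1 \<longrightarrow> norm (f z) \<le> C \<and> norm (deriv f z) * sqrt (norm (1 - z)) \<le> C" "C \<ge> 0"
    using tameE[OF assms(1)] by blast
  obtain D where D: "\<forall>z. norm z < 1 \<longrightarrow> norm (g z) \<le> D \<and> norm (deriv g z) * sqrt (norm (1 - z)) \<le> D" "D \<ge> 0"
    using tameE[OF assms(2)] by blast
  show ?thesis
  proof (rule tameI)
    show "(\<lambda>z. f z * g z) holomorphic_on ball 0 1" using assms by (intro holomorphic_intros tame_imp_holomorphic)
    fix z :: complex assume z: "norm z < 1"
    show "norm (f z * g z) \<le> C * D" unfolding norm_mult using C D z by (intro mult_mono) auto
    have "norm (deriv (\<lambda>z. f z * g z) z) * sqrt (norm (1 - z))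
       \<le> (norm (f z) * norm (deriv g z) + norm (deriv f z) * norm (g z)) * sqrt (norm (1 - z))"
      using tame_imp_differentiable[OF _ z] assms
      by (intro mult_right_mono) (auto simp: norm_mult[symmetric] norm_triangle_ineq)
    also have "\<dots> = norm (f z) * (norm (deriv g z) * sqrt (norm (1 - z))) + norm (deriv f z) * sqrt (norm (1 - z)) * norm (g z)"
      by (simp add: algebra_simps)
    also have "\<dots> \<le> C * D + C * D" using C D z by (intro add_mono mult_mono) auto
    finally show "norm (deriv (\<lambda>z. f z * g z) z) * sqrt (norm (1 - z)) \<le> C * D + C * D" .
  qed
qed

lemma tame_uminus: "tame f \<Longrightarrow> tame (\<lambda>z. - f z)"
  using tame_mult[OF tame_const[of "-1"]] by simp

lemma tame_diff: "tame f \<Longrightarrow> tame g \<Longrightarrow> tame (\<lambda>z. f z - g z)"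
  using tame_add[OF _ tame_uminus] by simp

lemma tame_inverse:
  assumes "tame f" "c > 0" "\<And>z. norm z < 1 \<Longrightarrow> c \<le> norm (f z)"
  shows "tame (\<lambda>z. inverse (f z))"
proof -
  obtain C where C: "\<forall>z. norm z < 1 \<longrightarrow> norm (f z) \<le> C \<and> norm (deriv f z) * sqrt (norm (1 - z)) \<le> C" "C \<ge> 0"
    using tameE[OF assms(1)] by blast
  have nz: "f z \<noteq> 0" if "norm z < 1" for z using assms(2) assms(3)[OF that] by auto
  show ?thesis
  proof (rule tameI)
    show "(\<lambda>z. inverse (f z)) holomorphic_on ball 0 1" using nz assms(1) by (intro holomorphic_intros tame_imp_holomorphic) auto
    fix z :: complex assume z: "norm z < 1"
    show "norm (inverse (f z)) \<le> 1 / c"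
      using assms(2) assms(3)[OF z] unfolding norm_inverse inverse_eq_divide by (simp add: frac_le norm_divide)
    have "deriv (\<lambda>z. inverse (f z)) z = - deriv f z / (f z)^2"
      using tame_imp_differentiable[OF assms(1) z] nz[OF z]
      by (intro DERIV_imp_deriv) (auto intro!: derivative_eq_intros simp: field_differentiable_derivI power2_eq_square field_simps)
    hence "norm (deriv (\<lambda>z. inverse (f z)) z) * sqrt (norm (1 - z))
       = norm (deriv f z) * sqrt (norm (1 - z)) / norm (f z)^2"
      by (simp add: norm_divide norm_power)
    also have "\<dots> \<le> C / c^2"
      using C z assms(2) assms(3)[OF z] by (intro frac_le power_mono) auto
    finally show "norm (deriv (\<lambda>z. inverse (f z)) z) * sqrt (norm (1 - z)) \<le> C / c^2" .
  qed
qed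

lemma one_minus_not_nonpos:
  assumes "norm (z::complex) < 1" shows "1 - z \<notin> \<real>\<^sub>\<le>\<^sub>0"
proof
  assume "1 - z \<in> \<real>\<^sub>\<le>\<^sub>0"
  hence "Re (1 - z) \<le> 0" by (auto simp: complex_nonpos_Reals_iff)
  thus False using complex_Re_le_cmod[of z] assms by simp
qed

lemma tame_csqrt: "tame (\<lambda>z. csqrt (1 - z))"
proof (rule tameI)
  show "(\<lambda>z. csqrt (1 - z)) holomorphic_on ball 0 1"
    using one_minus_not_nonpos by (intro holomorphic_intros) auto
  fix z :: complex assume z: "norm z < 1"
  show "norm (csqrt (1 - z)) \<le> 2" using norm_one_minus_le[OF z] by simp
  have nz: "z \<noteq> 1" using z by auto
  have "deriv (\<lambda>z. csqrt (1 - z)) z = - 1 / (2 * csqrt (1 - z))"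
    using one_minus_not_nonpos[OF z] by (intro DERIV_imp_deriv) (auto intro!: derivative_eq_intros)
  hence "norm (deriv (\<lambda>z. csqrt (1 - z)) z) * sqrt (norm (1 - z)) = 1 / 2"
    using nz by (simp add: norm_divide norm_mult)
  thus "norm (deriv (\<lambda>z. csqrt (1 - z)) z) * sqrt (norm (1 - z)) \<le> 1 / 2" by simp
qed

lemma of_real_gchoose: "complex_of_real (a gchoose n) = (complex_of_real a gchoose n)"
  by (simp add: gbinomial_prod_rev)

lemma inverse_csqrt_sums:
  assumes "norm z < 1"
  shows "(\<lambda>n. of_real ((-1/2 gchoose n) * (-1) ^ n) * z ^ n) sums inverse (csqrt (1 - z))"
proof -
  have nz: "1 - z \<noteq> 0" using assms by auto
  have "(\<lambda>n. (-1/2 gchoose n) * (-z) ^ n) sums (1 + (-z)) powr (-1/2)"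
    using assms by (intro gen_binomial_complex) simp
  also have "(1 + (-z)) powr (-1/2) = inverse (csqrt (1 - z))"
    using nz by (simp add: csqrt_conv_powr powr_minus)
  finally show ?thesis
    by (simp add: power_minus[of z] of_real_gchoose mult_ac)
qed

lemma inverse_sqrt_coeff_asymp:
  "(\<lambda>n. (-1/2 gchoose n) * (-1) ^ n - 1 / sqrt (pi * real n)) \<in> o(\<lambda>n. 1 / sqrt (real n))"
proof -
  have "(\<lambda>n. ((-1/2::real) gchoose n) / ((-1)^n / exp ((-1/2+1) * of_real (ln (real n))))) \<longlonglongrightarrow>
           inverse (Gamma (- (-1/2)))"
    by (rule gbinomial_asymptotic)
  hence lim: "(\<lambda>n. ((-1/2::real) gchoose n) / ((-1)^n / exp (1/2 * ln (real n)))) \<longlonglongrightarrow> 1 / sqrt pi"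
    by (simp add: Gamma_one_half_real inverse_eq_divide)
  show ?thesis
  proof (rule smalloI_tendsto)
    have "(\<lambda>n. ((-1/2::real) gchoose n) / ((-1)^n / exp (1/2 * ln (real n))) - 1 / sqrt pi) \<longlonglongrightarrow> 1 / sqrt pi - 1 / sqrt pi"
      by (intro tendsto_diff lim tendsto_const)
    moreover have "eventually (\<lambda>n. ((-1/2::real) gchoose n) / ((-1)^n / exp (1/2 * ln (real n))) - 1 / sqrt pi
       = ((-1/2 gchoose n) * (-1) ^ n - 1 / sqrt (pi * real n)) / (1 / sqrt (real n))) sequentially"
      using eventually_gt_at_top[of 0]
    proof eventually_elim
      case (elim n)
      have "exp (1/2 * ln (real n)) = sqrt (real n)"
        using elim by (simp add: powr_half_sqrt[symmetric] powr_def)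
      moreover have "x / ((-1)^n / y) = x * (-1)^n * y" for x y :: real
        by (cases "even n") auto
      ultimately show ?case using elim by (simp add: real_sqrt_mult field_simps)
    qed
    ultimately show "(\<lambda>n. ((-1/2 gchoose n) * (-1) ^ n - 1 / sqrt (pi * real n)) / (1 / sqrt (real n))) \<longlonglongrightarrow> 0"
      using Lim_transform_eventually by fastforce
    show "eventually (\<lambda>n. 1 / sqrt (real n) \<noteq> 0) sequentially"
      using eventually_gt_at_top[of 0] by eventually_elim auto
  qed
qed

text \<open>
  The transfer principle used for the main result: an explicit singular term plus a tame remainder
  determines the coefficients up to \<open>o(1 / sqrt n)\<close>.
\<close>
theorem coeff_asymp_of_tame_remainder:
  fixes c :: "nat \<Rightarrow> real"
  assumes "tame (\<lambda>z. f z - of_real \<kappa> * inverse (csqrt (1 - z)))"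
    and "\<And>z. norm z < 1 \<Longrightarrow> (\<lambda>n. of_real (c n) * z ^ n) sums f z"
  shows "(\<lambda>n. c n - \<kappa> / sqrt (pi * real n)) \<in> o(\<lambda>n. 1 / sqrt (real n))"
proof -
  define b :: "nat \<Rightarrow> real" where "b = (\<lambda>n. (-1/2 gchoose n) * (-1) ^ n)"
  have "(\<lambda>n. norm (complex_of_real (c n - \<kappa> * b n))) \<in> O(\<lambda>n. 1 / real n)"
  proof (rule tame_coeff_bigo[OF assms(1)])
    fix z :: complex assume z: "norm z < 1"
    have "(\<lambda>n. of_real (c n) * z ^ n - of_real \<kappa> * (of_real (b n) * z ^ n)) sums
       (f z - of_real \<kappa> * inverse (csqrt (1 - z)))"
      unfolding b_def by (intro sums_diff sums_mult assms(2)[OF z] inverse_csqrt_sums[OF z])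
    thus "(\<lambda>n. complex_of_real (c n - \<kappa> * b n) * z ^ n) sums
       (f z - of_real \<kappa> * inverse (csqrt (1 - z)))" by (simp add: algebra_simps)
  qed
  hence "(\<lambda>n. c n - \<kappa> * b n) \<in> O(\<lambda>n. 1 / real n)"
    by (simp only: norm_of_real) simp
  also have "(\<lambda>n. 1 / real n) \<in> o(\<lambda>n. 1 / sqrt (real n))"
    by real_asymp
  finally have 1: "(\<lambda>n. c n - \<kappa> * b n) \<in> o(\<lambda>n. 1 / sqrt (real n))" .
  have "(\<lambda>n. \<kappa> * (b n - 1 / sqrt (pi * real n))) \<in> o(\<lambda>n. 1 / sqrt (real n))"
    using inverse_sqrt_coeff_asymp unfolding b_def by simp
  from sum_in_smallo(1)[OF 1 this] show ?thesis by (simp add: algebra_simps)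
qed

section \<open>Walks whose steps are driven by a two-state chain\<close>

text \<open>
  Here \<open>m\<close> and \<open>m'\<close> are the roots of \<open>x\<^sup>2 - (1 + al de - be ga) x + al de\<close>. If both had modulus at
  most 1 and \<open>\<bar>m\<bar> + \<bar>m'\<bar> \<le> \<bar>al\<bar> + \<bar>de\<bar>\<close>, then, as \<open>\<bar>m m'\<bar> = \<bar>al de\<bar>\<close>, the product
  \<open>\<bar>1 - m\<bar> \<bar>1 - m'\<bar>\<close> would be at least \<open>(1 - \<bar>al\<bar>) (1 - \<bar>de\<bar>) > \<bar>be ga\<bar>\<close>, a contradiction.
  Roots of equal modulus, or a larger root not exceeding \<open>max \<bar>al\<bar> \<bar>de\<bar>\<close>, would bring the sum
  of the moduli below that bound.
\<close>
lemma complex_gap: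
  fixes al be ga de :: complex
  assumes "norm al < 1" "norm de < 1" "norm (be * ga) < (1 - norm al) * (1 - norm de)"
    and prod: "m * m' = al * de" and prod1: "(1 - m) * (1 - m') = be * ga"
  shows "norm m \<noteq> norm m'" "norm m \<ge> norm m' \<Longrightarrow> norm al < norm m \<and> norm de < norm m"
proof -
  have np: "norm m * norm m' = norm al * norm de" using prod by (metis norm_mult)
  have np1: "norm (1 - m) * norm (1 - m') < (1 - norm al) * (1 - norm de)"
    using prod1 assms(3) by (metis norm_mult)
  have key: "norm al + norm de < norm m + norm m'" if "norm m \<le> 1" "norm m' \<le> 1"
  proof -
    have "(1 - norm m) * (1 - norm m') \<le> norm (1 - m) * norm (1 - m')"
      using that norm_triangle_ineq2[of 1 m] norm_triangle_ineq2[of 1 m'] by (intro mult_mono) auto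
    hence "(1 - norm m) * (1 - norm m') < (1 - norm al) * (1 - norm de)" using np1 by linarith
    thus ?thesis using np by (simp add: algebra_simps)
  qed
  show "norm m \<noteq> norm m'"
  proof
    assume e: "norm m = norm m'"
    have sq: "(norm m)^2 = norm al * norm de" using np e by (simp add: power2_eq_square)
    have "norm al * norm de \<le> 1" using assms(1,2) by (simp add: mult_le_one)
    hence "norm m \<le> 1" using sq by (metis norm_ge_zero power2_le_imp_le one_power2 zero_le_one)
    hence "norm al + norm de < 2 * norm m" using key e by simp
    hence "(norm al + norm de)^2 < (2 * norm m)^2" by (intro power_strict_mono) auto
    hence "(norm al + norm de)^2 < 4 * (norm al * norm de)" using sq by (simp add: power_mult_distrib)
    moreover have "(norm al + norm de)^2 - 4 * (norm al * norm de) = (norm al - norm de)^2" by algebra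
    ultimately show False by (smt (verit) zero_le_power2)
  qed
  show "norm al < norm m \<and> norm de < norm m" if ge: "norm m \<ge> norm m'"
  proof (rule ccontr)
    assume n: "\<not> ?thesis"
    define M where "M = max (norm al) (norm de)"
    have mM: "norm m \<le> M" "norm m' \<le> M" "M < 1" "M \<ge> 0" using n ge assms(1,2) unfolding M_def by (auto simp: le_max_iff_disj)
    hence lt: "norm al + norm de < norm m + norm m'" using key by auto
    have "0 \<le> (M - norm m) * (M - norm m')" using mM by auto
    hence "M * (norm m + norm m') \<le> M * M + norm al * norm de" using np by (simp add: algebra_simps)
    also have "\<dots> = M * (norm al + norm de)" unfolding M_def max_def by (auto simp: algebra_simps)
    finally have "M * (norm m + norm m' - (norm al + norm de)) \<le> 0" by (simp add: algebra_simps)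
    hence "M \<le> 0" using lt by (simp add: mult_le_0_iff)
    hence "M = 0" using mM by simp
    thus False using mM lt by (smt (verit) norm_ge_zero)
  qed
qed

text \<open>
  As \<open>c < 1\<close>, the recursion is a contraction in the supremum norm over all levels.
\<close>
lemma level_system_unique:
  fixes U V U' V' :: "int \<Rightarrow> complex"
  assumes c: "norm al + norm be \<le> c" "norm ga + norm de \<le> c" "c < 1"
    and U: "\<And>k. U k = (if k > 0 then ea else 0) + al * U (k+1) + be * V (k-1)"
    and V: "\<And>k. V k = (if k > 0 then eb else 0) + ga * U (k+1) + de * V (k-1)"
    and U': "\<And>k. U' k = (if k > 0 then ea else 0) + al * U' (k+1) + be * V' (k-1)"
    and V': "\<And>k. V' k = (if k > 0 then eb else 0) + ga * U' (k+1) + de * V' (k-1)"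
    and B: "\<And>k. norm (U k) \<le> B" "\<And>k. norm (V k) \<le> B" "\<And>k. norm (U' k) \<le> B" "\<And>k. norm (V' k) \<le> B"
  shows "U k = U' k" "V k = V' k"
proof -
  have c0: "c \<ge> 0" using c(1) by (smt (verit) norm_ge_zero)
  have bd: "norm (U k - U' k) \<le> c ^ n * (2 * B) \<and> norm (V k - V' k) \<le> c ^ n * (2 * B)" for n k
  proof (induction n arbitrary: k)
    case 0
    show ?case using B[of k] norm_triangle_ineq4[of "U k" "U' k"] norm_triangle_ineq4[of "V k" "V' k"] by simp
  next
    case (Suc n)
    have step: "norm (x * (U (k+1) - U' (k+1)) + y * (V (k-1) - V' (k-1))) \<le> c ^ Suc n * (2 * B)"
      if "norm x + norm y \<le> c" for x y
    proof -
      have "norm (x * (U (k+1) - U' (k+1)) + y * (V (k-1) - V' (k-1)))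
         \<le> norm x * norm (U (k+1) - U' (k+1)) + norm y * norm (V (k-1) - V' (k-1))"
        by (metis norm_mult norm_triangle_ineq)
      also have "\<dots> \<le> norm x * (c ^ n * (2 * B)) + norm y * (c ^ n * (2 * B))"
        using Suc.IH by (intro add_mono mult_left_mono) auto
      also have "\<dots> = (norm x + norm y) * (c ^ n * (2 * B))" by (simp add: algebra_simps)
      also have "\<dots> \<le> c * (c ^ n * (2 * B))"
        using that c0 B(1)[of 0] by (intro mult_right_mono mult_nonneg_nonneg) (auto intro: order_trans[OF norm_ge_zero])
      finally show ?thesis by simp
    qed
    have "U k - U' k = al * (U (k+1) - U' (k+1)) + be * (V (k-1) - V' (k-1))"
      by (subst U, subst U') (simp add: algebra_simps)
    moreover have "V k - V' k = ga * (U (k+1) - U' (k+1)) + de * (V (k-1) - V' (k-1))"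
      by (subst V, subst V') (simp add: algebra_simps)
    ultimately show ?case using step c by simp
  qed
  have lim: "(\<lambda>n. c ^ n * (2 * B)) \<longlonglongrightarrow> 0 * (2 * B)"
    using c0 c by (intro tendsto_mult tendsto_const LIMSEQ_power_zero) auto
  show "U k = U' k"
    using tendsto_lowerbound[OF lim, of "norm (U k - U' k)"] bd by auto
  show "V k = V' k"
    using tendsto_lowerbound[OF lim, of "norm (V k - V' k)"] bd by auto
qed

text \<open>
  The homogeneous recursion is solved by geometric sequences. Those with ratio \<open>de / m\<close> decay for
  \<open>k \<rightarrow> \<infinity>\<close> and are added to the constant particular solution \<open>J\<close>; those with ratio \<open>al / m\<close>
  are used towards \<open>- \<infinity>\<close>. The equations at the seam involve both pieces at \<open>U 1\<close> and \<open>V 0\<close>, where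
  the two formulas agree, and this determines the amplitudes.
\<close>
lemma level_system_solution:
  fixes al be ga de m n J :: complex
  defines "s \<equiv> m - n" and "d \<equiv> 1 - n" and "e \<equiv> 1 - m"
  defines "U \<equiv> \<lambda>k::int. if k \<ge> 1 then J - J * (be - e) / s * (de / m) ^ nat (k - 1)
                           else J * (d - be) / s * (al / m) ^ nat (1 - k)"
  defines "V \<equiv> \<lambda>k::int. if k \<ge> 0 then J - J * (d - ga) / s * (de / m) ^ nat k
                           else J * (ga - e) / s * (al / m) ^ nat (- k)"
  assumes prod: "m * n = al * de" and prod1: "(1 - m) * (1 - n) = be * ga"
    and s: "m \<noteq> n" and m: "m \<noteq> 0"
  shows "U k = (if k > 0 then J * (1 - al - be) else 0) + al * U (k+1) + be * V (k-1)"
    and "V k = (if k > 0 then J * (1 - ga - de) else 0) + ga * U (k+1) + de * V (k-1)"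
proof -
  define xi eta where "xi = de / m" and "eta = al / m"
  have de: "de = m * xi" and al: "al = m * eta" using m by (auto simp: xi_def eta_def)
  have n: "n = m * xi * eta" using prod m unfolding de al by (simp add: field_simps)
  have sne: "s \<noteq> 0" using s unfolding s_def by simp
  have ed: "e * d = be * ga" using prod1 unfolding e_def d_def .
  define w where "w = J * inverse s"
  \<comment> \<open>dividing the inhomogeneity by \<open>s\<close> once turns every remaining check into a polynomial identity\<close>
  have Ju: "J = w * s" using sne unfolding w_def by simp
  have U1: "U k = J - w * (be - e) * xi ^ nat (k - 1)" if "k \<ge> 1" for k
    using that unfolding U_def w_def xi_def by (simp add: field_simps)
  have U0: "U k = w * (d - be) * eta ^ nat (1 - k)" if "k \<le> 1" for k
  proof (cases "k = 1")
    case True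
    have "J - w * (be - e) = w * (d - be)" unfolding Ju s_def d_def e_def by (simp add: algebra_simps)
    thus ?thesis using U1[of 1] True by simp
  next
    case False
    thus ?thesis using that unfolding U_def w_def eta_def by (simp add: field_simps)
  qed
  have V1: "V k = J - w * (d - ga) * xi ^ nat k" if "k \<ge> 0" for k
    using that unfolding V_def w_def xi_def by (simp add: field_simps)
  have V0: "V k = w * (ga - e) * eta ^ nat (- k)" if "k \<le> 0" for k
  proof (cases "k = 0")
    case True
    have "J - w * (d - ga) = w * (ga - e)" unfolding Ju s_def d_def e_def by (simp add: algebra_simps)
    thus ?thesis using V1[of 0] True by simp
  next
    case False
    thus ?thesis using that unfolding V_def w_def eta_def by (simp add: field_simps)
  qed
  have dn: "d = 1 - m * xi * eta" unfolding d_def n ..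
  \<comment> \<open>the identities that make the amplitudes compatible all reduce to \<open>d * e = be * ga\<close>\<close>
  have k1: "d * (be - e) = be * (d - ga)" "e * (d - ga) = ga * (be - e)"
     "e * (d - be) = be * (ga - e)" "d * (ga - e) = ga * (d - be)"
    using ed by (simp_all add: algebra_simps)
  show "U k = (if k > 0 then J * (1 - al - be) else 0) + al * U (k+1) + be * V (k-1)"
  proof (cases "k > 0")
    case True
    define j where "j = nat (k - 1)"
    have k: "nat (k + 1 - 1) = Suc j" "nat k = Suc j" "nat (k - 1) = j" using True unfolding j_def by auto
    have "U k - (J * (1 - al - be) + al * U (k+1) + be * V (k-1)) =
       - w * xi ^ j * (d * (be - e) - be * (d - ga))"
      using True by (subst U1, simp, subst U1, simp, subst V1, simp)
        (simp add: k al dn algebra_simps del: add_diff_cancel_right')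
    thus ?thesis using True k1 by simp
  next
    case False
    define j where "j = nat (- k)"
    have k: "nat (1 - (k + 1)) = j" "nat (1 - k) = Suc j" "nat (- (k - 1)) = Suc j" using False unfolding j_def by auto
    have "U k - (al * U (k+1) + be * V (k-1)) =
       w * eta ^ Suc j * (e * (d - be) - be * (ga - e))"
      using False by (subst U0, simp, subst U0, simp, subst V0, simp)
        (simp only: k, simp add: al e_def algebra_simps)
    thus ?thesis using False k1 by simp
  qed
  show "V k = (if k > 0 then J * (1 - ga - de) else 0) + ga * U (k+1) + de * V (k-1)"
  proof (cases "k > 0")
    case True
    define j where "j = nat (k - 1)"
    have k: "nat (k + 1 - 1) = Suc j" "nat (k - 1) = j" "nat k = Suc j" using True unfolding j_def by auto
    have "V k - (J * (1 - ga - de) + ga * U (k+1) + de * V (k-1)) =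
       - w * xi ^ Suc j * (e * (d - ga) - ga * (be - e))"
      using True by (subst V1, simp, subst U1, simp, subst V1, simp)
        (simp only: k, simp add: de e_def algebra_simps)
    thus ?thesis using True k1 by simp
  next
    case False
    define j where "j = nat (- k)"
    have k: "nat (1 - (k + 1)) = j" "nat (- k) = j" "nat (- (k - 1)) = Suc j" using False unfolding j_def by auto
    have "V k - (ga * U (k+1) + de * V (k-1)) =
       w * eta ^ j * (d * (ga - e) - ga * (d - be))"
      using False by (subst V0, simp, subst U0, simp, subst V0, simp)
        (simp only: k, simp add: de dn algebra_simps)
    thus ?thesis using False k1 by simp
  qed
qed

text \<open>
  The levels \<open>1\<close> after \<open>a\<close> and \<open>- 1\<close> after \<open>b\<close> are the ones that express a positive final value of
  the walk when the hit itself is counted.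
\<close>
theorem level_system_values:
  fixes U V :: "int \<Rightarrow> complex"
  assumes c: "norm al + norm be \<le> c" "norm ga + norm de \<le> c" "c < 1"
    and U: "\<And>k. U k = (if k > 0 then J * (1 - al - be) else 0) + al * U (k+1) + be * V (k-1)"
    and V: "\<And>k. V k = (if k > 0 then J * (1 - ga - de) else 0) + ga * U (k+1) + de * V (k-1)"
    and B: "\<And>k. norm (U k) \<le> B" "\<And>k. norm (V k) \<le> B"
    and prod: "m * n = al * de" and prod1: "(1 - m) * (1 - n) = be * ga"
    and m: "m \<noteq> n" "norm al < norm m" "norm de < norm m"
  shows "U 1 = J * (1 - n - be) / (m - n)"
    and "V (-1) = al / m * (J * (ga - (1 - m)) / (m - n))"
proof -
  define U' where "U' = (\<lambda>k::int. if k \<ge> 1 then J - J * (be - (1-m)) / (m-n) * (de / m) ^ nat (k - 1)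
                           else J * (1-n - be) / (m-n) * (al / m) ^ nat (1 - k))"
  define V' where "V' = (\<lambda>k::int. if k \<ge> 0 then J - J * (1-n - ga) / (m-n) * (de / m) ^ nat k
                           else J * (ga - (1-m)) / (m-n) * (al / m) ^ nat (- k))"
  have m0: "m \<noteq> 0" using m by auto
  have pw: "norm (de / m) ^ i \<le> 1" "norm (al / m) ^ i \<le> 1" for i
    using m by (intro power_le_one; simp add: norm_divide divide_le_eq_1)+
  define B' where "B' = max B (norm J + norm (J * (be - (1-m)) / (m-n)) + norm (J * (1-n - be) / (m-n))
     + norm (J * (1-n - ga) / (m-n)) + norm (J * (ga - (1-m)) / (m-n)))"
  have b1: "norm (J - x * (de / m) ^ i) \<le> norm J + norm x" for x i
  proof -
    have "norm (J - x * (de / m) ^ i) \<le> norm J + norm x * norm (de / m) ^ i"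
      by (metis norm_mult norm_power norm_triangle_ineq4)
    also have "\<dots> \<le> norm J + norm x * 1" using pw by (intro add_left_mono mult_left_mono) auto
    finally show ?thesis by simp
  qed
  have b2: "norm (x * (al / m) ^ i) \<le> norm x" for x i
    using mult_left_mono[OF pw(2), of "norm x" i] by (simp add: norm_mult norm_power)
  have B1: "norm (U' k) \<le> B'" for k
    unfolding U'_def B'_def using b1[of "J * (be - (1-m)) / (m-n)" "nat (k - 1)"] b2[of "J * (1-n - be) / (m-n)" "nat (1 - k)"]
    by (auto simp del: norm_divide norm_mult intro!: max.coboundedI2 intro: order_trans)
  have B2: "norm (V' k) \<le> B'" for k
    unfolding V'_def B'_def using b1[of "J * (1-n - ga) / (m-n)" "nat k"] b2[of "J * (ga - (1-m)) / (m-n)" "nat (- k)"]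
    by (auto intro!: max.coboundedI2 intro: order_trans)
  have B3: "norm (U k) \<le> B'" "norm (V k) \<le> B'" for k using B[of k] unfolding B'_def by auto
  have sol: "U' k = (if k > 0 then J * (1 - al - be) else 0) + al * U' (k+1) + be * V' (k-1)"
    "V' k = (if k > 0 then J * (1 - ga - de) else 0) + ga * U' (k+1) + de * V' (k-1)" for k
    unfolding U'_def V'_def by (rule level_system_solution[OF prod prod1 m(1) m0])+
  have "U 1 = U' 1"
    by (rule level_system_unique(1)[OF c U V sol B3 B1 B2])
  thus "U 1 = J * (1 - n - be) / (m - n)" unfolding U'_def using m
    by (simp add: field_simps)
  have "V (-1) = V' (-1)"
    by (rule level_system_unique(2)[OF c U V sol B3 B1 B2])
  thus "V (-1) = al / m * (J * (ga - (1 - m)) / (m - n))" unfolding V'_def by (simp add: mult_ac)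
qed

section \<open>Singular expansion of the level system\<close>

text \<open>
  The difference quotient at 1, extended over 1 by the derivative. It carries the first-order
  expansions below as exact identities between holomorphic functions.
\<close>
definition slope_at_1 :: "(complex \<Rightarrow> complex) \<Rightarrow> complex \<Rightarrow> complex" where
  "slope_at_1 f z = (if z = 1 then deriv f 1 else (f z - f 1) / (z - 1))"

lemma slope_at_1_eq: "f z = f 1 - (1 - z) * slope_at_1 f z"
  by (auto simp: slope_at_1_def field_simps)

lemma slope_at_1_1 [simp]: "slope_at_1 f 1 = deriv f 1"
  by (simp add: slope_at_1_def)

lemma holomorphic_slope_at_1:
  "f holomorphic_on ball 0 r \<Longrightarrow> r > 1 \<Longrightarrow> slope_at_1 f holomorphic_on ball 0 r"
  unfolding slope_at_1_def by (rule pole_lemma) auto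

text \<open>
  With \<open>s\<^sup>2 = al de\<close> a vanishing discriminant means \<open>(1 - s)\<^sup>2 = be ga\<close>. Since \<open>\<bar>s\<bar> \<le> p\<close> and
  \<open>\<bar>be ga\<bar> \<le> (1 - p)\<^sup>2\<close>, this leaves no slack in any of the bounds.
\<close>
lemma discriminant_zero_imp_extremal:
  fixes al be ga de :: complex
  assumes "0 < p" "p < 1" "norm al \<le> p" "norm de \<le> p" "norm be \<le> 1 - p" "norm ga \<le> 1 - p"
    and disc: "(1 + al * de - be * ga)^2 = 4 * al * de"
  shows "norm al = p \<and> norm de = p \<and> norm be = 1 - p \<and> norm ga = 1 - p"
proof -
  have "(1 + al * de - be * ga)^2 = (2 * csqrt (al * de))^2"
    using disc by (simp add: power_mult_distrib)
  then obtain s where s2: "s^2 = al * de" and "1 + al * de - be * ga = 2 * s"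
    by (metis power2_eq_iff power2_csqrt power2_minus minus_mult_right)
  hence bg: "be * ga = (1 - s)^2" by (simp add: power2_eq_square algebra_simps)
  have sn: "(norm s)^2 = norm al * norm de" using s2 by (metis norm_mult norm_power)
  have ad: "norm al * norm de \<le> p * p" using assms(1-6) by (intro mult_mono) auto
  hence "(norm s)^2 \<le> p^2" using sn by (simp add: power2_eq_square)
  hence sp: "norm s \<le> p" using assms(1) by (rule power2_le_imp_le[OF _ less_imp_le])
  have "1 - norm s \<le> norm (1 - s)" using norm_triangle_ineq2[of 1 s] by simp
  hence 1: "(1 - p)^2 \<le> (1 - norm s)^2" "(1 - norm s)^2 \<le> (norm (1 - s))^2"
    using sp assms(1,2) by (auto intro!: power_mono)
  have 2: "(norm (1 - s))^2 = norm be * norm ga" using bg by (metis norm_mult norm_power)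
  have bq: "norm be * norm ga \<le> (1 - p) * (1 - p)" using assms(1-6) by (intro mult_mono) auto
  have e1: "norm be * norm ga = (1 - p) * (1 - p)" using 1 2 bq by (simp add: power2_eq_square)
  have "(1 - norm s)^2 = (1 - p)^2" using 1 2 bq by (simp add: power2_eq_square)
  hence "1 - norm s = 1 - p" by (rule power_eq_imp_eq_base) (use sp assms(1,2) in auto)
  hence e2: "norm al * norm de = p * p" using sn by (simp add: power2_eq_square)
  have tight: "x = c \<and> y = c" if "x \<le> c" "y \<le> c" "0 \<le> x" "0 \<le> y" "0 < c" "x * y = c * c" for x y c :: real
  proof -
    have "x * y \<le> x * c" "x * c \<le> c * c" using that(1-5) by (auto intro: mult_left_mono mult_right_mono)
    hence "x * c = c * c" using that(6) by linarith
    hence x: "x = c" using that(5) by (metis mult_right_cancel less_irrefl)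
    have "y = c" using that(5,6) unfolding x by simp
    thus ?thesis using x by blast
  qed
  show ?thesis using tight[OF _ _ _ _ _ e1] tight[OF _ _ _ _ _ e2] assms(1-6) by auto
qed

text \<open>
  The analytic content of a two-state Markov renewal kernel with stay probability \<open>p\<close> and without
  periodicity: \<open>al, be, ga, de\<close> are its four generating functions and \<open>a1, b1, g1, d1\<close> the
  corresponding mean waiting times.
\<close>
locale renewal_kernel =
  fixes r p a1 b1 g1 d1 :: real and al be ga de :: "complex \<Rightarrow> complex"
  assumes r: "r > 1" and p: "0 < p" "p < 1"
    and hol: "al holomorphic_on ball 0 r" "be holomorphic_on ball 0 r"
             "ga holomorphic_on ball 0 r" "de holomorphic_on ball 0 r"
    and sub: "\<And>z. norm z \<le> 1 \<Longrightarrow> norm (al z) + norm (be z) \<le> norm z"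
             "\<And>z. norm z \<le> 1 \<Longrightarrow> norm (ga z) + norm (de z) \<le> norm z"
    and le: "\<And>z. norm z \<le> 1 \<Longrightarrow> norm (al z) \<le> p" "\<And>z. norm z \<le> 1 \<Longrightarrow> norm (be z) \<le> 1 - p"
            "\<And>z. norm z \<le> 1 \<Longrightarrow> norm (ga z) \<le> 1 - p" "\<And>z. norm z \<le> 1 \<Longrightarrow> norm (de z) \<le> p"
    and at1: "al 1 = of_real p" "be 1 = of_real (1 - p)" "ga 1 = of_real (1 - p)" "de 1 = of_real p"
    and aperiodic: "\<And>z. norm z \<le> 1 \<Longrightarrow> z \<noteq> 1 \<Longrightarrow> norm (al z) = p \<Longrightarrow> norm (be z) = 1 - p \<Longrightarrow>
          norm (ga z) = 1 - p \<Longrightarrow> norm (de z) = p \<Longrightarrow> False"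
    and deriv1: "deriv al 1 = of_real a1" "deriv be 1 = of_real b1" "deriv ga 1 = of_real g1" "deriv de 1 = of_real d1"
    and pos: "a1 + b1 + g1 + d1 > 0"
begin

text \<open>
  \<open>K\<close> is the sum of the two roots of the characteristic equation, and its discriminant equals
  \<open>(1 - z) * \<Theta> z\<close>; the factor \<open>1 - z\<close> is the origin of the square-root singularity. \<open>K1\<close> is the
  difference quotient of \<open>K\<close> at 1, written so that it is visibly holomorphic.
\<close>
definition "S = a1 + b1 + g1 + d1"
abbreviation "q \<equiv> 1 - p"
definition "K z = 1 + al z * de z - be z * ga z"
definition "K1 z = of_real p * (slope_at_1 al z + slope_at_1 de z) - of_real q * (slope_at_1 be z + slope_at_1 ga z)
   - (1 - z) * (slope_at_1 al z * slope_at_1 de z - slope_at_1 be z * slope_at_1 ga z)"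
definition "\<Theta> z = 4 * of_real p * (slope_at_1 al z + slope_at_1 de z - K1 z)
   + (1 - z) * ((K1 z)^2 - 4 * slope_at_1 al z * slope_at_1 de z)"

lemma hol_slopes: "slope_at_1 al holomorphic_on ball 0 r" "slope_at_1 be holomorphic_on ball 0 r"
   "slope_at_1 ga holomorphic_on ball 0 r" "slope_at_1 de holomorphic_on ball 0 r"
  using holomorphic_slope_at_1 hol r by auto

lemma hol_K1: "K1 holomorphic_on ball 0 r"
  unfolding K1_def by (intro holomorphic_intros hol_slopes)

lemma hol_Theta: "\<Theta> holomorphic_on ball 0 r"
  unfolding \<Theta>_def by (intro holomorphic_intros hol_slopes hol_K1)

lemma K_eq: "K z = 2 * of_real p - (1 - z) * K1 z"
  unfolding K_def K1_def
  by (subst (1) slope_at_1_eq[of al], subst (1) slope_at_1_eq[of be], subst (1) slope_at_1_eq[of ga], subst (1) slope_at_1_eq[of de])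
     (simp add: at1 algebra_simps power2_eq_square)

lemma disc_eq: "(K z)^2 - 4 * al z * de z = (1 - z) * \<Theta> z"
proof -
  have *: "al z = of_real p - (1 - z) * slope_at_1 al z" "de z = of_real p - (1 - z) * slope_at_1 de z"
    using slope_at_1_eq[of al z] slope_at_1_eq[of de z] by (simp_all add: at1)
  show ?thesis unfolding K_eq \<Theta>_def * by (simp add: algebra_simps power2_eq_square)
qed

lemma Theta_1: "\<Theta> 1 = of_real (4 * p * q * S)"
  unfolding \<Theta>_def K1_def S_def by (simp add: deriv1 algebra_simps power2_eq_square)

lemma Theta_nonzero:
  assumes "norm z \<le> 1" shows "\<Theta> z \<noteq> 0"
proof (cases "z = 1")
  case True thus ?thesis unfolding True Theta_1 of_real_eq_0_iff using p pos by (simp add: S_def)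
next
  case False
  show ?thesis
  proof
    assume "\<Theta> z = 0"
    hence "(1 + al z * de z - be z * ga z)^2 = 4 * al z * de z"
      using disc_eq[of z] unfolding K_def by simp
    from discriminant_zero_imp_extremal[OF p le(1)[OF assms] le(4)[OF assms] le(2)[OF assms] le(3)[OF assms] this]
    show False using aperiodic[OF assms False] by blast
  qed
qed

lemma vanish_0: "al 0 = 0" "be 0 = 0" "ga 0 = 0" "de 0 = 0"
  using sub[of 0] by (simp_all, (smt (verit) norm_ge_zero zero_less_norm_iff)+)

text \<open>
  \<open>\<Theta>\<close> does not vanish on the closed unit disc, hence on no point of a slightly larger disc, which is
  simply connected. Of the two branches, the one with \<open>R 0 = 1\<close> makes \<open>(K + sqrt (1 - z) * R) / 2\<close>
  the root that equals 1 at the origin.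
\<close>
lemma sqrt_Theta_exists:
  "\<exists>\<rho> R. 1 < \<rho> \<and> \<rho> \<le> r \<and> R holomorphic_on ball 0 \<rho> \<and> (\<forall>z\<in>ball 0 \<rho>. (R z)^2 = \<Theta> z \<and> R z \<noteq> 0) \<and> R 0 = 1"
proof -
  have "open (ball 0 r \<inter> \<Theta> -` (- {0}))"
    using hol_Theta by (intro continuous_open_preimage holomorphic_on_imp_continuous_on) auto
  moreover have "cball 0 1 \<subseteq> ball 0 r \<inter> \<Theta> -` (- {0})" using Theta_nonzero r by auto
  ultimately obtain e where e: "e > 0" "(\<Union>x\<in>cball 0 1. ball x e) \<subseteq> ball 0 r \<inter> \<Theta> -` (- {0})"
    using compact_subset_open_imp_ball_epsilon_subset[OF compact_cball] by metis
  define \<rho> where "\<rho> = min r (1 + e)"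
  have \<rho>: "1 < \<rho>" "\<rho> \<le> r" using r e by (auto simp: \<rho>_def)
  have nz: "\<Theta> z \<noteq> 0" if "z \<in> ball 0 \<rho>" for z
  proof (cases "norm z \<le> 1")
    case True thus ?thesis by (rule Theta_nonzero)
  next
    case False
    define x where "x = z / of_real (norm z)"
    have "norm x = 1" using False by (auto simp: x_def norm_divide)
    moreover have "dist x z < e"
    proof -
      have zx: "z = x * of_real (norm z)" using False by (auto simp: x_def)
      have "x - z = x * of_real (1 - norm z)" by (metis mult.right_neutral of_real_1 of_real_diff right_diff_distrib zx)
      hence "dist x z = norm z - 1" using False \<open>norm x = 1\<close> by (simp add: dist_norm norm_mult del: of_real_diff)
      thus ?thesis using that by (simp add: \<rho>_def)
    qed
    ultimately have "z \<in> (\<Union>x\<in>cball 0 1. ball x e)" by force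
    thus ?thesis using e by blast
  qed
  have "simply_connected (ball (0::complex) \<rho>)" by (simp add: convex_imp_simply_connected)
  moreover have "\<Theta> holomorphic_on ball 0 \<rho>" using hol_Theta \<rho> by (meson holomorphic_on_subset subset_ball)
  ultimately obtain R where R: "R holomorphic_on ball 0 \<rho>" "\<forall>z\<in>ball 0 \<rho>. \<Theta> z = (R z)^2"
    using nz simply_connected_eq_holomorphic_sqrt[OF open_ball] by blast
  have "\<Theta> 0 = 1" using disc_eq[of 0] by (simp add: K_def vanish_0)
  hence "R 0 = 1 \<or> R 0 = - 1" using R \<rho> by (auto simp: power2_eq_1_iff)
  thus ?thesis
  proof
    assume "R 0 = 1" thus ?thesis using R \<rho> nz by (intro exI[of _ \<rho>] exI[of _ R]) auto
  next
    assume "R 0 = -1" thus ?thesis using R \<rho> nz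
      by (intro exI[of _ \<rho>] exI[of _ "\<lambda>z. - R z"]) (auto intro!: holomorphic_intros)
  qed
qed

end

locale rooted_kernel = renewal_kernel +
  fixes \<rho> :: real and R :: "complex \<Rightarrow> complex"
  assumes rho: "1 < \<rho>" "\<rho> \<le> r" and holR: "R holomorphic_on ball 0 \<rho>"
    and R_sq: "\<And>z. z \<in> ball 0 \<rho> \<Longrightarrow> (R z)^2 = \<Theta> z" and R_nz: "\<And>z. z \<in> ball 0 \<rho> \<Longrightarrow> R z \<noteq> 0"
    and R_0: "R 0 = 1"
begin

text \<open>
  The roots of the characteristic equation, and the uniformizing variable \<open>t\<close> at the singularity.
\<close>
definition "t z = csqrt (1 - z)"
definition "big_root z = (K z + t z * R z) / 2"
definition "small_root z = (K z - t z * R z) / 2"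

lemma t_sq: "(t z)^2 = 1 - z" unfolding t_def by simp
lemma t_nz: "norm z < 1 \<Longrightarrow> t z \<noteq> 0" unfolding t_def by auto

lemma roots_product_sum: "norm z < 1 \<Longrightarrow> big_root z * small_root z = al z * de z" "big_root z + small_root z = K z" "big_root z - small_root z = t z * R z"
proof -
  assume z: "norm z < 1"
  have "4 * (big_root z * small_root z) = (K z)^2 - (t z)^2 * (R z)^2" unfolding big_root_def small_root_def by (simp add: field_simps power2_eq_square)
  also have "\<dots> = 4 * (al z * de z)" using R_sq[of z] z rho disc_eq[of z] unfolding t_sq by (simp add: algebra_simps)
  finally show "big_root z * small_root z = al z * de z" by simp
qed (simp_all add: big_root_def small_root_def field_simps)

lemma roots_shifted_product: "norm z < 1 \<Longrightarrow> (1 - big_root z) * (1 - small_root z) = be z * ga z"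
  using roots_product_sum(1)[of z] roots_product_sum(2)[of z] unfolding K_def by (simp add: algebra_simps)

lemma gap:
  assumes "norm z < 1"
  shows "norm (al z) < 1" "norm (de z) < 1" "norm (be z * ga z) < (1 - norm (al z)) * (1 - norm (de z))"
proof -
  have a: "norm (be z) < 1 - norm (al z)" "norm (ga z) < 1 - norm (de z)" using sub[of z] assms by auto
  show "norm (al z) < 1" "norm (de z) < 1" using order_le_less_trans[OF norm_ge_zero a(1)] order_le_less_trans[OF norm_ge_zero a(2)] by linarith+
  show "norm (be z * ga z) < (1 - norm (al z)) * (1 - norm (de z))"
    unfolding norm_mult using a order_le_less_trans[OF norm_ge_zero a(1)] by (intro mult_strict_mono) auto
qed

lemma cont_t: "continuous_on (ball 0 1) t"
  using tame_csqrt unfolding t_def tame_def by (blast intro: holomorphic_on_imp_continuous_on)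

lemma sub1: "ball 0 1 \<subseteq> ball (0::complex) \<rho>" "ball 0 \<rho> \<subseteq> ball (0::complex) r" "ball 0 1 \<subseteq> ball (0::complex) r"
  using rho by (auto intro: subset_ball)

lemma cont_K: "continuous_on (ball 0 r) K"
  unfolding K_def using hol by (intro continuous_intros holomorphic_on_imp_continuous_on)

text \<open>
  The moduli of the two roots never coincide on the disc, and the disc is connected. So the order
  that they have at the origin, where the roots are 1 and 0, persists.
\<close>
lemma small_less_big:
  assumes "norm z < 1" shows "norm (small_root z) < norm (big_root z)"
proof (rule ccontr)
  assume n: "\<not> ?thesis"
  define h where "h = (\<lambda>z. norm (big_root z) - norm (small_root z))"
  have cR: "continuous_on (ball 0 1) R" using holR sub1 by (meson continuous_on_subset holomorphic_on_imp_continuous_on)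
  have cK: "continuous_on (ball 0 1) K" using cont_K sub1 by (meson continuous_on_subset)
  have "continuous_on (ball 0 1) h"
    unfolding h_def big_root_def small_root_def by (intro continuous_intros cK cR cont_t) auto
  hence conn: "connected (h ` ball 0 1)" by (intro connected_continuous_image) auto
  have "h 0 = 1" unfolding h_def big_root_def small_root_def t_def K_def by (simp add: R_0 vanish_0)
  hence "1 \<in> h ` ball 0 1" by (metis centre_in_ball imageI zero_less_one)
  moreover have "h z \<in> h ` ball 0 1" using assms by auto
  moreover have "h z \<le> 0" using n unfolding h_def by simp
  ultimately have "0 \<in> h ` ball 0 1" using connectedD_interval[OF conn, of "h z" 1 0] by simp
  then obtain w where w: "norm w < 1" "norm (big_root w) = norm (small_root w)" unfolding h_def by auto
  show False using complex_gap(1)[OF gap[OF w(1)] roots_product_sum(1)[OF w(1)] roots_shifted_product[OF w(1)]] w by simp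
qed

lemma big_root_dominates:
  assumes "norm z < 1" shows "norm (al z) < norm (big_root z)" "norm (de z) < norm (big_root z)"
  using complex_gap(2)[OF gap[OF assms] roots_product_sum(1)[OF assms] roots_shifted_product[OF assms]] small_less_big[OF assms] by auto

text \<open>
  From \<open>1 = K + be ga - al de\<close> and \<open>\<bar>K\<bar> \<le> 2 \<bar>m\<bar>\<close>, \<open>\<bar>al de\<bar> \<le> \<bar>m\<bar>\<close>, \<open>\<bar>be ga\<bar> \<le> q\<^sup>2 < 1\<close>
  a root \<open>m\<close> with \<open>\<bar>m\<bar> \<le> 1\<close> satisfies \<open>3 \<bar>m\<bar> \<ge> 1 - q\<^sup>2\<close>.
\<close>
lemma big_root_bounded_below: "\<exists>c>0. \<forall>z. norm z < 1 \<longrightarrow> c \<le> norm (big_root z)"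
proof -
  define c where "c = min 1 ((1 - q * q) / 3)"
  have "q * q < 1 * 1" using p by (intro mult_strict_mono) auto
  hence c: "c > 0" unfolding c_def by simp
  have "c \<le> norm (big_root z)" if z: "norm z < 1" for z
  proof (cases "norm (big_root z) \<le> 1")
    case True
    have "norm (al z * de z) \<le> norm (big_root z) * 1"
      unfolding norm_mult using big_root_dominates[OF z] gap[OF z] by (intro mult_mono) auto
    moreover have "norm (be z * ga z) \<le> q * q"
      unfolding norm_mult using le[of z] z p by (intro mult_mono) auto
    moreover have "1 = K z + be z * ga z - al z * de z" unfolding K_def by simp
    hence "1 \<le> norm (K z) + norm (be z * ga z) + norm (al z * de z)"
      by (smt (verit) norm_one norm_triangle_ineq norm_triangle_ineq4)
    moreover have "norm (K z) \<le> 2 * norm (big_root z)"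
      using norm_triangle_ineq[of "big_root z" "small_root z"] small_less_big[OF z] unfolding roots_product_sum(2) by linarith
    ultimately have "1 \<le> 3 * norm (big_root z) + q * q" by linarith
    hence "(1 - q * q) / 3 \<le> norm (big_root z)" by (simp add: field_simps)
    thus ?thesis unfolding c_def by linarith
  next
    case False thus ?thesis unfolding c_def by linarith
  qed
  thus ?thesis using c by blast
qed

text \<open>
  \<open>\<Theta> 1\<close> fixes \<open>R 1\<close> up to its sign. The sign is positive because the larger root is
  \<open>(K + sqrt (1 - z) R) / 2\<close> along the whole radius towards 1: this says that \<open>Re (K * cnj R) \<ge> 0\<close>
  there, and \<open>K\<close> tends to \<open>2 p > 0\<close>.
\<close>
lemma R_1: "R 1 = of_real (sqrt (4 * p * q * S))"
proof -
  define x where "x = sqrt (4 * p * q * S)"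
  have x: "x > 0" using p pos unfolding x_def S_def by simp
  have "(R 1)^2 = (of_real x)^2"
    using R_sq[of 1] rho Theta_1 p pos by (simp add: x_def S_def flip: of_real_power)
  hence R1: "R 1 = of_real x \<or> R 1 = - of_real x" by (simp add: power2_eq_iff)
  have pos': "0 \<le> Re (K (of_real u) * cnj (R (of_real u)))" if u: "0 < u" "u < 1" for u :: real
  proof -
    define z where "z = complex_of_real u"
    have z: "norm z < 1" using u by (simp add: z_def)
    have tz: "t z = of_real (sqrt (1 - u))" unfolding t_def z_def using u by simp
    have "norm (small_root z)^2 \<le> norm (big_root z)^2" using small_less_big[OF z] by (intro power_mono) auto
    \<comment> \<open>polarization: \<open>\<bar>x + y\<bar>\<^sup>2 - \<bar>x - y\<bar>\<^sup>2 = 4 Re (x * cnj y)\<close>\<close>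
    moreover have "norm (big_root z)^2 - norm (small_root z)^2 = Re (K z * cnj (t z * R z))"
      unfolding big_root_def small_root_def cmod_power2 by (simp add: field_simps power2_eq_square)
    ultimately have "0 \<le> Re (K z * cnj (t z * R z))" by linarith
    also have "\<dots> = sqrt (1 - u) * Re (K z * cnj (R z))" unfolding tz by (simp add: algebra_simps)
    finally show ?thesis using u unfolding z_def by (simp add: zero_le_mult_iff)
  qed
  have cont: "isCont (\<lambda>u::real. Re (K (of_real u) * cnj (R (of_real u)))) 1"
  proof -
    have "isCont K (of_real 1)" using cont_K r by (simp add: continuous_on_eq_continuous_at)
    moreover have "isCont R (of_real 1)" using holomorphic_on_imp_continuous_on[OF holR] rho
      by (simp add: continuous_on_eq_continuous_at)
    moreover have "isCont complex_of_real 1" by (intro continuous_intros)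
    ultimately have "isCont (\<lambda>u::real. K (of_real u)) 1" "isCont (\<lambda>u::real. R (of_real u)) 1"
      using isCont_o2[of 1 complex_of_real] by blast+
    thus ?thesis unfolding isCont_def by (intro tendsto_intros)
  qed
  have "((\<lambda>u::real. Re (K (of_real u) * cnj (R (of_real u)))) \<longlongrightarrow> Re (K (of_real 1) * cnj (R (of_real 1)))) (at_left 1)"
    using cont unfolding isCont_def by (rule filterlim_mono) (auto simp: at_le)
  moreover have "eventually (\<lambda>u::real. 0 \<le> Re (K (of_real u) * cnj (R (of_real u)))) (at_left 1)"
    using pos' by (intro eventually_at_leftI[of 0]) auto
  ultimately have "0 \<le> Re (K (of_real 1) * cnj (R (of_real 1)))"
    by (intro tendsto_lowerbound) auto
  hence "0 \<le> 2 * p * Re (R 1)" by (simp add: K_eq)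
  hence "0 \<le> Re (R 1)" using p by (simp add: zero_le_mult_iff)
  thus ?thesis using R1 x unfolding x_def by auto
qed

text \<open>
  \<open>A\<close> and \<open>B\<close> are the values \<open>U 1\<close> and \<open>V (- 1)\<close> of the level system for \<open>J = 1 / (1 - z)\<close>, and \<open>cA\<close>,
  \<open>cB\<close> the coefficients of their \<open>1 / sqrt (1 - z)\<close> terms. \<open>N\<close> and \<open>N'\<close> are
  \<open>1 - K / 2 - be\<close> and \<open>1 - K / 2 - ga\<close> divided by \<open>1 - z\<close>.
\<close>
definition "N z = K1 z / 2 + slope_at_1 be z"
definition "N' z = K1 z / 2 + slope_at_1 ga z"
definition "h z = N z / R z"
definition "h' z = N' z / R z"
definition "A z = inverse (1 - z) * (1 - small_root z - be z) / (big_root z - small_root z)"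
definition "B z = al z / big_root z * (inverse (1 - z) * (ga z - (1 - big_root z)) / (big_root z - small_root z))"
definition "cA = (p * S / 2 + (b1 - g1) / 2) / sqrt (4 * p * q * S)"
definition "cB = (p * S / 2 - S + (b1 - g1) / 2) / sqrt (4 * p * q * S)"

lemma hol_rho: "K1 holomorphic_on ball 0 \<rho>" "slope_at_1 al holomorphic_on ball 0 \<rho>"
  "slope_at_1 be holomorphic_on ball 0 \<rho>" "slope_at_1 ga holomorphic_on ball 0 \<rho>"
  using hol_K1 hol_slopes sub1 holomorphic_on_subset by blast+

lemma hol_h: "h holomorphic_on ball 0 \<rho>" "h' holomorphic_on ball 0 \<rho>"
  unfolding h_def h'_def N_def N'_def using R_nz by (intro holomorphic_intros hol_rho holR; simp)+

lemma K1_1: "K1 1 = of_real (p * (a1 + d1) - q * (b1 + g1))"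
  unfolding K1_def by (simp add: deriv1)

lemma h_1: "h 1 = of_real cA"
proof -
  have "N 1 = of_real (p * S / 2 + (b1 - g1) / 2)"
    unfolding N_def by (simp add: deriv1 K1_1 S_def) (simp add: field_simps)
  thus ?thesis unfolding h_def cA_def R_1 by simp
qed

lemma h'_1: "- h' 1 - R 1 / (4 * of_real p) = of_real cB"
proof -
  define x where "x = sqrt (4 * p * q * S)"
  have x: "x > 0" using p pos unfolding x_def S_def by simp
  have x2: "x * x = 4 * p * q * S" using p pos unfolding x_def S_def by simp
  have "N' 1 = of_real (p * S / 2 + (g1 - b1) / 2)"
    unfolding N'_def by (simp add: deriv1 K1_1 S_def) (simp add: field_simps)
  hence "- h' 1 - R 1 / (4 * of_real p) = of_real (- ((p * S / 2 + (g1 - b1) / 2) / x) - x / (4 * p))"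
    unfolding h'_def R_1 x_def by simp
  also have "x / (4 * p) = q * S / x" using x2 x p by (simp add: field_simps)
  also have "- ((p * S / 2 + (g1 - b1) / 2) / x) - q * S / x = cB"
    unfolding cB_def x_def[symmetric] using x by (simp add: field_simps)
  finally show ?thesis .
qed

text \<open>
  The numerator of \<open>A\<close> is \<open>t R / 2 + t\<^sup>2 N\<close>, as the constant terms cancel at 1.
\<close>
lemma A_expansion:
  assumes "norm z < 1"
  shows "A z - inverse (1 - z) / 2 - of_real cA * inverse (t z) = - (t z * slope_at_1 h z)"
proof -
  have tz: "t z \<noteq> 0" using t_nz[OF assms] .
  have Rz: "R z \<noteq> 0" using R_nz assms rho by simp
  have bez: "be z = of_real q - (1 - z) * slope_at_1 be z" using slope_at_1_eq[of be z] by (simp add: at1)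
  hence num: "1 - small_root z - be z = t z * R z / 2 + (t z)^2 * N z"
    unfolding small_root_def K_eq N_def t_sq bez by (simp add: field_simps)
  have "A z = inverse ((t z)^2) * (t z * R z / 2 + (t z)^2 * N z) / (t z * R z)"
    unfolding A_def num roots_product_sum(3) t_sq ..
  also have "\<dots> = inverse ((t z)^2) / 2 + h z * inverse (t z)"
    using tz Rz unfolding h_def by (simp add: field_simps power2_eq_square)
  also have "h z = of_real cA - (t z)^2 * slope_at_1 h z"
    unfolding t_sq h_1[symmetric] by (rule slope_at_1_eq)
  finally have "A z = inverse ((t z)^2) / 2 + of_real cA * inverse (t z) - t z * slope_at_1 h z * (t z * inverse (t z))"
    by (simp add: algebra_simps power2_eq_square)
  thus ?thesis using tz by (simp add: t_sq)
qed

text \<open>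
  The quotients \<open>(al - m) / t\<close> and \<open>(p - m) / t\<close> for the larger root \<open>m\<close>, in a form in which their
  tameness is visible.
\<close>
definition "W z = - R z / 2 + t z * (K1 z / 2 - slope_at_1 al z)"
definition "V z = t z * K1 z / 2 - R z / 2"

text \<open>
  \<open>B\<close> has the extra factor \<open>al / m = 1 + t W / m\<close>, which contributes to the singular term through
  \<open>W / (2 t m)\<close>. There \<open>1 / m\<close> is replaced by \<open>1 / p + t V / (p m)\<close>, and the exact first-order
  expansions of \<open>R\<close> and \<open>h'\<close> at 1 separate the multiple of \<open>1 / t\<close> from the tame rest.
\<close>
lemma B_expansion:
  assumes "norm z < 1"
  shows "B z - inverse (1 - z) / 2 - of_real cB * inverse (t z) =
    t z * slope_at_1 h' z + t z * slope_at_1 R z * of_real (1 / (4 * p))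
    + (K1 z / 2 - slope_at_1 al z) * of_real (1 / (2 * p))
    + W z * V z * inverse (big_root z) * of_real (1 / (2 * p)) - W z * h' z * inverse (big_root z)"
proof -
  have tz: "t z \<noteq> 0" using t_nz[OF assms] .
  have Rz: "R z \<noteq> 0" using R_nz assms rho by simp
  have mz: "big_root z \<noteq> 0" using big_root_dominates[OF assms] by auto
  have pz: "complex_of_real p \<noteq> 0" using p by simp
  define i where "i = inverse (big_root z)"
  define ip where "ip = inverse (complex_of_real p)"
  define it where "it = inverse (t z)"
  have it: "t z * it = 1" "(t z)^2 * it = t z" "inverse ((t z)^2) = it^2" using tz unfolding it_def by (auto simp: power2_eq_square)
  have gaz: "ga z = of_real q - (1 - z) * slope_at_1 ga z" using slope_at_1_eq[of ga z] by (simp add: at1)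
  hence num: "ga z - (1 - big_root z) = t z * R z / 2 - (t z)^2 * N' z"
    unfolding big_root_def K_eq N'_def t_sq gaz by (simp add: field_simps)
  have alm: "al z = big_root z + t z * W z"
  proof -
    have alz: "al z = of_real p - (t z)^2 * slope_at_1 al z" using slope_at_1_eq[of al z] by (simp add: at1 t_sq)
    show ?thesis unfolding W_def big_root_def K_eq t_sq[of z, symmetric] alz by (simp add: field_simps power2_eq_square)
  qed
  have frac: "al z / big_root z = 1 + t z * W z * i" unfolding alm i_def using mz by (simp add: field_simps)
  have pm: "of_real p = big_root z + t z * V z"
    unfolding V_def big_root_def K_eq t_sq[of z, symmetric] by (simp add: field_simps power2_eq_square)
  have ieq: "i = ip + t z * V z * i * ip"
  proof -
    have "i = i * (of_real p * ip)" using pz unfolding ip_def by simp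
    also have "\<dots> = i * ((big_root z + t z * V z) * ip)" using pm by simp
    also have "\<dots> = ip + t z * V z * i * ip" using mz unfolding i_def by (simp add: field_simps)
    finally show ?thesis .
  qed
  have inner: "inverse (1 - z) * (ga z - (1 - big_root z)) / (big_root z - small_root z) = it^2 / 2 - h' z * it"
    unfolding num roots_product_sum(3) t_sq[of z, symmetric] it_def h'_def using tz Rz by (simp add: field_simps power2_eq_square)
  have "B z = (1 + t z * W z * i) * (it^2 / 2 - h' z * it)" unfolding B_def frac inner ..
  also have "\<dots> = it^2 / 2 - h' z * it + W z * i * it / 2 * (t z * it) - W z * i * h' z * (t z * it)"
    by (simp add: algebra_simps power2_eq_square)
  also have "\<dots> = it^2 / 2 - h' z * it + W z * i * it / 2 - W z * i * h' z" by (simp add: it)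
  also have "W z * i * it / 2 = W z * it * ip / 2 + W z * V z * i * ip / 2 * (t z * it)"
    by (subst ieq) (simp add: algebra_simps)
  also have "\<dots> = W z * it * ip / 2 + W z * V z * i * ip / 2" by (simp add: it)
  also have "W z * it * ip / 2 = - R z * it * ip / 4 + (K1 z / 2 - slope_at_1 al z) * ip / 2 * (t z * it)"
    unfolding W_def by (simp add: field_simps)
  also have "\<dots> = - R z * it * ip / 4 + (K1 z / 2 - slope_at_1 al z) * ip / 2" by (simp add: it)
  finally have Bz: "B z = it^2 / 2 - h' z * it + (- R z * it * ip / 4 + (K1 z / 2 - slope_at_1 al z) * ip / 2
      + W z * V z * i * ip / 2) - W z * i * h' z" .
  have hz: "h' z * it = h' 1 * it - t z * slope_at_1 h' z"
  proof -
    have "h' z * it = (h' 1 - (t z)^2 * slope_at_1 h' z) * it" unfolding t_sq by (subst slope_at_1_eq) simp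
    also have "\<dots> = h' 1 * it - ((t z)^2 * it) * slope_at_1 h' z" by (simp add: algebra_simps)
    finally show ?thesis unfolding it(2) .
  qed
  have Rz': "R z * it = R 1 * it - t z * slope_at_1 R z"
  proof -
    have "R z * it = (R 1 - (t z)^2 * slope_at_1 R z) * it" unfolding t_sq by (subst slope_at_1_eq) simp
    also have "\<dots> = R 1 * it - ((t z)^2 * it) * slope_at_1 R z" by (simp add: algebra_simps)
    finally show ?thesis unfolding it(2) .
  qed
  have cb: "of_real cB = - h' 1 - R 1 * ip / 4" unfolding h'_1[symmetric] ip_def by (simp add: field_simps)
  have e: "of_real (1 / (4 * p)) = ip / 4" "of_real (1 / (2 * p)) = ip / 2" "inverse (big_root z) = i" "inverse (t z) = it"
    "inverse (1 - z) = it^2"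
    unfolding ip_def i_def it_def t_sq[symmetric] by (simp_all add: field_simps)
  have "- R z * it * ip / 4 = - (R z * it) * ip / 4" by simp
  hence Rz'': "- R z * it * ip / 4 = - (R 1 * it - t z * slope_at_1 R z) * ip / 4" by (simp only: Rz')
  show ?thesis unfolding e cb Bz hz Rz'' by (simp add: field_simps)
qed

lemma tame_t: "tame t" using tame_csqrt unfolding t_def[abs_def] .

lemma tame_hol_rho: "f holomorphic_on ball 0 \<rho> \<Longrightarrow> tame f"
  using tame_holomorphic rho by blast

lemma tame_big_root: "tame big_root"
proof -
  have "K holomorphic_on ball 0 r" unfolding K_def by (intro holomorphic_intros hol)
  hence "K holomorphic_on ball 0 \<rho>" using sub1 holomorphic_on_subset by blast
  hence "tame (\<lambda>z. (K z + t z * R z) * (1/2))"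
    by (intro tame_mult tame_add tame_t tame_hol_rho holR tame_const)
  thus ?thesis by (rule tame_cong) (simp add: big_root_def)
qed

lemma tame_inverse_big_root: "tame (\<lambda>z. inverse (big_root z))"
  using big_root_bounded_below tame_inverse[OF tame_big_root] by blast

lemma tame_A: "tame (\<lambda>z. A z - inverse (1 - z) / 2 - of_real cA * inverse (t z))"
proof (rule tame_cong)
  show "tame (\<lambda>z. - (t z * slope_at_1 h z))"
    using hol_h holomorphic_slope_at_1 rho by (intro tame_uminus tame_mult tame_t tame_hol_rho) auto
qed (simp add: A_expansion)

lemma tame_B: "tame (\<lambda>z. B z - inverse (1 - z) / 2 - of_real cB * inverse (t z))"
proof (rule tame_cong)
  have s: "slope_at_1 h' holomorphic_on ball 0 \<rho>" "slope_at_1 R holomorphic_on ball 0 \<rho>"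
    using hol_h holR holomorphic_slope_at_1 rho by auto
  have k: "(\<lambda>z. K1 z / 2 - slope_at_1 al z) holomorphic_on ball 0 \<rho>" by (intro holomorphic_intros hol_rho) auto
  have "tame (\<lambda>z. R z * (-1/2) + t z * (K1 z / 2 - slope_at_1 al z))"
    by (intro tame_add tame_mult tame_t tame_hol_rho k holR tame_const)
  hence W: "tame W" by (rule tame_cong) (simp add: W_def)
  have "tame (\<lambda>z. t z * (K1 z * (1/2)) + R z * (-1/2))"
    by (intro tame_add tame_mult tame_t tame_hol_rho hol_rho holR tame_const)
  hence V: "tame V" by (rule tame_cong) (simp add: V_def)
  show "tame (\<lambda>z. t z * slope_at_1 h' z + t z * slope_at_1 R z * of_real (1 / (4 * p))
    + (K1 z / 2 - slope_at_1 al z) * of_real (1 / (2 * p))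
    + W z * V z * inverse (big_root z) * of_real (1 / (2 * p)) - W z * h' z * inverse (big_root z))"
    by (intro tame_add tame_mult tame_diff[OF _ tame_mult[OF tame_mult]] tame_t tame_const W V tame_inverse_big_root tame_hol_rho s k hol_h)
qed (simp only: B_expansion)

text \<open>
  \<open>ra\<close> and \<open>rb\<close> are the generating functions of the first hit from an arbitrary start. Only their
  values at 1 matter for the singular term, since \<open>ra + rb - 1\<close> vanishes at 1 and cancels the
  pole of \<open>1 / (2 (1 - z))\<close>.
\<close>
theorem tame_mixture:
  fixes ra rb :: "complex \<Rightarrow> complex" and pa pb :: real
  assumes "ra holomorphic_on ball 0 r" "rb holomorphic_on ball 0 r"
    and ra: "ra 1 = of_real pa" and rb: "rb 1 = of_real pb" and pab: "pa + pb = 1"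
  shows "tame (\<lambda>z. (ra z * A z + rb z * B z - inverse (1 - z) / 2)
    - of_real (((p / 2 - pb) * S + (b1 - g1) / 2) / sqrt (4 * p * q * S)) * inverse (csqrt (1 - z)))"
    (is "tame (\<lambda>z. _ - of_real ?c * _)")
proof (rule tame_cong)
  have hr: "tame ra" "tame rb" "tame (slope_at_1 ra)" "tame (slope_at_1 rb)"
    using assms r holomorphic_slope_at_1 tame_holomorphic by auto
  show "tame (\<lambda>z. ra z * (A z - inverse (1 - z) / 2 - of_real cA * inverse (t z))
      + rb z * (B z - inverse (1 - z) / 2 - of_real cB * inverse (t z))
      - (slope_at_1 ra z + slope_at_1 rb z) * (1/2)
      - t z * (slope_at_1 ra z * of_real cA + slope_at_1 rb z * of_real cB))"
    by (intro tame_diff tame_add tame_mult[OF hr(1) tame_A] tame_mult[OF hr(2) tame_B] tame_mult[OF tame_t] tame_mult hr tame_const)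
  fix z :: complex assume z: "norm z < 1"
  have tz: "t z \<noteq> 0" using t_nz[OF z] .
  define it where "it = inverse (t z)"
  have it: "(t z)^2 * it^2 = 1" "(t z)^2 * it = t z" using tz unfolding it_def by (auto simp: power2_eq_square field_simps)
  have e: "inverse (1 - z) = it^2" "inverse (csqrt (1 - z)) = it" "inverse (t z) = it"
    unfolding it_def t_sq[symmetric] by (simp_all add: power_inverse t_def)
  have r1: "ra z = of_real pa - (t z)^2 * slope_at_1 ra z" "rb z = of_real pb - (t z)^2 * slope_at_1 rb z"
    using slope_at_1_eq[of ra z] slope_at_1_eq[of rb z] unfolding t_sq ra rb by simp_all
  have s: "sqrt (4 * p * q * S) \<noteq> 0" using p pos by (simp add: S_def)
  have "?c = ((p * S / 2 + (b1 - g1) / 2) * pa + (p * S / 2 - S + (b1 - g1) / 2) * pb) / sqrt (4 * p * q * S)"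
  proof -
    have pa: "pa = 1 - pb" using pab by simp
    have "(p / 2 - pb) * S + (b1 - g1) / 2 = (p * S / 2 + (b1 - g1) / 2) * (1 - pb) + (p * S / 2 - S + (b1 - g1) / 2) * pb"
      by (simp add: field_simps)
    thus ?thesis unfolding pa by simp
  qed
  moreover have "(x * pa + y * pb) / w = pa * (x / w) + pb * (y / w)" for x y w
    by (simp add: add_divide_distrib mult.commute)
  ultimately have c: "?c = pa * cA + pb * cB" unfolding cA_def cB_def by simp
  have 1: "ra z * (it^2 / 2) + rb z * (it^2 / 2) = it^2 / 2 - (slope_at_1 ra z + slope_at_1 rb z) * (1/2)"
  proof -
    have "ra z * (it^2 / 2) + rb z * (it^2 / 2) = of_real (pa + pb) * (it^2 / 2)
       - (slope_at_1 ra z + slope_at_1 rb z) * ((t z)^2 * it^2 / 2)"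
      unfolding r1 by (simp add: algebra_simps)
    thus ?thesis using it pab by simp
  qed
  have 2: "ra z * (of_real cA * it) + rb z * (of_real cB * it) = of_real (pa * cA + pb * cB) * it
      - t z * (slope_at_1 ra z * of_real cA + slope_at_1 rb z * of_real cB)"
  proof -
    have "ra z * (of_real cA * it) + rb z * (of_real cB * it) = of_real (pa * cA + pb * cB) * it
      - ((t z)^2 * it) * (slope_at_1 ra z * of_real cA + slope_at_1 rb z * of_real cB)"
      unfolding r1 by (simp add: algebra_simps)
    thus ?thesis using it by simp
  qed
  have "ra z * (A z - it^2 / 2 - of_real cA * it) + rb z * (B z - it^2 / 2 - of_real cB * it)
     = ra z * A z + rb z * B z - (ra z * (it^2 / 2) + rb z * (it^2 / 2)) - (ra z * (of_real cA * it) + rb z * (of_real cB * it))"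
    by (simp add: algebra_simps)
  thus "ra z * (A z - inverse (1 - z) / 2 - of_real cA * inverse (t z))
      + rb z * (B z - inverse (1 - z) / 2 - of_real cB * inverse (t z))
      - (slope_at_1 ra z + slope_at_1 rb z) * (1/2)
      - t z * (slope_at_1 ra z * of_real cA + slope_at_1 rb z * of_real cB)
      = (ra z * A z + rb z * B z - inverse (1 - z) / 2) - of_real ?c * inverse (csqrt (1 - z))"
    unfolding e 1 2 c by simp
qed

end

section \<open>Words and first hits\<close>

text \<open>
  The block of ones followed by zeros is not a proper power, so everything that commutes with it is a
  power of it. A proper overlap \<open>X @ us = us @ X\<close> of the block with itself would have \<open>X\<close> end in
  a zero and \<open>us\<close> begin with a one, against the block being sorted.
\<close>
lemma commute_with_block:
  fixes X :: "bool list"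
  defines "Z \<equiv> \<lambda>k l. replicate l True @ replicate k False"
  assumes "k \<ge> 1" "l \<ge> 1" "X @ Z k l = Z k l @ X"
  shows "\<exists>n. X = concat (replicate n (Z k l))"
  using assms(4)
proof (induction "length X" arbitrary: X rule: less_induct)
  case less
  let ?Z = "Z k l"
  have Zne: "?Z \<noteq> []" using assms(2) by (simp add: Z_def)
  show ?case
  proof (cases "X = []")
    case True thus ?thesis by (intro exI[of _ 0]) simp
  next
    case False
    from less.prems consider us where "X = ?Z @ us" "us @ ?Z = X" | us where "X @ us = ?Z" "?Z = us @ X"
      by (auto simp: append_eq_append_conv2)
    thus ?thesis
    proof cases
      case 1
      have "length us < length X" using 1(1) Zne by simp
      moreover have "us @ ?Z = ?Z @ us" using 1 by simp
      ultimately obtain n where "us = concat (replicate n ?Z)" using less.hyps by blast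
      thus ?thesis using 1 by (intro exI[of _ "Suc n"]) simp
    next
      case 2
      show ?thesis
      proof (cases "us = []")
        case True thus ?thesis using 2 by (intro exI[of _ 1]) simp
      next
        case us: False
        have "hd us = hd ?Z" using 2(2) us by simp
        moreover have "hd ?Z = True" using assms(3) by (cases l) (auto simp: Z_def)
        ultimately have h: "True \<in> set us" using us hd_in_set by metis
        have "last X = last ?Z" using 2(2) False by simp
        moreover have "last ?Z = False" using assms(2) by (simp add: Z_def)
        ultimately have t: "False \<in> set X" using False last_in_set by metis
        have "sorted_wrt (\<ge>) (replicate i e)" for i and e :: bool by (induction i) auto
        hence "sorted_wrt (\<ge>) ?Z" by (auto simp: Z_def sorted_wrt_append)
        hence "sorted_wrt (\<ge>) (X @ us)" using 2(1) by simp
        thus ?thesis using h t by (auto simp: sorted_wrt_append)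
      qed
    qed
  qed
qed

text \<open>
  The two decompositions of \<open>u\<close> do not overlap, so \<open>u = 0\<^sup>k X 1\<^sup>l\<close> and \<open>w = X 1\<^sup>l 0\<^sup>k = 1\<^sup>l 0\<^sup>k X\<close>.
  Hence \<open>X\<close> is a power of \<open>1\<^sup>l 0\<^sup>k\<close>, and then \<open>u\<close> and \<open>w\<close> are the same power of \<open>0\<^sup>k 1\<^sup>l\<close> and of its
  reversal \<open>1\<^sup>l 0\<^sup>k\<close>.
\<close>
lemma rev_of_block_rotations:
  assumes u: "u = replicate k False @ u1" "u = u2 @ replicate l True"
    and w: "w = u1 @ replicate k False" "w = replicate l True @ u2" and kl: "k \<ge> 1" "l \<ge> 1"
  shows "w = rev u"
proof -
  obtain X where X: "u2 = replicate k False @ X" "u1 = X @ replicate l True"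
  proof -
    from u have "replicate k False @ u1 = u2 @ replicate l True" by simp
    then consider us where "replicate k False = u2 @ us" "us @ u1 = replicate l True"
      | us where "replicate k False @ us = u2" "u1 = us @ replicate l True"
      by (auto simp: append_eq_append_conv2)
    thus ?thesis
    proof cases
      case 1
      have "us = []"
      proof (rule ccontr)
        assume "us \<noteq> []"
        hence "hd us \<in> set (replicate k False)" "hd us \<in> set (replicate l True)"
          using 1 by (metis hd_in_set Un_iff set_append)+
        thus False by simp
      qed
      thus ?thesis using 1 that[of "[]"] by simp
    next
      case 2 thus ?thesis using that[of us] by simp
    qed
  qed
  let ?Z = "replicate l True @ replicate k False"
  have "X @ ?Z = ?Z @ X" using w X by simp
  then obtain n where n: "X = concat (replicate n ?Z)" using commute_with_block[OF kl] by auto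
  have revX: "rev X = concat (replicate n (replicate k False @ replicate l True))"
    unfolding n by (simp add: rev_concat)
  have slide: "replicate l True @ concat (replicate n (replicate k False @ replicate l True)) @ replicate k False
     = concat (replicate (Suc n) ?Z)" for n
    by (induction n) auto
  have "rev u = replicate l True @ rev X @ replicate k False" using u(1) X by simp
  also have "\<dots> = concat (replicate (Suc n) ?Z)" unfolding revX by (rule slide)
  also have "concat (replicate (Suc n) ?Z) = concat (replicate n ?Z) @ ?Z"
    by (metis concat.simps concat_append append_Nil2 replicate_Suc replicate_append_same)
  also have "\<dots> = w" using w X n by simp
  finally show ?thesis ..
qed

definition advance :: "bool list \<Rightarrow> bool \<Rightarrow> bool list" where
  "advance x c = tl x @ [c]"

definition avg :: "(bool list \<Rightarrow> real) \<Rightarrow> bool list \<Rightarrow> real" where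
  "avg g x = (g (advance x False) + g (advance x True)) / 2"

lemma length_advance: "x \<noteq> [] \<Longrightarrow> length (advance x c) = length x"
  by (simp add: advance_def)

lemma foldl_advance: "x \<noteq> [] \<Longrightarrow> foldl advance x w = drop (length w) (x @ w)"
proof (induction w arbitrary: x)
  case (Cons c w)
  have "foldl advance x (c # w) = drop (length w) ((tl x @ [c]) @ w)"
  proof -
    have "advance x c \<noteq> []" by (simp add: advance_def)
    from Cons.IH[OF this] show ?thesis unfolding foldl_Cons by (simp only: advance_def[of x c])
  qed
  also have "\<dots> = drop (length (c # w)) (x @ c # w)" using Cons.prems by (cases x) auto
  finally show ?case .
qed simp

lemma avg_mono: "(\<And>c. g (advance x c) \<le> h (advance x c)) \<Longrightarrow> avg g x \<le> avg h x"
  by (auto simp: avg_def intro!: divide_right_mono add_mono)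

lemma avg_ge: "(\<And>y. g y \<ge> 0) \<Longrightarrow> avg g x \<ge> g (advance x c) / 2"
  by (cases c) (auto simp: avg_def)

lemma sum_lists_Cons: "(\<Sum>w | length w = Suc n. f w) = (\<Sum>w | length w = n. f (False # w) + f (True # w))"
  for f :: "bool list \<Rightarrow> 'b::comm_monoid_add"
proof -
  have fin: "finite {w::bool list. length w = n}" using finite_lists_length_eq[of "UNIV :: bool set" n] by simp
  have "{w::bool list. length w = Suc n} = (#) False ` {w. length w = n} \<union> (#) True ` {w. length w = n}"
  proof (intro set_eqI iffI)
    fix w :: "bool list" assume "w \<in> {w. length w = Suc n}"
    then obtain c u where "w = c # u" "length u = n" by (auto simp: length_Suc_conv)
    thus "w \<in> (#) False ` {w. length w = n} \<union> (#) True ` {w. length w = n}" by (cases c) auto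
  qed auto
  hence "(\<Sum>w | length w = Suc n. f w) = sum f ((#) False ` {w. length w = n}) + sum f ((#) True ` {w. length w = n})"
    using fin by (simp only:) (rule sum.union_disjoint, auto)
  also have "\<dots> = (\<Sum>w | length w = n. f (False # w)) + (\<Sum>w | length w = n. f (True # w))"
    by (simp add: sum.reindex)
  finally show ?thesis by (simp add: sum.distrib)
qed

lemma sum_lists_snoc: "(\<Sum>w | length w = Suc n. f w) = (\<Sum>w | length w = n. f (w @ [False]) + f (w @ [True]))"
  for f :: "bool list \<Rightarrow> 'b::comm_monoid_add"
proof -
  have r: "(\<Sum>w | length w = m. g (rev w)) = (\<Sum>w | length w = m. g w)" for g :: "bool list \<Rightarrow> 'b" and m
    by (rule sum.reindex_bij_witness[of _ rev rev]) auto
  have "(\<Sum>w | length w = Suc n. f w) = (\<Sum>w | length w = Suc n. f (rev w))" by (rule r[symmetric])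
  also have "\<dots> = (\<Sum>w | length w = n. f (rev w @ [False]) + f (rev w @ [True]))" by (simp add: sum_lists_Cons)
  also have "\<dots> = (\<Sum>w | length w = n. f (w @ [False]) + f (w @ [True]))" by (rule r)
  finally show ?thesis .
qed

text \<open>
  Every word is reached from exactly two words, with probability 1/2 each: the uniform distribution
  is stationary for the moving window.
\<close>
lemma avg_stationary:
  assumes "L \<ge> 1"
  shows "(\<Sum>x | length x = L. avg g x) = (\<Sum>x | length x = L. g x)"
proof -
  obtain n where L: "L = Suc n" using assms by (cases L) auto
  show ?thesis unfolding L
    by (subst sum_lists_Cons, subst sum_lists_snoc) (auto simp: avg_def advance_def intro!: sum.cong)
qed

locale word_pair =
  fixes L :: nat and a b :: "bool list"
  assumes L: "L \<ge> 1" and len: "length a = L" "length b = L" and ab: "a \<noteq> b"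
begin

text \<open>
  Probabilities for the letters that follow a window \<open>x\<close>: \<open>hit t x c\<close> that \<open>{a, b}\<close> is hit for the
  first time after exactly \<open>t \<ge> 1\<close> steps, at \<open>c\<close>; \<open>nohit t x\<close> that it is not hit during \<open>t\<close> steps; and,
  below, \<open>exceed t x k\<close> that after \<open>t\<close> steps the later hits of \<open>a\<close> exceed those of \<open>b\<close> by more than \<open>- k\<close>.
\<close>
primrec hit :: "nat \<Rightarrow> bool list \<Rightarrow> bool list \<Rightarrow> real" where
  "hit 0 = (\<lambda>x c. 0)"
| "hit (Suc t) = (\<lambda>x c. avg (\<lambda>y. if y \<in> {a, b} then of_bool (t = 0 \<and> y = c) else hit t y c) x)"

primrec nohit :: "nat \<Rightarrow> bool list \<Rightarrow> real" where
  "nohit 0 = (\<lambda>x. 1)"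
| "nohit (Suc t) = (\<lambda>x. avg (\<lambda>y. if y \<in> {a, b} then 0 else nohit t y) x)"

definition sgn_word :: "bool list \<Rightarrow> int" where
  "sgn_word y = of_bool (y = a) - of_bool (y = b)"

primrec exceed :: "nat \<Rightarrow> bool list \<Rightarrow> int \<Rightarrow> real" where
  "exceed 0 = (\<lambda>x k. of_bool (k > 0))"
| "exceed (Suc t) = (\<lambda>x k. avg (\<lambda>y. exceed t y (k + sgn_word y)) x)"

lemma hit_nonneg: "hit t x c \<ge> 0"
  by (induction t arbitrary: x) (auto simp: avg_def)

lemma nohit_bounds: "0 \<le> nohit t x" "nohit t x \<le> 1"
proof (induction t arbitrary: x)
  case (Suc t)
  { case 1 thus ?case using Suc by (auto simp: avg_def) }
  { case 2 thus ?case using Suc(2)[of "advance x False"] Suc(2)[of "advance x True"] by (auto simp: avg_def) }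
qed auto

lemma exceed_bounds: "0 \<le> exceed t x k" "exceed t x k \<le> 1"
proof (induction t arbitrary: x k)
  case (Suc t)
  { case 1 thus ?case using Suc by (auto simp: avg_def) }
  { case 2 thus ?case using Suc(2)[of "advance x False"] Suc(2)[of "advance x True"]
    by (auto simp: avg_def) (smt (verit) Suc(2)) }
qed auto

lemma abs_exceed_le: "\<bar>exceed t x k\<bar> \<le> 1"
  using exceed_bounds[of t x k] by auto

lemma hit_step_pos:
  assumes "advance x e \<notin> {a, b}" "hit j (advance x e) c > 0" shows "hit (Suc j) x c > 0"
proof -
  have "hit (Suc j) x c \<ge> hit j (advance x e) c / 2"
    using avg_ge[of "\<lambda>y. if y \<in> {a, b} then of_bool (j = 0 \<and> y = c) else hit j y c" x e] assms hit_nonneg by auto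
  thus ?thesis using assms by auto
qed

lemma hit_one_pos:
  assumes "advance x e = c" "c \<in> {a, b}" shows "hit 1 x c > 0"
proof -
  let ?g = "\<lambda>y. if y \<in> {a, b} then of_bool ((0::nat) = 0 \<and> y = c) else hit 0 y c"
  have "?g (advance x e) / 2 \<le> avg ?g x" by (rule avg_ge) auto
  moreover have "?g (advance x e) = 1" using assms by simp
  moreover have "hit 1 x c = avg ?g x" by simp
  ultimately show ?thesis by linarith
qed

text \<open>
  A walk from \<open>x\<close> to \<open>c\<close> that avoids \<open>c'\<close> in between may visit \<open>c\<close> earlier; its first visit is a
  first hit of the pair.
\<close>
lemma hit_pos_of_walk:
  assumes "w \<noteq> []" "foldl advance x w = c" "{c, c'} = {a, b}"
    "\<And>i. 0 < i \<Longrightarrow> i < length w \<Longrightarrow> foldl advance x (take i w) \<noteq> c'"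
  shows "\<exists>j. hit j x c > 0"
  using assms
proof (induction w arbitrary: x)
  case (Cons e w)
  let ?y = "advance x e"
  show ?case
  proof (cases "?y = c")
    case True thus ?thesis using hit_one_pos[of x e c] Cons.prems(3) by blast
  next
    case False
    hence w: "w \<noteq> []" using Cons.prems by auto
    have nc': "?y \<noteq> c'" using Cons.prems(4)[of 1] w by (cases w) auto
    have "foldl advance ?y (take i w) \<noteq> c'" if "0 < i" "i < length w" for i
      using Cons.prems(4)[of "Suc i"] that by simp
    then obtain j where "hit j ?y c > 0" using Cons.IH[OF w, of ?y] Cons.prems by auto
    thus ?thesis using hit_step_pos[of x e j c] False nc' Cons.prems(3) by blast
  qed
qed simp

lemma walk_from:
  assumes "length x = L" shows "foldl advance x w = drop (length w) (x @ w)"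
  using foldl_advance[of x w] L assms by fastforce

text \<open>
  If every run from \<open>a\<close> to \<open>a\<close> meets \<open>b\<close>, then so do the runs spelled by \<open>a a\<close> and by
  \<open>a c\<^sup>L a\<close>. The first one makes \<open>b\<close> a rotation of \<open>a\<close>, so that it has as many letters of each kind. In
  the second one \<open>b\<close> overlaps the block of \<open>c\<close>, and the part of \<open>a\<close> that it misses must
  then consist of letters \<open>c\<close> only.
\<close>
lemma recurrent_rotation:
  assumes "\<And>j. hit j a a = 0"
  shows "\<exists>k a1. k \<ge> 1 \<and> ((a = replicate k c @ a1 \<and> b = a1 @ replicate k c) \<or>
                         (a = a1 @ replicate k c \<and> b = replicate k c @ a1))"
proof -
  have meets: "\<exists>i>0. i < length w \<and> drop i (a @ take i w) = b" if "w \<noteq> []" "drop (length w) (a @ w) = a" for w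
  proof (rule ccontr)
    assume n: "\<not> ?thesis"
    have "\<exists>j. hit j a a > 0"
    proof (rule hit_pos_of_walk[OF that(1), of _ _ b])
      show "foldl advance a w = a" using that walk_from[OF len(1)] by simp
      fix i assume "0 < i" "i < length w"
      thus "foldl advance a (take i w) \<noteq> b" using n walk_from[OF len(1), of "take i w"] by (auto simp: min_def)
    qed auto
    thus False using assms by auto
  qed
  have "a \<noteq> []" using L len by auto
  then obtain i where i: "0 < i" "i < L" "drop i (a @ take i a) = b" using meets[of a] len by auto
  have bcount: "count_list b e = count_list a e" for e
  proof -
    have "b = drop i a @ take i a" using i len by simp
    hence "count_list b e = count_list (take i a @ drop i a) e" by (simp only: count_list_append add.commute)
    thus ?thesis by simp
  qed
  have allc: "xs = replicate (length xs) c" if "count_list xs (\<not> c) = 0" for xs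
  proof -
    have "(\<not> c) \<notin> set xs" using that by (simp add: count_list_0_iff)
    moreover have "e = c \<or> e = (\<not> c)" for e by (cases e; cases c) auto
    ultimately have "\<forall>e\<in>set xs. e = c" by blast
    thus ?thesis by (rule replicate_length_same[symmetric])
  qed
  have r0: "count_list (replicate m c) (\<not> c) = 0" for m by (induction m) auto
  let ?w = "replicate L c @ a"
  obtain j where j: "0 < j" "j < length ?w" "drop j (a @ take j ?w) = b" using meets[of ?w] \<open>a \<noteq> []\<close> len by auto
  show ?thesis
  \<comment> \<open>\<open>b\<close> overlaps either the first or the second copy of \<open>a\<close>\<close>
  proof (cases "j \<le> L")
    case True
    hence b: "b = drop j a @ replicate j c" using j len by simp
    have "count_list (take j a @ drop j a) (\<not> c) = count_list (drop j a @ replicate j c) (\<not> c)"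
      using bcount[of "\<not> c"] b by simp
    hence "count_list (take j a) (\<not> c) = 0" unfolding count_list_append r0 by linarith
    hence "take j a = replicate j c" using allc[of "take j a"] True len by (simp add: min_def)
    hence "a = replicate j c @ drop j a" by (metis append_take_drop_id)
    thus ?thesis using b j by (intro exI[of _ j] exI[of _ "drop j a"]) auto
  next
    case False
    define k where "k = j - L"
    have k: "j = L + k" "k < L" using False j len by (auto simp: k_def)
    have b: "b = replicate (L - k) c @ take k a" using j(3) k len by simp
    have "count_list (take k a @ drop k a) (\<not> c) = count_list (replicate (L - k) c @ take k a) (\<not> c)"
      using bcount[of "\<not> c"] b by simp
    hence "count_list (drop k a) (\<not> c) = 0" unfolding count_list_append r0 by linarith
    hence "drop k a = replicate (L - k) c" using allc[of "drop k a"] len by simp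
    hence "a = take k a @ replicate (L - k) c" by (metis append_take_drop_id)
    thus ?thesis using b k by (intro exI[of _ "L - k"] exI[of _ "take k a"]) auto
  qed
qed

text \<open>
  Otherwise \<open>b\<close> arises from \<open>a\<close> by moving a block of zeros from one end to the other, and also by moving
  a block of ones. As a word cannot begin (or end) with both, the two moves go in opposite
  directions.
\<close>
lemma return_possible:
  assumes "b \<noteq> rev a" shows "\<exists>j. hit j a a > 0"
proof (rule ccontr)
  assume "\<not> ?thesis"
  hence z: "\<And>j. hit j a a = 0" using hit_nonneg by (metis antisym_conv2 not_less)
  obtain k a1 where k: "k \<ge> 1" "(a = replicate k False @ a1 \<and> b = a1 @ replicate k False) \<or>
      (a = a1 @ replicate k False \<and> b = replicate k False @ a1)"
    using recurrent_rotation[OF z, of False] by blast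
  obtain l a2 where l: "l \<ge> 1" "(a = replicate l True @ a2 \<and> b = a2 @ replicate l True) \<or>
      (a = a2 @ replicate l True \<and> b = replicate l True @ a2)"
    using recurrent_rotation[OF z, of True] by blast
  have clash: "replicate k False @ x \<noteq> replicate l True @ y" for x y
    using k(1) l(1) by (cases k; cases l) auto
  from k(2) l(2) consider
     "a = replicate k False @ a1" "a = a2 @ replicate l True" "b = a1 @ replicate k False" "b = replicate l True @ a2"
   | "b = replicate k False @ a1" "b = a2 @ replicate l True" "a = a1 @ replicate k False" "a = replicate l True @ a2"
    using clash by metis
  thus False
  proof cases
    case 1 thus False using rev_of_block_rotations[OF 1(1,2,3,4) k(1) l(1)] assms by simp
  next
    case 2 thus False using rev_of_block_rotations[OF 2(1,2,3,4) k(1) l(1)] assms by simp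
  qed
qed

text \<open>
  Otherwise no walk from \<open>a\<close> would ever reach \<open>b\<close>, but appending the letters of \<open>b\<close> does.
\<close>
lemma crossing_possible: "\<exists>j. hit j a b > 0"
proof (rule ccontr)
  assume "\<not> ?thesis"
  hence z: "\<And>j. hit j a b = 0" using hit_nonneg by (metis antisym_conv2 not_less)
  have "(\<forall>j. hit j (foldl advance a w) b = 0) \<and> (w \<noteq> [] \<longrightarrow> foldl advance a w \<noteq> b)" for w
  proof (induction w rule: rev_induct)
    case (snoc e w)
    let ?x = "foldl advance a w"
    have nb: "advance ?x e \<noteq> b" using hit_one_pos[of ?x e b] snoc by (auto simp del: hit.simps One_nat_def)
    have "hit j (advance ?x e) b = 0" for j
    proof (cases "advance ?x e = a")
      case True thus ?thesis using z by simp
    next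
      case False
      hence "\<not> hit j (advance ?x e) b > 0" using hit_step_pos[of ?x e j b] nb snoc by (auto simp del: hit.simps)
      thus ?thesis using hit_nonneg by (metis antisym_conv2)
    qed
    thus ?case using nb by simp
  qed (use z in auto)
  hence "foldl advance a b \<noteq> b" using len L by (metis list.size(3) not_one_le_zero)
  thus False using walk_from[OF len(1), of b] len by simp
qed

text \<open>
  Whatever is hit from the end of a walk that starts at \<open>a\<close> is also hit, possibly later, from the last
  word of the pair that the walk visits.
\<close>
lemma reach:
  "\<exists>u\<in>{a,b}. \<exists>n. \<forall>j c. hit j (foldl advance a w) c > 0 \<longrightarrow> hit (n + j) u c > 0"
proof (induction w rule: rev_induct)
  case Nil thus ?case by (intro bexI[of _ a] exI[of _ 0]) auto
next
  case (snoc e w)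
  let ?x = "foldl advance a w"
  show ?case
  proof (cases "advance ?x e \<in> {a, b}")
    case True thus ?thesis by (intro bexI[of _ "advance ?x e"] exI[of _ 0]) auto
  next
    case False
    from snoc obtain u n where u: "u \<in> {a,b}" "\<And>j c. hit j ?x c > 0 \<Longrightarrow> hit (n + j) u c > 0" by blast
    have "hit (Suc n + j) u c > 0" if "hit j (advance ?x e) c > 0" for j c
      using u(2)[of "Suc j" c] hit_step_pos[OF False that] by simp
    thus ?thesis using u(1) by (intro bexI[of _ u] exI[of _ "Suc n"]) auto
  qed
qed


lemma avg_cong: "(\<And>c. g (advance x c) = h (advance x c)) \<Longrightarrow> avg g x = avg h x"
  by (simp add: avg_def)

lemma length_adv: "length x = L \<Longrightarrow> length (advance x e) = L"
  using length_advance[of x e] L by fastforce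

lemma sum_hit_Suc:
  assumes "c \<in> {a, b}"
  shows "(\<Sum>s\<le>Suc t. hit s x c) = avg (\<lambda>y. if y \<in> {a, b} then of_bool (y = c) else (\<Sum>s\<le>t. hit s y c)) x"
proof -
  have "(\<Sum>s\<le>Suc t. hit s x c) = (\<Sum>s\<le>t. hit (Suc s) x c)"
    by (subst sum.atMost_Suc_shift) simp
  also have "\<dots> = avg (\<lambda>y. \<Sum>s\<le>t. if y \<in> {a, b} then of_bool (s = 0 \<and> y = c) else hit s y c) x"
    by (simp add: avg_def sum_divide_distrib[symmetric] sum.distrib)
  also have "\<dots> = avg (\<lambda>y. if y \<in> {a, b} then of_bool (y = c) else (\<Sum>s\<le>t. hit s y c)) x"
  proof (rule avg_cong)
    fix e
    have "(\<Sum>s\<le>t. of_bool (s = 0 \<and> P) :: real) = of_bool P" for P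
      by (cases P) (simp_all add: of_bool_def sum.delta)
    thus "(\<Sum>s\<le>t. if advance x e \<in> {a, b} then of_bool (s = 0 \<and> advance x e = c) else hit s (advance x e) c) =
      (if advance x e \<in> {a, b} then of_bool (advance x e = c) else (\<Sum>s\<le>t. hit s (advance x e) c))" by auto
  qed
  finally show ?thesis .
qed

lemma total_probability: "(\<Sum>s\<le>t. hit s x a) + (\<Sum>s\<le>t. hit s x b) + nohit t x = 1"
proof (induction t arbitrary: x)
  case (Suc t)
  have "(\<Sum>s\<le>Suc t. hit s x a) + (\<Sum>s\<le>Suc t. hit s x b) + nohit (Suc t) x =
     avg (\<lambda>y. (if y \<in> {a, b} then of_bool (y = a) else (\<Sum>s\<le>t. hit s y a)) +
        (if y \<in> {a, b} then of_bool (y = b) else (\<Sum>s\<le>t. hit s y b)) + (if y \<in> {a, b} then 0 else nohit t y)) x"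
    by (subst sum_hit_Suc, simp, subst sum_hit_Suc, simp) (simp add: avg_def add_divide_distrib)
  also have "\<dots> = avg (\<lambda>_. 1) x"
    using ab Suc by (intro avg_cong) auto
  finally show ?case by (simp add: avg_def)
qed simp

lemma hit_sum_nohit: "hit (Suc t) x a + hit (Suc t) x b = nohit t x - nohit (Suc t) x"
  using total_probability[where t = t and x = x] total_probability[where t = "Suc t" and x = x] by (simp only: sum.atMost_Suc)

lemma hit_Suc_le_nohit: "c \<in> {a, b} \<Longrightarrow> hit (Suc t) x c \<le> nohit t x"
  using hit_sum_nohit[where t = t and x = x] nohit_bounds(1)[of "Suc t" x]
    hit_nonneg[of "Suc t" x a] hit_nonneg[of "Suc t" x b] by auto

lemma first_hit_decomposition:
  "exceed t x k = of_bool (k > 0) * nohit t x +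
     (\<Sum>s\<le>t. hit s x a * exceed (t - s) a (k + 1) + hit s x b * exceed (t - s) b (k - 1))"
proof (induction t arbitrary: x k)
  case (Suc t)
  let ?G = "\<lambda>y s. (if y \<in> {a, b} then of_bool (s = 0 \<and> y = a) else hit s y a) * exceed (t - s) a (k + 1)
        + (if y \<in> {a, b} then of_bool (s = 0 \<and> y = b) else hit s y b) * exceed (t - s) b (k - 1)"
  have "(\<Sum>s\<le>Suc t. hit s x a * exceed (Suc t - s) a (k + 1) + hit s x b * exceed (Suc t - s) b (k - 1))
     = (\<Sum>s\<le>t. hit (Suc s) x a * exceed (t - s) a (k + 1) + hit (Suc s) x b * exceed (t - s) b (k - 1))"
    by (subst sum.atMost_Suc_shift) simp
  also have "\<dots> = avg (\<lambda>y. \<Sum>s\<le>t. ?G y s) x"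
    by (simp add: avg_def sum.distrib[symmetric] sum_divide_distrib algebra_simps add_divide_distrib)
  finally have "of_bool (k > 0) * nohit (Suc t) x + (\<Sum>s\<le>Suc t. hit s x a * exceed (Suc t - s) a (k + 1) + hit s x b * exceed (Suc t - s) b (k - 1))
     = avg (\<lambda>y. of_bool (k > 0) * (if y \<in> {a, b} then 0 else nohit t y) + (\<Sum>s\<le>t. ?G y s)) x"
    by (simp add: avg_def algebra_simps add_divide_distrib)
  also have "\<dots> = avg (\<lambda>y. exceed t y (k + sgn_word y)) x"
  proof (rule avg_cong)
    fix e
    let ?y = "advance x e"
    have one: "(\<Sum>s\<le>t. of_bool (s = 0) * f s) = f 0" for f :: "nat \<Rightarrow> real"
      by (simp add: of_bool_def if_distrib[of "\<lambda>x. x * _"] sum.delta cong: if_cong)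
    show "of_bool (k > 0) * (if ?y \<in> {a, b} then 0 else nohit t ?y) + (\<Sum>s\<le>t. ?G ?y s) = exceed t ?y (k + sgn_word ?y)"
    proof (cases "?y = a")
      case True thus ?thesis using ab one[of "\<lambda>s. exceed (t - s) a (k + 1)"] by (simp add: sgn_word_def)
    next
      case na: False
      show ?thesis
      proof (cases "?y = b")
        case True thus ?thesis using ab na one[of "\<lambda>s. exceed (t - s) b (k - 1)"] by (simp add: sgn_word_def)
      next
        case False thus ?thesis using na Suc.IH[of ?y k] by (simp add: sgn_word_def)
      qed
    qed
  qed
  finally show ?case by simp
qed simp

text \<open>
  Spelling out the rest of \<open>a\<close> is one of the \<open>2 ^ (L - i)\<close> continuations, and it hits \<open>a\<close>.
\<close>
lemma nohit_towards_a:
  assumes "i < L" "length x = L" "drop (L - i) x = take i a"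
  shows "nohit (L - i) x \<le> 1 - 1 / 2 ^ (L - i)"
  using assms
proof (induction "L - i" arbitrary: i x)
  case (Suc n)
  let ?y = "advance x (a ! i)"
  have i: "L - i = Suc n" "L - Suc i = n" using Suc(2) by auto
  have xne: "x \<noteq> []" using Suc.prems L by auto
  have suf: "drop (L - Suc i) ?y = take (Suc i) a"
  proof -
    have "drop n (tl x) = take i a" using Suc.prems(3) unfolding i(1) by (simp add: drop_Suc)
    moreover have "n \<le> length (tl x)" using Suc.prems i by simp
    ultimately show ?thesis using Suc.prems(1) len unfolding advance_def i(2)
      by (simp add: take_Suc_conv_app_nth)
  qed
  define g where "g = (\<lambda>y. if y \<in> {a, b} then 0 else nohit n y)"
  have yb: "g ?y \<le> 1 - 1 / 2 ^ n"
  proof (cases "n = 0")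
    case True
    hence "Suc i = L" using i Suc.prems by auto
    hence "?y = a" using suf len by simp
    thus ?thesis by (simp add: g_def)
  next
    case False
    hence "nohit n ?y \<le> 1 - 1 / 2 ^ n"
      using Suc.hyps(1)[of "Suc i" ?y] i suf length_adv Suc.prems(2) by simp
    thus ?thesis by (auto simp: g_def)
  qed
  have oth: "g y \<le> 1" for y using nohit_bounds by (auto simp: g_def)
  have "nohit (Suc n) x = (g (advance x False) + g (advance x True)) / 2" by (simp add: avg_def g_def)
  also have "\<dots> \<le> ((1 - 1 / 2 ^ n) + 1) / 2"
    using yb oth[of "advance x True"] oth[of "advance x False"] by (cases "a ! i") simp_all
  also have "\<dots> = 1 - 1 / 2 ^ Suc n" by (simp add: field_simps)
  finally show ?case unfolding i(1) .
qed simp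

lemma nohit_add_le:
  assumes "\<And>y. length y = L \<Longrightarrow> nohit s y \<le> \<kappa>" "length x = L" "\<kappa> \<ge> 0"
  shows "nohit (t + s) x \<le> \<kappa> * nohit t x"
  using assms(2)
proof (induction t arbitrary: x)
  case (Suc t)
  have "nohit (Suc t + s) x \<le> avg (\<lambda>y. \<kappa> * (if y \<in> {a, b} then 0 else nohit t y)) x"
    using Suc.IH[OF length_adv[OF Suc.prems]] assms(3) by (simp, intro avg_mono) auto
  thus ?case by (simp add: avg_def algebra_simps)
qed (use assms in auto)

lemma nohit_antimono: "nohit (t + s) x \<le> nohit t x"
proof (induction s)
  case (Suc s)
  have "nohit (Suc (t + s)) x \<le> nohit (t + s) x"
    using hit_sum_nohit[where t = "t + s" and x = x] hit_nonneg[of "Suc (t + s)" x a] hit_nonneg[of "Suc (t + s)" x b] by linarith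
  thus ?case using Suc by simp
qed simp

lemma nohit_geometric:
  obtains C \<rho> where "0 < \<rho>" "\<rho> < 1" "C > 0" "\<And>t x. length x = L \<Longrightarrow> nohit t x \<le> C * \<rho> ^ t"
proof -
  define \<kappa> where "\<kappa> = (1 - 1 / 2 ^ L :: real)"
  have k: "0 < \<kappa>" "\<kappa> < 1" using L one_less_power[of "2::real" L] unfolding \<kappa>_def by auto
  have kL: "nohit L y \<le> \<kappa>" if "length y = L" for y
    using nohit_towards_a[of 0 y] that L unfolding \<kappa>_def by simp
  have pw: "nohit (n * L) x \<le> \<kappa> ^ n" if "length x = L" for n x
  proof (induction n)
    case (Suc n)
    have "nohit (n * L + L) x \<le> \<kappa> * nohit (n * L) x" using nohit_add_le[OF kL that, of "n * L"] k by simp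
    also have "\<dots> \<le> \<kappa> * \<kappa> ^ n" using Suc k by simp
    finally show ?case by (simp add: add.commute)
  qed simp
  define \<rho> where "\<rho> = root L \<kappa>"
  have r: "0 < \<rho>" "\<rho> < 1" "\<rho> ^ L = \<kappa>" using k L unfolding \<rho>_def by (auto simp: real_root_pow_pos2)
  have "nohit t x \<le> 1 / \<kappa> * \<rho> ^ t" if x: "length x = L" for t x
  proof -
    have t: "t = (t div L) * L + t mod L" by simp
    have "nohit t x \<le> nohit ((t div L) * L) x" by (subst t) (rule nohit_antimono)
    also have "\<dots> \<le> \<kappa> ^ (t div L)" by (rule pw[OF x])
    also have "\<dots> = \<rho> ^ (L * (t div L))" using r by (simp add: power_mult)
    also have "\<dots> \<le> 1 / \<kappa> * \<rho> ^ t"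
    proof -
      have "t \<le> L * (t div L) + L" using L by (metis add_le_cancel_left mod_less_divisor less_imp_le mult.commute mult_div_mod_eq less_le_trans zero_less_one)
      hence "\<rho> ^ (L * (t div L) + L) \<le> \<rho> ^ t" using r by (intro power_decreasing) auto
      thus ?thesis using r k by (simp add: power_add field_simps)
    qed
    finally show ?thesis .
  qed
  thus ?thesis using that[of \<rho> "1 / \<kappa>"] r k by simp
qed

end

section \<open>Generating functions with geometrically decaying coefficients\<close>

definition gf :: "(nat \<Rightarrow> real) \<Rightarrow> complex \<Rightarrow> complex" where
  "gf c z = (\<Sum>n. of_real (c n) * z ^ n)"

locale geometric_seq =
  fixes c :: "nat \<Rightarrow> real" and r :: real
  assumes nonneg: "\<And>n. 0 \<le> c n" and r: "1 < r" and summ: "summable (\<lambda>n. c n * r ^ n)"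
begin

lemma summable_norm_terms:
  assumes "norm z \<le> r" shows "summable (\<lambda>n. norm (of_real (c n) * z ^ n :: complex))"
  using summ
proof (rule summable_comparison_test'[where N = 0])
  fix n show "norm (norm (of_real (c n) * z ^ n)) \<le> c n * r ^ n"
    using assms nonneg[of n] by (simp add: norm_mult norm_power mult_left_mono power_mono)
qed

lemma gf_sums: "norm z \<le> r \<Longrightarrow> (\<lambda>n. of_real (c n) * z ^ n) sums gf c z"
  unfolding gf_def by (rule summable_sums[OF summable_norm_cancel[OF summable_norm_terms]])

lemma holomorphic_gf: "gf c holomorphic_on ball 0 r"
  by (rule power_series_holomorphic[of 0 r c]) (use gf_sums in auto)

lemma summable_c: "summable c"
  using summable_norm_terms[of 1] nonneg r by simp

lemma norm_gf_le: assumes "norm z \<le> 1" shows "norm (gf c z) \<le> suminf c"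
proof -
  have "norm (gf c z) \<le> (\<Sum>n. norm (of_real (c n) * z ^ n))"
    unfolding gf_def using assms r by (intro Series.summable_norm) (auto intro: summable_norm_terms)
  also have "\<dots> \<le> suminf c"
    using assms r nonneg
    by (intro suminf_le summable_norm_terms summable_c)
       (auto simp: norm_mult norm_power power_le_one mult_left_le)
  finally show ?thesis .
qed

lemma gf_1: "gf c 1 = of_real (suminf c)"
  unfolding gf_def by (simp add: suminf_of_real[OF summable_c])

lemma norm_gf_le_mult:
  assumes "norm z \<le> 1" "c 0 = 0" shows "norm (gf c z) \<le> norm z * suminf c"
proof -
  have s: "summable (\<lambda>n. norm (of_real (c n) * z ^ n))" using assms r by (intro summable_norm_terms) auto
  have "norm (gf c z) \<le> (\<Sum>n. norm (of_real (c n) * z ^ n))"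
    unfolding gf_def using s by (rule Series.summable_norm)
  also have "\<dots> \<le> (\<Sum>n. norm z * c n)"
  proof (rule suminf_le[OF _ s summable_mult[OF summable_c]])
    fix n show "norm (of_real (c n) * z ^ n) \<le> norm z * c n"
    proof (cases n)
      case (Suc m)
      have "norm z ^ m \<le> 1" using assms by (simp add: power_le_one)
      hence "c n * (norm z * norm z ^ m) \<le> c n * (norm z * 1)"
        using nonneg by (intro mult_left_mono) auto
      thus ?thesis using nonneg[of n] Suc by (simp add: norm_mult norm_power mult_ac)
    qed (use assms in simp)
  qed
  also have "\<dots> = norm z * suminf c" by (rule suminf_mult[OF summable_c])
  finally show ?thesis .
qed

lemma sums_deriv: "(\<lambda>n. real n * c n) sums Re (deriv (gf c) 1)" "Im (deriv (gf c) 1) = 0"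
proof -
  have d: "DERIV (\<lambda>z. \<Sum>n. of_real (c n) * z ^ n) 1 :> (\<Sum>n. diffs (\<lambda>n. complex_of_real (c n)) n * 1 ^ n)"
    by (rule termdiffs_strong[where K = "of_real r"])
       (use gf_sums[of "of_real r"] r in \<open>auto simp: sums_iff\<close>)
  hence dd: "deriv (gf c) 1 = (\<Sum>n. diffs (\<lambda>n. complex_of_real (c n)) n)"
    unfolding gf_def[abs_def] by (simp add: DERIV_imp_deriv)
  have sd: "summable (\<lambda>n. diffs (\<lambda>n. complex_of_real (c n)) n * 1 ^ n)"
    by (rule termdiff_converges[where K = r]) (use gf_sums r in \<open>auto simp: sums_iff\<close>)
  hence "(\<lambda>n. diffs (\<lambda>n. complex_of_real (c n)) n * 1 ^ n) sums deriv (gf c) 1"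
    using dd by (simp add: summable_sums)
  hence "(\<lambda>n. of_nat (Suc n) * complex_of_real (c (Suc n))) sums deriv (gf c) 1"
    by (simp add: diffs_def)
  hence "(\<lambda>n. of_nat n * complex_of_real (c n)) sums deriv (gf c) 1"
    by (subst (asm) sums_Suc_iff) simp
  hence s: "(\<lambda>n. complex_of_real (real n * c n)) sums deriv (gf c) 1" by simp
  show "(\<lambda>n. real n * c n) sums Re (deriv (gf c) 1)" using sums_Re[OF s] by simp
  show "Im (deriv (gf c) 1) = 0" using sums_Im[OF s] by (simp add: sums_iff)
qed

lemma deriv_gf_1: "deriv (gf c) 1 = of_real (\<Sum>n. real n * c n)"
  using sums_deriv by (simp add: complex_eq_iff sums_iff)

text \<open>
  Equality in the triangle inequality on the closed disc forces two consecutive charged terms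
  \<open>z ^ j\<close> and \<open>z ^ (j + 1)\<close> to be aligned.
\<close>
lemma gf_norm_extremal:
  assumes j: "c j > 0" "c (Suc j) > 0" and z: "norm z \<le> 1" "norm (gf c z) = suminf c"
  shows "z = 1"
proof (rule ccontr)
  assume ne: "z \<noteq> 1"
  have re: "Re z < 1"
  proof (rule ccontr)
    assume "\<not> Re z < 1"
    hence R: "Re z = 1" using complex_Re_le_cmod[of z] z(1) by linarith
    have "(Re z)^2 + (Im z)^2 \<le> 1" using z(1) by (metis cmod_power2 norm_ge_zero one_power2 power_mono)
    hence "Im z = 0" using R by simp
    thus False using ne R by (simp add: complex_eq_iff)
  qed
  let ?u = "of_real (c j) + of_real (c (Suc j)) * z"
  have "(norm ?u)^2 = (c j)^2 + 2 * c j * c (Suc j) * Re z + (c (Suc j))^2 * (norm z)^2"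
    unfolding cmod_power2 by (simp add: power2_eq_square algebra_simps)
  also have "\<dots> < (c j)^2 + 2 * c j * c (Suc j) * 1 + (c (Suc j))^2 * 1"
    using j re z(1) by (intro add_less_le_mono add_strict_left_mono mult_strict_left_mono mult_left_mono) (auto simp: power_le_one)
  also have "\<dots> = (c j + c (Suc j))^2" by (simp add: power2_eq_square algebra_simps)
  finally have u: "norm ?u < c j + c (Suc j)" by (rule power2_less_imp_less) (use j in auto)
  let ?f = "\<lambda>n. of_real (c n) * z ^ n"
  have s: "summable (\<lambda>n. norm (?f n))" using z(1) r by (intro summable_norm_terms) auto
  have nj: "norm (?f n) \<le> c n" for n using z(1) nonneg[of n]
    by (auto simp: norm_mult norm_power power_le_one mult_left_le)
  have "gf c z = (\<Sum>n. ?f (n + (j + 2))) + (\<Sum>n<j+2. ?f n)"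
    unfolding gf_def by (rule suminf_split_initial_segment[OF summable_norm_cancel[OF s]])
  also have "(\<Sum>n<j+2. ?f n) = (\<Sum>n<j. ?f n) + z ^ j * ?u" by (simp add: algebra_simps)
  finally have "norm (gf c z) \<le> norm (\<Sum>n. ?f (n + (j + 2))) + (norm (\<Sum>n<j. ?f n) + norm (z ^ j * ?u))"
    by (simp only: order_trans[OF norm_triangle_ineq add_left_mono[OF norm_triangle_ineq]])
  also have "\<dots> < (\<Sum>n. c (n + (j + 2))) + ((\<Sum>n<j. c n) + (c j + c (Suc j)))"
  proof (intro add_le_less_mono)
    have "norm (\<Sum>n. ?f (n + (j + 2))) \<le> (\<Sum>n. norm (?f (n + (j + 2))))"
      using s by (intro Series.summable_norm) (rule summable_ignore_initial_segment)
    also have "\<dots> \<le> (\<Sum>n. c (n + (j + 2)))"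
      using s summable_c by (intro suminf_le nj summable_ignore_initial_segment)
    finally show "norm (\<Sum>n. ?f (n + (j + 2))) \<le> (\<Sum>n. c (n + (j + 2)))" .
    show "norm (\<Sum>n<j. ?f n) \<le> (\<Sum>n<j. c n)" by (rule sum_norm_le) (rule nj)
    have "norm (z ^ j * ?u) \<le> 1 * norm ?u"
      unfolding norm_mult norm_power using z(1) by (intro mult_right_mono power_le_one) auto
    thus "norm (z ^ j * ?u) < c j + c (Suc j)" using u by simp
  qed
  also have "\<dots> = (\<Sum>n. c (n + (j + 2))) + (\<Sum>n<j+2. c n)" by simp
  also have "\<dots> = suminf c" by (rule suminf_split_initial_segment[OF summable_c, symmetric])
  finally show False using z(2) by simp
qed

end

lemma gf_convolution:
  assumes "summable (\<lambda>n. norm (of_real (f n) * z ^ n))" "summable (\<lambda>n. norm (of_real (g n) * z ^ n))"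
  shows "(\<lambda>n. of_real (\<Sum>i\<le>n. f i * g (n - i)) * z ^ n) sums (gf f z * gf g z)"
proof -
  have "(\<lambda>n. \<Sum>i\<le>n. (of_real (f i) * z ^ i) * (of_real (g (n - i)) * z ^ (n - i))) sums (gf f z * gf g z)"
    unfolding gf_def by (rule Cauchy_product_sums[OF assms])
  moreover have "(\<Sum>i\<le>n. (of_real (f i) * z ^ i) * (of_real (g (n - i)) * z ^ (n - i))) =
     of_real (\<Sum>i\<le>n. f i * g (n - i)) * z ^ n" for n
  proof -
    have "(\<Sum>i\<le>n. (of_real (f i) * z ^ i) * (of_real (g (n - i)) * z ^ (n - i))) =
      (\<Sum>i\<le>n. of_real (f i * g (n - i)) * z ^ n)"
      by (rule sum.cong) (auto simp: power_add[symmetric] mult_ac)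
    thus ?thesis by (simp add: sum_distrib_right)
  qed
  ultimately show ?thesis by simp
qed

lemma summable_bounded_powers:
  assumes "norm (z::complex) < 1" "\<And>n. \<bar>f n\<bar> \<le> 1"
  shows "summable (\<lambda>n. norm (of_real (f n) * z ^ n))"
proof (rule summable_comparison_test'[where N = 0 and g = "\<lambda>n. norm z ^ n"])
  show "summable (\<lambda>n. norm z ^ n)" using assms(1) by (simp add: summable_geometric)
  fix n show "norm (norm (of_real (f n) * z ^ n)) \<le> norm z ^ n"
    using assms(2)[of n] by (simp add: norm_mult norm_power mult_left_le_one_le)
qed

section \<open>Stationarity and the asymptotics from a given window\<close>

context word_pair begin

abbreviation "hit_gf x c \<equiv> gf (\<lambda>n. hit n x c)"
abbreviation "exceed_gf x k \<equiv> gf (\<lambda>n. exceed n x k)"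

lemma common_radius:
  obtains r where "1 < r" "\<And>x c. length x = L \<Longrightarrow> c \<in> {a, b} \<Longrightarrow> geometric_seq (\<lambda>n. hit n x c) r"
    "\<And>x. length x = L \<Longrightarrow> summable (\<lambda>n. nohit n x)"
    "\<And>x. length x = L \<Longrightarrow> (\<lambda>n. real n * nohit n x) \<longlonglongrightarrow> 0"
proof -
  obtain C \<rho> where g: "0 < \<rho>" "\<rho> < 1" "C > 0" "\<And>t x. length x = L \<Longrightarrow> nohit t x \<le> C * \<rho> ^ t"
    by (rule nohit_geometric) (rule that; assumption)
  \<comment> \<open>any radius strictly between 1 and \<open>1 / \<rho>\<close> would do\<close>
  define r where "r = 1 / sqrt \<rho>"
  have sq: "0 < sqrt \<rho>" "sqrt \<rho> < 1" "sqrt \<rho> * sqrt \<rho> = \<rho>" using g by auto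
  have r: "1 < r" using sq by (simp add: r_def)
  have rr: "\<rho> * r = sqrt \<rho>" unfolding r_def using sq by (simp add: field_simps)
  have hb: "hit (Suc t) x c \<le> C * \<rho> ^ t" if "length x = L" "c \<in> {a, b}" for t x c
    using hit_Suc_le_nohit[OF that(2), of t x] g(4)[OF that(1), of t] by linarith
  have geo: "geometric_seq (\<lambda>n. hit n x c) r" if "length x = L" "c \<in> {a, b}" for x c
  proof
    have "summable (\<lambda>t. hit (Suc t) x c * r ^ Suc t)"
    proof (rule summable_comparison_test'[where N = 0 and g = "\<lambda>t. (C * r) * (\<rho> * r) ^ t"])
      show "summable (\<lambda>t. (C * r) * (\<rho> * r) ^ t)"
        unfolding rr using sq by (intro summable_mult summable_geometric) auto
      fix t
      have "hit (Suc t) x c * r ^ Suc t \<le> (C * \<rho> ^ t) * r ^ Suc t"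
        using hb[OF that, of t] r by (intro mult_right_mono) auto
      moreover have "0 \<le> hit (Suc t) x c * r ^ Suc t" using hit_nonneg[of "Suc t" x c] r by (intro mult_nonneg_nonneg) auto
      ultimately show "norm (hit (Suc t) x c * r ^ Suc t) \<le> (C * r) * (\<rho> * r) ^ t"
        by (simp add: power_mult_distrib mult_ac del: hit.simps)
    qed
    thus "summable (\<lambda>n. hit n x c * r ^ n)" by (subst (asm) summable_Suc_iff)
  qed (use r hit_nonneg in auto)
  have sn: "summable (\<lambda>n. nohit n x)" if "length x = L" for x
  proof (rule summable_comparison_test'[where N = 0 and g = "\<lambda>n. C * \<rho> ^ n"])
    show "summable (\<lambda>n. C * \<rho> ^ n)" using g by (intro summable_mult summable_geometric) auto
  qed (use g(4)[OF that] nohit_bounds in auto)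
  have lim: "(\<lambda>n. real n * nohit n x) \<longlonglongrightarrow> 0" if "length x = L" for x
  proof (rule tendsto_sandwich[of "\<lambda>_. 0" _ _ "\<lambda>n. C * (real n * \<rho> ^ n)"])
    have "(\<lambda>n. real n * \<rho> ^ n) \<longlonglongrightarrow> 0" using g by (intro powser_times_n_limit_0) auto
    thus "(\<lambda>n. C * (real n * \<rho> ^ n)) \<longlonglongrightarrow> 0" by (rule tendsto_mult_right_zero)
    show "eventually (\<lambda>n. real n * nohit n x \<le> C * (real n * \<rho> ^ n)) sequentially"
    proof (intro always_eventually allI)
      fix n show "real n * nohit n x \<le> C * (real n * \<rho> ^ n)"
        using mult_left_mono[OF g(4)[OF that, of n], of "real n"] by (simp add: mult_ac)
    qed
  qed (use nohit_bounds in auto)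
  show ?thesis using that[OF r geo sn lim] .
qed

definition "hitprob x c = (\<Sum>n. hit n x c)"
definition "hitmean x c = (\<Sum>n. real n * hit n x c)"

lemma hit_sums:
  assumes "length x = L" "c \<in> {a, b}"
  shows "(\<lambda>n. hit n x c) sums hitprob x c" "(\<lambda>n. real n * hit n x c) sums hitmean x c"
    "summable (\<lambda>n. hit n x c)"
proof -
  obtain r where "geometric_seq (\<lambda>n. hit n x c) r" using common_radius assms by metis
  then interpret geometric_seq "\<lambda>n. hit n x c" r .
  show "(\<lambda>n. hit n x c) sums hitprob x c" unfolding hitprob_def by (rule summable_sums[OF summable_c])
  show "(\<lambda>n. real n * hit n x c) sums hitmean x c"
    using sums_deriv(1) unfolding hitmean_def by (simp add: sums_iff)
  show "summable (\<lambda>n. hit n x c)" by (rule summable_c)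
qed

lemma nohit_tendsto_0: "length x = L \<Longrightarrow> (\<lambda>n. nohit n x) \<longlonglongrightarrow> 0"
  using common_radius summable_LIMSEQ_zero by metis

lemma partial_hit_tendsto:
  assumes "length x = L" "c \<in> {a, b}" shows "(\<lambda>n. \<Sum>s\<le>n. hit s x c) \<longlonglongrightarrow> hitprob x c"
  using hit_sums(1)[OF assms] by (simp add: sums_def_le)

lemma hitprob_total: assumes "length x = L" shows "hitprob x a + hitprob x b = 1"
proof -
  have "(\<lambda>t. (\<Sum>s\<le>t. hit s x a) + (\<Sum>s\<le>t. hit s x b) + nohit t x) \<longlonglongrightarrow> hitprob x a + hitprob x b + 0"
    using assms by (intro tendsto_add partial_hit_tendsto nohit_tendsto_0) auto
  thus ?thesis unfolding total_probability by (simp add: LIMSEQ_const_iff)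
qed

abbreviation "Words \<equiv> {x::bool list. length x = L}"

lemma finite_Words: "finite Words" and card_Words: "card Words = 2 ^ L"
  using finite_lists_length_eq[of "UNIV :: bool set" L] card_lists_length_eq[of "UNIV :: bool set" L] by auto

lemma sum_off_pair: "(\<Sum>y\<in>Words. if y \<in> {a, b} then f y else g y) = (\<Sum>y\<in>Words. g y) + (f a - g a) + (f b - g b)"
  for f g :: "bool list \<Rightarrow> real"
proof -
  have "(\<Sum>y\<in>Words. if y \<in> {a, b} then f y else g y) = (\<Sum>y\<in>Words. g y + (if y = a then f a - g a else 0) + (if y = b then f b - g b else 0))"
    using ab by (intro sum.cong) auto
  thus ?thesis using finite_Words len by (simp add: sum.distrib)
qed

text \<open>
  Sum the first-step equation over all words. By stationarity the sums over words after \<open>t\<close> and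
  \<open>t + 1\<close> steps differ by \<open>1\<close> minus the probabilities that \<open>c\<close> is the next hit, within \<open>t\<close> steps, after \<open>a\<close>
  and after \<open>b\<close>; the difference tends to 0.
  Together with \<open>hitprob_total\<close> this makes the stay probability the same for both words.
\<close>
lemma hitprob_stationary: assumes "c \<in> {a, b}" shows "hitprob a c + hitprob b c = 1"
proof -
  define H where "H = (\<lambda>t x. \<Sum>s\<le>t. hit s x c)"
  have step: "(\<Sum>x\<in>Words. H (Suc t) x) = (\<Sum>x\<in>Words. H t x) + (1 - H t a - H t b)" for t
  proof -
    have "(\<Sum>x\<in>Words. H (Suc t) x) = (\<Sum>x\<in>Words. avg (\<lambda>y. if y \<in> {a, b} then of_bool (y = c) else H t y) x)"
      unfolding H_def by (subst sum_hit_Suc[OF assms]) simp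
    also have "\<dots> = (\<Sum>y\<in>Words. if y \<in> {a, b} then of_bool (y = c) else H t y)" by (rule avg_stationary[OF L])
    finally show ?thesis unfolding sum_off_pair using assms ab by auto
  qed
  have lim: "(\<lambda>t. H t x) \<longlonglongrightarrow> hitprob x c" if "x \<in> Words" for x
    unfolding H_def using partial_hit_tendsto assms that by simp
  have "(\<lambda>t. \<Sum>x\<in>Words. H t x) \<longlonglongrightarrow> (\<Sum>x\<in>Words. hitprob x c)" by (intro tendsto_sum lim)
  hence "(\<lambda>t. (\<Sum>x\<in>Words. H (Suc t) x) - (\<Sum>x\<in>Words. H t x)) \<longlonglongrightarrow> (\<Sum>x\<in>Words. hitprob x c) - (\<Sum>x\<in>Words. hitprob x c)"
    by (intro tendsto_diff LIMSEQ_Suc)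
  hence "(\<lambda>t. 1 - H t a - H t b) \<longlonglongrightarrow> 0" unfolding step by simp
  moreover have "(\<lambda>t. 1 - H t a - H t b) \<longlonglongrightarrow> 1 - hitprob a c - hitprob b c"
    using lim len by (intro tendsto_intros) auto
  ultimately show ?thesis using LIMSEQ_unique by fastforce
qed

text \<open>
  The tail formula for the mean waiting time, by summation by parts; the boundary term
  \<open>n * nohit n x\<close> tends to 0.
\<close>
lemma hitmean_sums_nohit:
  assumes "length x = L" shows "(\<lambda>t. nohit t x) sums (hitmean x a + hitmean x b)"
proof -
  have partial: "(\<Sum>s\<le>n. real s * (hit s x a + hit s x b)) = (\<Sum>s<n. nohit s x) - real n * nohit n x" for n
  proof (induction n)
    case (Suc n)
    have "(\<Sum>s\<le>Suc n. real s * (hit s x a + hit s x b)) = (\<Sum>s<n. nohit s x) - real n * nohit n x + real (Suc n) * (nohit n x - nohit (Suc n) x)"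
      unfolding sum.atMost_Suc Suc.IH hit_sum_nohit ..
    thus ?case by (simp add: algebra_simps del: nohit.simps)
  qed simp
  have "(\<lambda>n. real n * (hit n x a + hit n x b)) sums (hitmean x a + hitmean x b)"
    using sums_add[OF hit_sums(2)[OF assms, of a] hit_sums(2)[OF assms, of b]] by (simp add: distrib_left)
  hence 1: "(\<lambda>n. (\<Sum>s\<le>n. real s * (hit s x a + hit s x b)) + real n * nohit n x) \<longlonglongrightarrow> hitmean x a + hitmean x b + 0"
    using common_radius assms unfolding sums_def_le by (intro tendsto_add) metis+
  show ?thesis using 1 unfolding partial sums_def by simp
qed

text \<open>
  Kac's return time formula: summed over all words, \<open>nohit\<close> starts at \<open>2 ^ L\<close>, tends to 0, and loses
  \<open>nohit t a + nohit t b\<close> in step \<open>t\<close>.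
\<close>
lemma hitmean_total: "hitmean a a + hitmean a b + hitmean b a + hitmean b b = 2 ^ L"
proof -
  have step: "(\<Sum>x\<in>Words. nohit (Suc t) x) = (\<Sum>x\<in>Words. nohit t x) - nohit t a - nohit t b" for t
  proof -
    have "(\<Sum>x\<in>Words. nohit (Suc t) x) = (\<Sum>y\<in>Words. if y \<in> {a, b} then 0 else nohit t y)"
      by (simp only: nohit.simps avg_stationary[OF L])
    thus ?thesis unfolding sum_off_pair by simp
  qed
  have partial: "(\<Sum>s<n. nohit s a + nohit s b) = 2 ^ L - (\<Sum>x\<in>Words. nohit n x)" for n
  proof (induction n)
    case 0 show ?case using card_Words by simp
  next
    case (Suc n) thus ?case unfolding step by simp
  qed
  have "(\<lambda>n. 2 ^ L - (\<Sum>x\<in>Words. nohit n x)) \<longlonglongrightarrow> 2 ^ L - (\<Sum>x\<in>Words. 0)"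
    by (intro tendsto_diff tendsto_sum tendsto_const nohit_tendsto_0) auto
  hence "(\<lambda>s. nohit s a + nohit s b) sums (2 ^ L)" unfolding sums_def partial by simp
  moreover have "(\<lambda>s. nohit s a + nohit s b) sums ((hitmean a a + hitmean a b) + (hitmean b a + hitmean b b))"
    by (intro sums_add hitmean_sums_nohit len)
  ultimately show ?thesis using sums_unique2 by fastforce
qed

lemma hitprob_pos: assumes "length x = L" "c \<in> {a, b}" "hit j x c > 0" shows "hitprob x c > 0"
  unfolding hitprob_def using hit_sums(3)[OF assms(1,2)] hit_nonneg assms(3) by (intro suminf_pos2[of _ j]) auto

end

locale generic_pair = word_pair +
  assumes not_rev: "b \<noteq> rev a" and not_conj: "b \<noteq> map Not a"
begin

definition "stay = hitprob a a"

lemma stay_eqs: "hitprob a a = stay" "hitprob a b = 1 - stay" "hitprob b a = 1 - stay" "hitprob b b = stay"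
  using hitprob_total[OF len(1)] hitprob_stationary[of a] hitprob_stationary[of b] unfolding stay_def by auto

lemma stay_bounds: "0 < stay" "stay < 1"
proof -
  show "0 < stay" using return_possible[OF not_rev] hitprob_pos[of a a] len unfolding stay_def by auto
  have "0 < hitprob a b" using crossing_possible hitprob_pos[of a b] len by auto
  thus "stay < 1" unfolding stay_eqs by simp
qed

text \<open>
  Walk from \<open>a\<close> to a constant word outside the pair and on to the next hit. One more repetition of the
  letter leaves the window unchanged and delays that hit by one step.
\<close>
lemma consecutive_hits:
  "\<exists>u\<in>{a, b}. \<exists>c\<in>{a, b}. \<exists>m. hit m u c > 0 \<and> hit (Suc m) u c > 0"
proof -
  obtain e where e: "replicate L e \<notin> {a, b}"
  proof (rule ccontr)
    assume "\<not> thesis"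
    hence "replicate L True \<in> {a, b}" "replicate L False \<in> {a, b}" using that by blast+
    moreover have "replicate L True \<noteq> replicate L False" using L by (cases L) auto
    ultimately have "b = map Not a" using ab by (auto simp: map_replicate)
    thus False using not_conj by simp
  qed
  define w where "w = replicate L e"
  have wl: "length w = L" and w: "w \<notin> {a, b}" using e by (auto simp: w_def)
  have "hitprob w a + hitprob w b = 1" by (rule hitprob_total[OF wl])
  then obtain c where c: "c \<in> {a, b}" "hitprob w c \<noteq> 0" by (metis insertCI add.right_neutral zero_neq_one)
  have "\<exists>j. hit j w c \<noteq> 0"
  proof (rule ccontr)
    assume "\<not> ?thesis"
    hence "hitprob w c = 0" by (simp add: hitprob_def)
    thus False using c by simp
  qed
  then obtain j where j: "hit j w c > 0" using hit_nonneg[of _ w c] by (auto simp: less_le)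
  have "advance w e = w" using L by (cases L) (auto simp: w_def advance_def replicate_append_same)
  hence j': "hit (Suc j) w c > 0" using hit_step_pos[of w e j c] w j by simp
  have "foldl advance a w = w" using walk_from[OF len(1), of w] wl len by simp
  then obtain u n where u: "u \<in> {a, b}" "\<And>j c. hit j w c > 0 \<Longrightarrow> hit (n + j) u c > 0" using reach[of w] by metis
  have "hit (n + j) u c > 0 \<and> hit (Suc (n + j)) u c > 0"
    using u(2)[OF j] u(2)[OF j'] unfolding add_Suc_right by blast
  thus ?thesis using c(1) u(1) by blast
qed

lemma kernel_exists:
  obtains r where "1 < r" "\<And>x c. length x = L \<Longrightarrow> c \<in> {a, b} \<Longrightarrow> geometric_seq (\<lambda>n. hit n x c) r"
   "renewal_kernel r stay (hitmean a a) (hitmean a b) (hitmean b a) (hitmean b b)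
      (hit_gf a a) (hit_gf a b) (hit_gf b a) (hit_gf b b)"
proof -
  obtain r where r: "1 < r" "\<And>x c. length x = L \<Longrightarrow> c \<in> {a, b} \<Longrightarrow> geometric_seq (\<lambda>n. hit n x c) r"
    by (rule common_radius) blast
  interpret aa: geometric_seq "\<lambda>n. hit n a a" r using r(2) len by simp
  interpret ab: geometric_seq "\<lambda>n. hit n a b" r using r(2) len by simp
  interpret ba: geometric_seq "\<lambda>n. hit n b a" r using r(2) len by simp
  interpret bb: geometric_seq "\<lambda>n. hit n b b" r using r(2) len by simp
  note sums = stay_eqs[unfolded hitprob_def]
  have "renewal_kernel r stay (hitmean a a) (hitmean a b) (hitmean b a) (hitmean b b)
      (hit_gf a a) (hit_gf a b) (hit_gf b a) (hit_gf b b)"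
  proof
    fix z :: complex assume z: "norm z \<le> 1"
    show "norm (hit_gf a a z) + norm (hit_gf a b z) \<le> norm z"
      using aa.norm_gf_le_mult[OF z] ab.norm_gf_le_mult[OF z] unfolding sums by (simp add: algebra_simps)
    show "norm (hit_gf b a z) + norm (hit_gf b b z) \<le> norm z"
      using ba.norm_gf_le_mult[OF z] bb.norm_gf_le_mult[OF z] unfolding sums by (simp add: algebra_simps)
    show "norm (hit_gf a a z) \<le> stay" "norm (hit_gf a b z) \<le> 1 - stay"
       "norm (hit_gf b a z) \<le> 1 - stay" "norm (hit_gf b b z) \<le> stay"
      using aa.norm_gf_le[OF z] ab.norm_gf_le[OF z] ba.norm_gf_le[OF z] bb.norm_gf_le[OF z] unfolding sums by auto
    assume ne: "z \<noteq> 1" and e: "norm (hit_gf a a z) = stay" "norm (hit_gf a b z) = 1 - stay"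
       "norm (hit_gf b a z) = 1 - stay" "norm (hit_gf b b z) = stay"
    obtain u c m where "u \<in> {a, b}" "c \<in> {a, b}" "hit m u c > 0" "hit (Suc m) u c > 0"
      using consecutive_hits by blast
    thus False using ne z e
      aa.gf_norm_extremal[of m z] ab.gf_norm_extremal[of m z] ba.gf_norm_extremal[of m z] bb.gf_norm_extremal[of m z]
      unfolding sums by blast
  qed (use r stay_bounds hitmean_total in \<open>simp_all add: aa.holomorphic_gf ab.holomorphic_gf ba.holomorphic_gf bb.holomorphic_gf
      aa.gf_1 ab.gf_1 ba.gf_1 bb.gf_1 sums aa.deriv_gf_1 ab.deriv_gf_1 ba.deriv_gf_1 bb.deriv_gf_1 hitmean_def\<close>)
  thus ?thesis using that r by blast
qed


text \<open>
  The decomposition at the first hit, as an identity of generating functions.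
\<close>
lemma exceed_gf_first_hit:
  assumes x: "length x = L" and z: "norm z < 1"
  shows "exceed_gf x k z =
     (if k > 0 then inverse (1 - z) * (1 - hit_gf x a z - hit_gf x b z) else 0)
     + hit_gf x a z * exceed_gf a (k + 1) z + hit_gf x b z * exceed_gf b (k - 1) z"
proof -
  have hle: "\<bar>hit n x c\<bar> \<le> 1" if "c \<in> {a, b}" for n c
  proof (cases n)
    case (Suc t)
    thus ?thesis using hit_Suc_le_nohit[OF that, of t x] hit_nonneg[of n x c] nohit_bounds(2)[of t x] unfolding Suc by linarith
  qed simp
  note sh = summable_bounded_powers[OF z hle]
  have sa: "summable (\<lambda>n. norm (of_real (exceed n y j) * z ^ n))" for y j
    by (rule summable_bounded_powers[OF z abs_exceed_le])
  have s1: "summable (\<lambda>n. norm (of_real ((\<lambda>_. 1) n) * z ^ n))"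
    by (intro summable_bounded_powers[OF z]) simp
  have geo: "gf (\<lambda>_. 1) z = inverse (1 - z)"
    unfolding gf_def using suminf_geometric[of z] z by (simp add: inverse_eq_divide)
  have conv1: "(\<lambda>n. of_real (\<Sum>i\<le>n. hit i x c * 1) * z ^ n) sums (hit_gf x c z * inverse (1 - z))"
    if "c \<in> {a, b}" for c
    using gf_convolution[OF sh[OF that] s1] geo by simp
  have one: "(\<lambda>n. z ^ n) sums inverse (1 - z)"
    using geometric_sums[of z] z by (simp add: inverse_eq_divide)
  have "(\<lambda>n. z ^ n - of_real (\<Sum>i\<le>n. hit i x a * 1) * z ^ n - of_real (\<Sum>i\<le>n. hit i x b * 1) * z ^ n) sums
     (inverse (1 - z) - hit_gf x a z * inverse (1 - z) - hit_gf x b z * inverse (1 - z))"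
    by (intro sums_diff conv1 one) auto
  moreover have "z ^ n - of_real (\<Sum>i\<le>n. hit i x a * 1) * z ^ n - of_real (\<Sum>i\<le>n. hit i x b * 1) * z ^ n
     = of_real (nohit n x) * z ^ n" for n
  proof -
    have nn: "nohit n x = 1 - (\<Sum>i\<le>n. hit i x a * 1) - (\<Sum>i\<le>n. hit i x b * 1)"
      using total_probability[where t = n and x = x] by simp
    show ?thesis unfolding nn by (simp add: algebra_simps)
  qed
  ultimately have "(\<lambda>n. of_real (nohit n x) * z ^ n) sums
     (inverse (1 - z) - hit_gf x a z * inverse (1 - z) - hit_gf x b z * inverse (1 - z))"
    by (simp only:)
  hence nh: "(\<lambda>n. of_real (nohit n x) * z ^ n) sums
    (inverse (1 - z) * (1 - hit_gf x a z - hit_gf x b z))"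
    by (simp add: algebra_simps)
  have "(\<lambda>n. of_real (of_bool (k > 0)) * (of_real (nohit n x) * z ^ n) +
      of_real (\<Sum>i\<le>n. hit i x a * exceed (n - i) a (k + 1)) * z ^ n +
      of_real (\<Sum>i\<le>n. hit i x b * exceed (n - i) b (k - 1)) * z ^ n) sums
     (of_real (of_bool (k > 0)) * (inverse (1 - z) * (1 - hit_gf x a z - hit_gf x b z))
      + hit_gf x a z * exceed_gf a (k + 1) z + hit_gf x b z * exceed_gf b (k - 1) z)"
    by (intro sums_add sums_mult nh gf_convolution sh sa) auto
  moreover have "of_real (of_bool (k > 0)) * (of_real (nohit n x) * z ^ n) +
      of_real (\<Sum>i\<le>n. hit i x a * exceed (n - i) a (k + 1)) * z ^ n +
      of_real (\<Sum>i\<le>n. hit i x b * exceed (n - i) b (k - 1)) * z ^ n = of_real (exceed n x k) * z ^ n" for n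
    by (subst first_hit_decomposition) (simp add: sum.distrib algebra_simps)
  ultimately show ?thesis by (cases "k > 0") (simp_all add: gf_def sums_iff)
qed

lemma exceed_gf_bound: assumes "norm z < 1" shows "norm (exceed_gf x k z) \<le> 1 / (1 - norm z)"
proof -
  have s: "summable (\<lambda>n. norm (of_real (exceed n x k) * z ^ n))"
    by (rule summable_bounded_powers[OF assms abs_exceed_le])
  have "norm (exceed_gf x k z) \<le> (\<Sum>n. norm (of_real (exceed n x k) * z ^ n))"
    unfolding gf_def by (rule Series.summable_norm[OF s])
  also have "\<dots> \<le> (\<Sum>n. norm z ^ n)"
    using exceed_bounds[of _ x k] assms
    by (intro suminf_le s summable_geometric) (auto simp: norm_mult norm_power mult_left_le_one_le)
  also have "\<dots> = 1 / (1 - norm z)" using assms by (simp add: suminf_geometric)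
  finally show ?thesis .
qed

text \<open>
  A start inside the pair counts as a hit at time 0; hence the case distinction for \<open>pb\<close>, which is the
  probability that the first hit is at \<open>b\<close>.
\<close>
theorem exceed_asymptotics:
  assumes v: "length v = L"
  defines "pb \<equiv> (if v = b then 1 else if v = a then 0 else hitprob v b)"
  shows "(\<lambda>n. (exceed n v (sgn_word v) - 1/2) -
     ((stay / 2 - pb) * 2 ^ L + (hitmean a b - hitmean b a) / 2) / sqrt (4 * stay * (1 - stay) * 2 ^ L) / sqrt (pi * real n))
     \<in> o(\<lambda>n. 1 / sqrt (real n))"
proof -
  obtain r where r: "1 < r" "\<And>x c. length x = L \<Longrightarrow> c \<in> {a, b} \<Longrightarrow> geometric_seq (\<lambda>n. hit n x c) r"
   "renewal_kernel r stay (hitmean a a) (hitmean a b) (hitmean b a) (hitmean b b)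
      (hit_gf a a) (hit_gf a b) (hit_gf b a) (hit_gf b b)"
    by (rule kernel_exists) (rule that; assumption)
  interpret k: renewal_kernel r stay "hitmean a a" "hitmean a b" "hitmean b a" "hitmean b b"
      "hit_gf a a" "hit_gf a b" "hit_gf b a" "hit_gf b b"
    by (rule r(3))
  obtain \<rho> R where R: "1 < \<rho>" "\<rho> \<le> r" "R holomorphic_on ball 0 \<rho>"
     "\<And>z. z \<in> ball 0 \<rho> \<Longrightarrow> (R z)^2 = k.\<Theta> z" "\<And>z. z \<in> ball 0 \<rho> \<Longrightarrow> R z \<noteq> 0" "R 0 = 1"
    using k.sqrt_Theta_exists by blast
  interpret k: rooted_kernel r stay "hitmean a a" "hitmean a b" "hitmean b a" "hitmean b b"
      "hit_gf a a" "hit_gf a b" "hit_gf b a" "hit_gf b b" \<rho> R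
    by unfold_locales (use R in auto)
  have vals: "exceed_gf a 1 z = k.A z" "exceed_gf b (-1) z = k.B z" if z: "norm z < 1" for z
  proof -
    have mm: "k.big_root z \<noteq> k.small_root z" using k.small_less_big[OF z] by auto
    note lv = level_system_values[where U = "\<lambda>k. exceed_gf a k z" and V = "\<lambda>k. exceed_gf b k z",
        OF k.sub(1) k.sub(2) z exceed_gf_first_hit[OF len(1) z] exceed_gf_first_hit[OF len(2) z] exceed_gf_bound[OF z] exceed_gf_bound[OF z]
        k.roots_product_sum(1)[OF z] k.roots_shifted_product[OF z] mm k.big_root_dominates[OF z]]
    show "exceed_gf a 1 z = k.A z" "exceed_gf b (-1) z = k.B z"
      unfolding k.A_def k.B_def using lv z by simp_all
  qed
  define ra where "ra = (if v = a then (\<lambda>_. 1) else if v = b then (\<lambda>_. 0) else hit_gf v a)"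
  define rb where "rb = (if v = b then (\<lambda>_. 1) else if v = a then (\<lambda>_. 0) else hit_gf v b)"
  interpret va: geometric_seq "\<lambda>n. hit n v a" r using r(2) v by simp
  interpret vb: geometric_seq "\<lambda>n. hit n v b" r using r(2) v by simp
  have tame: "tame (\<lambda>z. (ra z * k.A z + rb z * k.B z - inverse (1 - z) / 2)
    - of_real (((stay / 2 - pb) * k.S + (hitmean a b - hitmean b a) / 2) / sqrt (4 * stay * (1 - stay) * k.S)) * inverse (csqrt (1 - z)))"
  proof (rule k.tame_mixture)
    show "ra holomorphic_on ball 0 r" "rb holomorphic_on ball 0 r"
      unfolding ra_def rb_def using va.holomorphic_gf vb.holomorphic_gf by auto
    show "ra 1 = of_real (1 - pb)" "rb 1 = of_real pb" "1 - pb + pb = 1"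
      using ab hitprob_total[OF v] unfolding ra_def rb_def pb_def
      by (auto simp: va.gf_1 vb.gf_1 hitprob_def[symmetric] algebra_simps simp flip: of_real_add)
  qed
  have S: "k.S = 2 ^ L" unfolding k.S_def using hitmean_total by simp
  show ?thesis
  proof (rule coeff_asymp_of_tame_remainder[OF tame[unfolded S]])
    fix z :: complex assume z: "norm z < 1"
    have val: "exceed_gf v (sgn_word v) z = ra z * k.A z + rb z * k.B z"
    proof -
      consider "v = a" | "v = b" | "v \<notin> {a, b}" by blast
      thus ?thesis
      proof cases
        case 3
        thus ?thesis using exceed_gf_first_hit[OF v z, of 0] vals[OF z] by (simp add: ra_def rb_def sgn_word_def)
      qed (use vals[OF z] ab in \<open>auto simp: ra_def rb_def sgn_word_def\<close>)
    qed
    have "summable (\<lambda>n. norm (of_real (exceed n v (sgn_word v)) * z ^ n))"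
      by (rule summable_bounded_powers[OF z abs_exceed_le])
    hence "(\<lambda>n. of_real (exceed n v (sgn_word v)) * z ^ n) sums exceed_gf v (sgn_word v) z"
      unfolding gf_def by (rule summable_sums[OF summable_norm_cancel])
    moreover have "(\<lambda>n. z ^ n / 2) sums (inverse (1 - z) / 2)"
      using sums_divide[OF geometric_sums[OF z], of 2] by (simp add: inverse_eq_divide)
    ultimately have "(\<lambda>n. of_real (exceed n v (sgn_word v)) * z ^ n - z ^ n / 2) sums (ra z * k.A z + rb z * k.B z - inverse (1 - z) / 2)"
      unfolding val by (intro sums_diff)
    thus "(\<lambda>n. of_real (exceed n v (sgn_word v) - 1/2) * z ^ n) sums (ra z * k.A z + rb z * k.B z - inverse (1 - z) / 2)"
      by (simp add: algebra_simps)
  qed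
qed

end

section \<open>Fair bits and the Markov property\<close>

definition word_fraction :: "nat \<Rightarrow> (bool list \<Rightarrow> bool) \<Rightarrow> real" where
  "word_fraction n \<Phi> = (\<Sum>w | length w = n. of_bool (\<Phi> w)) / 2 ^ n"

lemma word_fraction_0 [simp]: "word_fraction 0 \<Phi> = of_bool (\<Phi> [])"
  by (simp add: word_fraction_def)

lemma word_fraction_Suc: "word_fraction (Suc n) \<Phi> = (word_fraction n (\<lambda>w. \<Phi> (False # w)) + word_fraction n (\<lambda>w. \<Phi> (True # w))) / 2"
  unfolding word_fraction_def sum_lists_Cons by (simp add: sum.distrib add_divide_distrib)

lemma word_fraction_const [simp]: "word_fraction n (\<lambda>w. P) = of_bool P"
  by (induction n) (auto simp: word_fraction_Suc)

lemma word_fraction_cong: "(\<And>w. length w = n \<Longrightarrow> \<Phi> w = \<Psi> w) \<Longrightarrow> word_fraction n \<Phi> = word_fraction n \<Psi>"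
  unfolding word_fraction_def by (auto intro: sum.cong)

text \<open>
  Disjoint parts of a uniformly distributed word are independent.
\<close>
lemma word_fraction_append: "word_fraction (s + n) (\<lambda>w. \<Phi> (take s w) \<and> \<Psi> (drop s w)) = word_fraction s \<Phi> * word_fraction n \<Psi>"
proof (induction s arbitrary: \<Phi>)
  case (Suc s)
  show ?case
    unfolding add_Suc word_fraction_Suc take_Suc_Cons drop_Suc_Cons
      Suc.IH[of "\<lambda>w. \<Phi> (False # w)"] Suc.IH[of "\<lambda>w. \<Phi> (True # w)"] by (simp add: field_simps)
qed simp

context word_pair begin

primrec first_at :: "bool list \<Rightarrow> bool list \<Rightarrow> bool list \<Rightarrow> bool" where
  "first_at [] x c = False"
| "first_at (e # w) x c =
    (if advance x e \<in> {a, b} then w = [] \<and> advance x e = c else first_at w (advance x e) c)"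

primrec avoids :: "bool list \<Rightarrow> bool list \<Rightarrow> bool" where
  "avoids [] x = True"
| "avoids (e # w) x = (advance x e \<notin> {a, b} \<and> avoids w (advance x e))"

primrec score :: "bool list \<Rightarrow> bool list \<Rightarrow> int" where
  "score [] x = 0"
| "score (e # w) x = sgn_word (advance x e) + score w (advance x e)"

lemma word_fraction_first_at: "word_fraction n (\<lambda>w. first_at w x c) = hit n x c"
proof (induction n arbitrary: x)
  case (Suc n)
  have "word_fraction n (\<lambda>w. first_at (e # w) x c) =
    (if advance x e \<in> {a, b} then of_bool (n = 0 \<and> advance x e = c) else hit n (advance x e) c)" for e
  proof (cases "advance x e \<in> {a, b}")
    case True
    have "word_fraction n (\<lambda>w. first_at (e # w) x c) = word_fraction n (\<lambda>w. n = 0 \<and> advance x e = c)"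
      using True by (intro word_fraction_cong) auto
    thus ?thesis using True by simp
  qed (simp add: Suc)
  thus ?case unfolding word_fraction_Suc by (simp add: avg_def)
qed simp

lemma word_fraction_avoids: "word_fraction n (\<lambda>w. avoids w x) = nohit n x"
proof (induction n arbitrary: x)
  case (Suc n)
  have "word_fraction n (\<lambda>w. avoids (e # w) x) = (if advance x e \<in> {a, b} then 0 else nohit n (advance x e))" for e
    using Suc by (cases "advance x e \<in> {a, b}") auto
  thus ?case unfolding word_fraction_Suc by (simp add: avg_def)
qed simp

lemma word_fraction_score: "word_fraction n (\<lambda>w. k + score w x > 0) = exceed n x k"
proof (induction n arbitrary: x k)
  case (Suc n)
  have "word_fraction n (\<lambda>w. k + score (e # w) x > 0) = exceed n (advance x e) (k + sgn_word (advance x e))" for e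
    using Suc[of "k + sgn_word (advance x e)"] by (simp add: add.assoc)
  thus ?case unfolding word_fraction_Suc by (simp add: avg_def)
qed simp

lemma first_at_iff:
  "first_at w x c \<longleftrightarrow> w \<noteq> [] \<and> c \<in> {a, b} \<and> foldl advance x w = c \<and>
     (\<forall>i. 0 < i \<longrightarrow> i < length w \<longrightarrow> foldl advance x (take i w) \<notin> {a, b})"
proof (induction w arbitrary: x)
  case (Cons e w)
  let ?P = "\<lambda>i. foldl advance x (take i (e # w)) \<notin> {a, b}"
  have split: "(\<forall>i. 0 < i \<longrightarrow> i < length (e # w) \<longrightarrow> ?P i) \<longleftrightarrow>
     (w \<noteq> [] \<longrightarrow> advance x e \<notin> {a, b}) \<and> (\<forall>i. 0 < i \<longrightarrow> i < length w \<longrightarrow> foldl advance (advance x e) (take i w) \<notin> {a, b})"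
  proof -
    define Q where "Q = (\<lambda>i. foldl advance (advance x e) (take i w) \<notin> {a, b})"
    have "(\<forall>i. 0 < i \<longrightarrow> i < length (e # w) \<longrightarrow> ?P i) \<longleftrightarrow> (\<forall>j<length w. Q j)"
    proof (intro iffI allI impI)
      fix j assume "\<forall>i. 0 < i \<longrightarrow> i < length (e # w) \<longrightarrow> ?P i" "j < length w"
      thus "Q j" unfolding Q_def by (auto dest: spec[of _ "Suc j"])
    next
      fix i assume "\<forall>j<length w. Q j" "0 < i" "i < length (e # w)"
      thus "?P i" unfolding Q_def by (cases i) auto
    qed
    also have "\<dots> \<longleftrightarrow> (w \<noteq> [] \<longrightarrow> Q 0) \<and> (\<forall>i. 0 < i \<longrightarrow> i < length w \<longrightarrow> Q i)"
      by (metis gr0I length_greater_0_conv)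
    finally show ?thesis by (simp add: Q_def)
  qed
  show ?case
  proof (cases "advance x e \<in> {a, b}")
    case True thus ?thesis unfolding split by auto
  next
    case False
    thus ?thesis unfolding split using Cons.IH[of "advance x e"] by (cases "w = []") auto
  qed
qed simp

lemma avoids_iff:
  "avoids w x \<longleftrightarrow> (\<forall>i. 0 < i \<longrightarrow> i \<le> length w \<longrightarrow> foldl advance x (take i w) \<notin> {a, b})"
proof (induction w arbitrary: x)
  case (Cons e w)
  show ?case
  proof
    assume A: "avoids (e # w) x"
    show "\<forall>i. 0 < i \<longrightarrow> i \<le> length (e # w) \<longrightarrow> foldl advance x (take i (e # w)) \<notin> {a, b}"
    proof (intro allI impI)
      fix i assume i: "0 < i" "i \<le> length (e # w)"
      then obtain j where "i = Suc j" by (cases i) auto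
      thus "foldl advance x (take i (e # w)) \<notin> {a, b}"
        using A Cons.IH[of "advance x e"] i by (cases "j = 0") auto
    qed
  next
    assume B: "\<forall>i. 0 < i \<longrightarrow> i \<le> length (e # w) \<longrightarrow> foldl advance x (take i (e # w)) \<notin> {a, b}"
    have "foldl advance (advance x e) (take i w) \<notin> {a, b}" if "0 < i" "i \<le> length w" for i
      using B[rule_format, of "Suc i"] that by simp
    thus "avoids (e # w) x" using Cons.IH[of "advance x e"] B[rule_format, of 1] by simp
  qed
qed simp

lemma score_snoc: "score (w @ [e]) x = score w x + sgn_word (foldl advance x (w @ [e]))"
  by (induction w arbitrary: x) auto

end

definition segment :: "(nat \<Rightarrow> 'w \<Rightarrow> bool) \<Rightarrow> nat \<Rightarrow> nat \<Rightarrow> 'w \<Rightarrow> bool list" where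
  "segment X s n \<omega> = map (\<lambda>i. X i \<omega>) [Suc s..<Suc (s + n)]"

lemma length_segment [simp]: "length (segment X s n \<omega>) = n"
  by (simp add: segment_def)

lemma segment_0 [simp]: "segment X s 0 \<omega> = []"
  by (simp add: segment_def)

lemma segment_Suc: "segment X s (Suc n) \<omega> = segment X s n \<omega> @ [X (Suc (s + n)) \<omega>]"
  by (simp add: segment_def)

lemma segment_add: "segment X s (m + n) \<omega> = segment X s m \<omega> @ segment X (s + m) n \<omega>"
  by (induction n) (simp_all add: segment_Suc add.assoc)

lemma take_segment: "i \<le> n \<Longrightarrow> take i (segment X s n \<omega>) = segment X s i \<omega>"
  using segment_add[of X s i "n - i" \<omega>] by simp

lemma window_advance:
  assumes "L \<ge> 1" "L \<le> t" shows "window X L (Suc t) \<omega> = advance (window X L t \<omega>) (X (Suc t) \<omega>)"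
proof -
  have "[Suc t + 1 - L..<Suc t + 1] = tl [t + 1 - L..<t + 1] @ [Suc t]"
  proof -
    have "Suc t + 1 - L = Suc (t + 1 - L)" using assms by simp
    moreover have "[Suc (t + 1 - L)..<Suc (t + 1)] = [Suc (t + 1 - L)..<t + 1] @ [t + 1]"
      using assms by (intro upt_Suc_append) simp
    ultimately show ?thesis by (simp add: tl_upt del: upt_Suc)
  qed
  thus ?thesis using assms by (simp add: window_def advance_def map_tl[symmetric] del: upt_Suc)
qed

lemma window_segment:
  assumes "L \<ge> 1" "L \<le> s" shows "window X L (s + n) \<omega> = foldl advance (window X L s \<omega>) (segment X s n \<omega>)"
proof (induction n)
  case (Suc n)
  have "window X L (Suc (s + n)) \<omega> = advance (window X L (s + n) \<omega>) (X (Suc (s + n)) \<omega>)"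
    using assms by (intro window_advance) auto
  thus ?case using Suc by (simp add: segment_Suc)
qed simp

lemma window_start: "L \<ge> 1 \<Longrightarrow> window X L L \<omega> = segment X 0 L \<omega>"
  by (simp add: window_def segment_def)

lemma window_prefix: "L \<le> t \<Longrightarrow> t \<le> n \<Longrightarrow> window X L t \<omega> = take L (drop (t - L) (segment X 0 n \<omega>))"
proof -
  assume h: "L \<le> t" "t \<le> n"
  have "take L (drop (t - L) [Suc 0..<Suc n]) = [Suc (t - L)..<Suc t]"
    using h by (simp add: drop_upt take_upt del: upt_Suc)
  thus ?thesis using h by (simp add: window_def segment_def take_map drop_map Suc_diff_le del: upt_Suc)
qed

lemma length_window: "L \<le> t \<Longrightarrow> length (window X L t \<omega>) = L"
  by (simp add: window_def del: upt_Suc)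

locale fair_process = prob_space M for M :: "'w measure" +
  fixes X :: "nat \<Rightarrow> 'w \<Rightarrow> bool"
  assumes indep: "indep_vars (\<lambda>_. count_space UNIV) X {1..}"
    and fair: "\<And>i. i \<ge> 1 \<Longrightarrow> prob {\<omega> \<in> space M. X i \<omega> = e} = 1 / 2"
begin

lemma measurable_X [measurable]: "i \<ge> 1 \<Longrightarrow> X i \<in> M \<rightarrow>\<^sub>M count_space UNIV"
  using indep unfolding indep_vars_def by auto

lemma sets_segment_eq: "{\<omega> \<in> space M. segment X s n \<omega> = w} \<in> sets M"
proof -
  have "{\<omega> \<in> space M. segment X s n \<omega> = w} =
    (if length w = n then {\<omega> \<in> space M. \<forall>i\<in>{..<n}. X (Suc (s + i)) \<omega> = w ! i} else {})"
    by (auto simp: segment_def list_eq_iff_nth_eq simp del: upt_Suc)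
  moreover have "{\<omega> \<in> space M. \<forall>i\<in>{..<n}. X (Suc (s + i)) \<omega> = w ! i} \<in> sets M"
    by measurable
  ultimately show ?thesis by simp
qed

lemma sets_segment: "{\<omega> \<in> space M. \<Phi> (segment X s n \<omega>)} \<in> sets M"
proof -
  have "{\<omega> \<in> space M. \<Phi> (segment X s n \<omega>)} = (\<Union>w\<in>{w. \<Phi> w}. {\<omega> \<in> space M. segment X s n \<omega> = w})" by auto
  also have "\<dots> \<in> sets M" by (intro sets.countable_UN'' sets_segment_eq) auto
  finally show ?thesis .
qed

lemma prob_segment_eq: assumes "length w = n" shows "prob {\<omega> \<in> space M. segment X 0 n \<omega> = w} = 1 / 2 ^ n"
proof (cases "n = 0")
  case True thus ?thesis using assms by (simp add: prob_space)
next
  case False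
  have eq: "{\<omega> \<in> space M. segment X 0 n \<omega> = w} = (\<Inter>i\<in>{1..n}. X i -` {w ! (i - 1)} \<inter> space M)"
  proof -
    have 1: "segment X 0 n \<omega> = w \<longleftrightarrow> (\<forall>j<n. X (Suc j) \<omega> = w ! j)" for \<omega>
      using assms by (auto simp: segment_def list_eq_iff_nth_eq simp del: upt_Suc)
    have "(\<forall>j<n. X (Suc j) \<omega> = w ! j) \<longleftrightarrow> (\<forall>i\<in>{1..n}. X i \<omega> = w ! (i - 1))" for \<omega>
    proof (rule iffI; intro ballI allI impI)
      fix i assume "\<forall>j<n. X (Suc j) \<omega> = w ! j" "i \<in> {1..n}"
      thus "X i \<omega> = w ! (i - 1)" by (cases i) auto
    next
      fix j assume "\<forall>i\<in>{1..n}. X i \<omega> = w ! (i - 1)" "j < n"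
      thus "X (Suc j) \<omega> = w ! j" by (auto dest: bspec[of _ _ "Suc j"])
    qed
    thus ?thesis using False unfolding 1 by auto
  qed
  have "prob (\<Inter>i\<in>{1..n}. X i -` {w ! (i - 1)} \<inter> space M) = (\<Prod>i\<in>{1..n}. prob (X i -` {w ! (i - 1)} \<inter> space M))"
    using False by (intro indep_varsD[OF indep]) auto
  also have "\<dots> = (\<Prod>i\<in>{1..n}. 1 / 2)"
  proof (rule prod.cong)
    fix i assume "i \<in> {1..n}"
    moreover have "X i -` {w ! (i - 1)} \<inter> space M = {\<omega> \<in> space M. X i \<omega> = w ! (i - 1)}" by auto
    ultimately show "prob (X i -` {w ! (i - 1)} \<inter> space M) = 1 / 2" using fair[of i] by simp
  qed simp
  also have "\<dots> = 1 / 2 ^ n" by (simp add: power_divide)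
  finally show ?thesis unfolding eq .
qed

lemma prob_segment: "prob {\<omega> \<in> space M. \<Phi> (segment X 0 n \<omega>)} = word_fraction n \<Phi>"
proof -
  let ?W = "{w. length w = n \<and> \<Phi> w}"
  have fin: "finite ?W" using finite_lists_length_eq[of "UNIV :: bool set" n] by simp
  have "{\<omega> \<in> space M. \<Phi> (segment X 0 n \<omega>)} = (\<Union>w\<in>?W. {\<omega> \<in> space M. segment X 0 n \<omega> = w})" by auto
  also have "prob \<dots> = (\<Sum>w\<in>?W. prob {\<omega> \<in> space M. segment X 0 n \<omega> = w})"
    using fin by (intro finite_measure_finite_Union) (auto simp: sets_segment_eq disjoint_family_on_def)
  also have "\<dots> = (\<Sum>w\<in>?W. 1 / 2 ^ n)" by (intro sum.cong) (auto simp: prob_segment_eq)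
  also have "\<dots> = (\<Sum>w | length w = n. of_bool (\<Phi> w) / 2 ^ n)"
    using finite_lists_length_eq[of "UNIV :: bool set" n] by (intro sum.mono_neutral_cong_left) auto
  finally show ?thesis unfolding word_fraction_def sum_divide_distrib .
qed

lemma markov:
  "prob {\<omega> \<in> space M. \<Phi> (segment X 0 s \<omega>) \<and> \<Psi> (segment X s n \<omega>)}
     = prob {\<omega> \<in> space M. \<Phi> (segment X 0 s \<omega>)} * word_fraction n \<Psi>"
proof -
  have "{\<omega> \<in> space M. \<Phi> (segment X 0 s \<omega>) \<and> \<Psi> (segment X s n \<omega>)}
     = {\<omega> \<in> space M. \<Phi> (take s (segment X 0 (s + n) \<omega>)) \<and> \<Psi> (drop s (segment X 0 (s + n) \<omega>))}"
    by (simp add: segment_add)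
  thus ?thesis by (simp only: prob_segment prob_segment[of "\<lambda>w. \<Phi> (take s w) \<and> \<Psi> (drop s w)"] word_fraction_append)
qed

end

section \<open>Hitting times of the process\<close>

lemma window_eq_segment: "L \<le> t \<Longrightarrow> window X L t \<omega> = segment X (t - L) L \<omega>"
  by (simp add: window_def segment_def Suc_diff_le del: upt_Suc)

locale fair_pair = fair_process M X + word_pair L a b
  for M :: "'w measure" and X :: "nat \<Rightarrow> 'w \<Rightarrow> bool" and L :: nat and a b :: "bool list"
begin

abbreviation "W \<equiv> window X L"
abbreviation "T \<equiv> hit_time X L a b"
abbreviation "Y \<equiv> hit_sign X L a b"

lemma window_hit_ge: "W t \<omega> \<in> {a, b} \<Longrightarrow> L \<le> t"
  using len L by (auto simp: window_def split: if_splits)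

lemma hit_time_Suc_eq:
  assumes "T k \<omega> < t" "W t \<omega> \<in> {a, b}" "\<And>i. T k \<omega> < i \<Longrightarrow> i < t \<Longrightarrow> W i \<omega> \<notin> {a, b}"
  shows "T (Suc k) \<omega> = t"
  unfolding hit_time.simps
proof (rule Least_equality)
  fix i assume "T k \<omega> < i \<and> W i \<omega> \<in> {a, b}"
  thus "t \<le> i" using assms(3)[of i] by (meson not_le)
qed (use assms in auto)

definition first_hit_at :: "nat \<Rightarrow> bool list \<Rightarrow> 'w \<Rightarrow> bool" where
  "first_hit_at t c \<omega> \<longleftrightarrow> t > 0 \<and> c \<in> {a, b} \<and> W t \<omega> = c \<and> (\<forall>i. 0 < i \<longrightarrow> i < t \<longrightarrow> W i \<omega> \<notin> {a, b})"

text \<open>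
  The word \<open>c\<close> is hit first, at time \<open>t\<close>, and \<open>c'\<close> second, \<open>j\<close> steps later. In contrast to an equation for
  \<open>T\<close>, this depends on finitely many letters only.
\<close>
definition two_hits :: "nat \<Rightarrow> bool list \<Rightarrow> nat \<Rightarrow> bool list \<Rightarrow> 'w \<Rightarrow> bool" where
  "two_hits t c j c' \<omega> \<longleftrightarrow> first_hit_at t c \<omega> \<and> first_at (segment X t j \<omega>) c c'"

definition sign_of :: "bool list \<Rightarrow> int" where "sign_of c = (if c = a then 1 else - 1)"

lemma hit_sign_eq: "W (T k \<omega>) \<omega> = c \<Longrightarrow> c \<in> {a, b} \<Longrightarrow> Y k \<omega> = sign_of c"
  using ab by (auto simp: hit_sign_def sign_of_def)

lemma sign_of_inj: "c \<in> {a, b} \<Longrightarrow> c' \<in> {a, b} \<Longrightarrow> sign_of c = sign_of c' \<longleftrightarrow> c = c'"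
  using ab by (auto simp: sign_of_def)

lemma first_hitD:
  assumes "first_hit_at t c \<omega>"
  shows "T 1 \<omega> = t" "W t \<omega> = c" "c \<in> {a, b}" "Y 1 \<omega> = sign_of c" "L \<le> t"
proof -
  show c: "W t \<omega> = c" "c \<in> {a, b}" using assms by (auto simp: first_hit_at_def)
  show t: "T 1 \<omega> = t" unfolding One_nat_def
    by (rule hit_time_Suc_eq) (use assms in \<open>auto simp: first_hit_at_def\<close>)
  show "Y 1 \<omega> = sign_of c" by (rule hit_sign_eq) (use t c in auto)
  show "L \<le> t" using window_hit_ge c by blast
qed

lemma first_at_segment_iff:
  assumes "L \<le> t" "W t \<omega> = x"
  shows "first_at (segment X t j \<omega>) x c \<longleftrightarrow> j > 0 \<and> c \<in> {a, b} \<and> W (t + j) \<omega> = c \<and>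
     (\<forall>i. 0 < i \<longrightarrow> i < j \<longrightarrow> W (t + i) \<omega> \<notin> {a, b})"
proof -
  have w: "foldl advance x (segment X t i \<omega>) = W (t + i) \<omega>" for i
    using window_segment[OF L assms(1), of X i \<omega>] assms(2) by simp
  have ne: "segment X t j \<omega> \<noteq> [] \<longleftrightarrow> j > 0" by (metis length_segment length_greater_0_conv)
  have "(\<forall>i. 0 < i \<longrightarrow> i < j \<longrightarrow> foldl advance x (take i (segment X t j \<omega>)) \<notin> {a, b}) \<longleftrightarrow>
      (\<forall>i. 0 < i \<longrightarrow> i < j \<longrightarrow> W (t + i) \<omega> \<notin> {a, b})"
    by (intro all_cong1 imp_cong refl) (simp add: take_segment w)
  thus ?thesis unfolding first_at_iff ne length_segment w by simp
qed

lemma two_hitsD: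
  assumes "two_hits t c j c' \<omega>"
  shows "T 1 \<omega> = t" "T 2 \<omega> = t + j" "c \<in> {a, b}" "c' \<in> {a, b}" "Y 1 \<omega> = sign_of c" "Y 2 \<omega> = sign_of c'" "L \<le> t"
    "first_hit_at t c \<omega>" "j > 0"
proof -
  have f: "first_hit_at t c \<omega>" and g: "first_at (segment X t j \<omega>) c c'"
    using assms by (auto simp: two_hits_def)
  show "first_hit_at t c \<omega>" by (rule f)
  note F = first_hitD[OF f]
  show "T 1 \<omega> = t" "c \<in> {a, b}" "Y 1 \<omega> = sign_of c" "L \<le> t" by fact+
  note G = g[unfolded first_at_segment_iff[OF F(5,2)]]
  show c': "c' \<in> {a, b}" "j > 0" using G by auto
  show t2: "T 2 \<omega> = t + j" unfolding numeral_2_eq_2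
  proof (rule hit_time_Suc_eq)
    fix i assume i: "T (Suc 0) \<omega> < i" "i < t + j"
    have "0 < i - t" "i - t < j" using i F(1) by auto
    hence "W (t + (i - t)) \<omega> \<notin> {a, b}" using G by blast
    moreover have "t + (i - t) = i" using i F(1) by simp
    ultimately show "W i \<omega> \<notin> {a, b}" by simp
  qed (use G F(1) in auto)
  show "Y 2 \<omega> = sign_of c'" by (rule hit_sign_eq) (use G c' t2 in auto)
qed

lemma two_hits_unique:
  assumes "two_hits t c j c' \<omega>" "two_hits t' d j' d' \<omega>"
  shows "t' = t" "d = c" "j' = j" "d' = c'"
  using two_hitsD[OF assms(1)] two_hitsD[OF assms(2)] sign_of_inj by auto

text \<open>
  On this almost sure event all \<open>LEAST\<close> operators in the hitting times are attained.
\<close>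
definition hits_recur :: "'w \<Rightarrow> bool" where "hits_recur \<omega> \<longleftrightarrow> (\<forall>s. \<exists>t>s. W t \<omega> \<in> {a, b})"

lemma next_hit:
  assumes "hits_recur \<omega>" "L \<le> s"
  shows "\<exists>j c. first_at (segment X s j \<omega>) (W s \<omega>) c"
proof -
  define P where "P = (\<lambda>j. j > 0 \<and> W (s + j) \<omega> \<in> {a, b})"
  obtain t where "t > s" "W t \<omega> \<in> {a, b}" using assms(1) by (auto simp: hits_recur_def)
  hence "P (t - s)" by (simp add: P_def)
  hence 1: "P (LEAST j. P j)" by (rule LeastI)
  have 2: "\<not> P i" if "i < (LEAST j. P j)" for i using that by (rule not_less_Least)
  show ?thesis
    using 1 2 by (intro exI[of _ "LEAST j. P j"] exI[of _ "W (s + (LEAST j. P j)) \<omega>"])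
      (auto simp: first_at_segment_iff[OF assms(2) refl] P_def)
qed

lemma recur_first_hit: assumes "hits_recur \<omega>" shows "\<exists>t c. first_hit_at t c \<omega>"
proof -
  define P where "P = (\<lambda>t. t > 0 \<and> W t \<omega> \<in> {a, b})"
  obtain t where "P t" using assms by (auto simp: hits_recur_def P_def)
  hence 1: "P (LEAST j. P j)" by (rule LeastI)
  have 2: "\<not> P i" if "i < (LEAST j. P j)" for i using that by (rule not_less_Least)
  show ?thesis using 1 2 by (intro exI[of _ "LEAST j. P j"] exI[of _ "W (LEAST j. P j) \<omega>"])
      (auto simp: first_hit_at_def P_def)
qed

lemma recur_two_hits: assumes "hits_recur \<omega>" shows "\<exists>t c j c'. two_hits t c j c' \<omega>"
proof -
  obtain t c where t: "first_hit_at t c \<omega>" using recur_first_hit[OF assms] by blast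
  thus ?thesis using next_hit[OF assms first_hitD(5)[OF t]] first_hitD(2)[OF t] by (auto simp: two_hits_def)
qed

lemma sets_window: "{\<omega> \<in> space M. \<Phi> (W t \<omega>)} \<in> sets M"
proof (cases "L \<le> t")
  case True thus ?thesis using sets_segment[of \<Phi> "t - L" L] by (simp add: window_eq_segment)
next
  case False thus ?thesis by (simp add: window_def)
qed

lemma prob_avoid_tendsto:
  assumes "L \<le> s" shows "(\<lambda>n. prob {\<omega> \<in> space M. avoids (segment X s n \<omega>) (W s \<omega>)}) \<longlonglongrightarrow> 0"
proof (rule tendsto_sandwich[of "\<lambda>_. 0" _ _ "\<lambda>n. \<Sum>x\<in>Words. nohit n x"])
  have "(\<lambda>n. \<Sum>x\<in>Words. nohit n x) \<longlonglongrightarrow> (\<Sum>x\<in>Words. 0)"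
    by (intro tendsto_sum nohit_tendsto_0) auto
  thus "(\<lambda>n. \<Sum>x\<in>Words. nohit n x) \<longlonglongrightarrow> 0" by simp
  show "eventually (\<lambda>n. prob {\<omega> \<in> space M. avoids (segment X s n \<omega>) (W s \<omega>)} \<le> (\<Sum>x\<in>Words. nohit n x)) sequentially"
  proof (intro always_eventually allI)
    fix n
    let ?A = "\<lambda>x. {\<omega> \<in> space M. (take L (drop (s - L) (segment X 0 s \<omega>)) = x) \<and> avoids (segment X s n \<omega>) x}"
    have A: "?A x \<in> sets M" for x
      by (rule sets.sets_Collect_conj[OF sets_segment[of "\<lambda>u. avoids u x"] sets_segment[of "\<lambda>u. take L (drop (s - L) u) = x"]])
    have "{\<omega> \<in> space M. avoids (segment X s n \<omega>) (W s \<omega>)} \<subseteq> (\<Union>x\<in>Words. ?A x)"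
      using window_prefix[OF assms order_refl, of X] length_window[OF assms, of X] by auto
    hence "prob {\<omega> \<in> space M. avoids (segment X s n \<omega>) (W s \<omega>)} \<le> prob (\<Union>x\<in>Words. ?A x)"
      using A finite_Words by (intro finite_measure_mono) auto
    also have "\<dots> \<le> (\<Sum>x\<in>Words. prob (?A x))"
      using A finite_Words by (intro finite_measure_subadditive_finite) auto
    also have "\<dots> \<le> (\<Sum>x\<in>Words. nohit n x)"
    proof (rule sum_mono)
      fix x
      have "prob (?A x) = prob {\<omega> \<in> space M. take L (drop (s - L) (segment X 0 s \<omega>)) = x} * nohit n x"
        using markov[of "\<lambda>u. take L (drop (s - L) u) = x" s "\<lambda>u. avoids u x" n] by (simp only: word_fraction_avoids)
      also have "\<dots> \<le> 1 * nohit n x" using nohit_bounds by (intro mult_right_mono) auto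
      finally show "prob (?A x) \<le> nohit n x" by simp
    qed
    finally show "prob {\<omega> \<in> space M. avoids (segment X s n \<omega>) (W s \<omega>)} \<le> (\<Sum>x\<in>Words. nohit n x)" .
  qed
qed auto

lemma AE_hits_recur: "AE \<omega> in M. hits_recur \<omega>"
  unfolding hits_recur_def AE_all_countable
proof
  fix s
  \<comment> \<open>windows are complete only from time \<open>L\<close> on\<close>
  define s' where "s' = max s L"
  let ?N = "{\<omega> \<in> space M. \<forall>t. s' < t \<longrightarrow> W t \<omega> \<notin> {a, b}}"
  have "{\<omega> \<in> space M. s' < t \<longrightarrow> W t \<omega> \<notin> {a, b}} \<in> sets M" for t
    using sets_window[of "\<lambda>w. s' < t \<longrightarrow> w \<notin> {a, b}" t] .
  hence N: "?N \<in> sets M" by (rule sets.sets_Collect_countable_All)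
  have "prob ?N \<le> 0"
  proof (rule tendsto_lowerbound[OF prob_avoid_tendsto[of s']])
    show "L \<le> s'" by (simp add: s'_def)
    show "eventually (\<lambda>n. prob ?N \<le> prob {\<omega> \<in> space M. avoids (segment X s' n \<omega>) (W s' \<omega>)}) sequentially"
    proof (intro always_eventually allI)
      fix n
      have Av: "{\<omega> \<in> space M. avoids (segment X s' n \<omega>) (W s' \<omega>)} \<in> sets M"
      proof -
        have "W s' \<omega> = segment X (s' - L) L \<omega>" "segment X s' n \<omega> = drop L (segment X (s' - L) (L + n) \<omega>)"
          "segment X (s' - L) L \<omega> = take L (segment X (s' - L) (L + n) \<omega>)" for \<omega>
          by (simp_all add: window_eq_segment segment_add s'_def)
        thus ?thesis using sets_segment[of "\<lambda>u. avoids (drop L u) (take L u)" "s' - L" "L + n"] by simp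
      qed
      have "avoids (segment X s' n \<omega>) (W s' \<omega>)" if "\<omega> \<in> ?N" for \<omega>
        unfolding avoids_iff
      proof (intro allI impI)
        fix i assume i: "0 < i" "i \<le> length (segment X s' n \<omega>)"
        have "foldl advance (W s' \<omega>) (take i (segment X s' n \<omega>)) = W (s' + i) \<omega>"
          using i window_segment[OF L, of s' X i \<omega>] by (simp add: take_segment s'_def)
        thus "foldl advance (W s' \<omega>) (take i (segment X s' n \<omega>)) \<notin> {a, b}" using that i by simp
      qed
      thus "prob ?N \<le> prob {\<omega> \<in> space M. avoids (segment X s' n \<omega>) (W s' \<omega>)}"
        using Av by (intro finite_measure_mono) auto
    qed
  qed simp
  hence "prob ?N = 0" using measure_nonneg[of M ?N] by (rule antisym)
  hence "emeasure M ?N = 0" unfolding emeasure_eq_measure by (simp only: ennreal_0)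
  hence "?N \<in> null_sets M" using N by (rule null_setsI)
  thus "AE \<omega> in M. \<exists>t>s. W t \<omega> \<in> {a, b}"
    by (rule AE_I') (auto simp: s'_def)
qed

lemma measurable_hit_time: "T k \<in> M \<rightarrow>\<^sub>M count_space UNIV"
proof (induction k)
  case (Suc k)
  have "(\<lambda>\<omega>. LEAST t. t > T k \<omega> \<and> W t \<omega> \<in> {a, b}) \<in> M \<rightarrow>\<^sub>M count_space UNIV"
  proof (rule measurable_Least)
    fix t
    have "{\<omega> \<in> space M. T k \<omega> < t} = T k -` {..<t} \<inter> space M" by auto
    also have "\<dots> \<in> sets M" using Suc by (rule measurable_sets) auto
    finally have "{\<omega> \<in> space M. T k \<omega> < t \<and> W t \<omega> \<in> {a, b}} \<in> sets M"
      by (rule sets.sets_Collect_conj[OF sets_window[of "\<lambda>w. w \<in> {a, b}"]])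
    thus "(\<lambda>\<omega>. t > T k \<omega> \<and> W t \<omega> \<in> {a, b}) \<in> M \<rightarrow>\<^sub>M count_space UNIV" by (simp add: pred_def)
  qed
  thus ?case by simp
qed simp

lemma measurable_hit_sign: "Y k \<in> M \<rightarrow>\<^sub>M count_space UNIV"
proof -
  have s: "{\<omega> \<in> space M. W (T k \<omega>) \<omega> = c} \<in> sets M" for c
  proof -
    have "{\<omega> \<in> space M. W (T k \<omega>) \<omega> = c} = (\<Union>t. (T k -` {t} \<inter> space M) \<inter> {\<omega> \<in> space M. W t \<omega> = c})" by auto
    also have "\<dots> \<in> sets M" using measurable_hit_time sets_window[of "\<lambda>w. w = c"]
      by (intro sets.countable_UN'' sets.Int measurable_sets[OF measurable_hit_time]) auto
    finally show ?thesis .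
  qed
  have [measurable]: "Measurable.pred M (\<lambda>\<omega>. W (T k \<omega>) \<omega> = a)" "Measurable.pred M (\<lambda>\<omega>. W (T k \<omega>) \<omega> = b)"
    using s by (auto simp: pred_def)
  show ?thesis unfolding hit_sign_def[abs_def] by measurable
qed

lemma sets_hit_sign: "{\<omega> \<in> space M. \<Phi> (Y k \<omega>)} \<in> sets M"
proof -
  have "{\<omega> \<in> space M. \<Phi> (Y k \<omega>)} = Y k -` {y. \<Phi> y} \<inter> space M" by auto
  also have "\<dots> \<in> sets M" by (rule measurable_sets[OF measurable_hit_sign]) simp
  finally show ?thesis .
qed

text \<open>
  A first hit at time \<open>t\<close> as a condition on the first \<open>t\<close> letters, the form in which \<open>markov\<close>
  applies. Windows that end before time \<open>L\<close> are empty and never hit the pair.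
\<close>
definition "first_pattern t c = (\<lambda>u. L \<le> t \<and> c \<in> {a, b} \<and> take L (drop (t - L) u) = c \<and>
    (\<forall>i. L \<le> i \<longrightarrow> i < t \<longrightarrow> take L (drop (i - L) u) \<notin> {a, b}))"

lemma first_hit_at_iff: "first_hit_at t c \<omega> \<longleftrightarrow> first_pattern t c (segment X 0 t \<omega>)"
proof -
  have "W i \<omega> \<notin> {a, b}" if "i < L" for i using that window_hit_ge by (meson not_le)
  hence "first_hit_at t c \<omega> \<longleftrightarrow> L \<le> t \<and> c \<in> {a, b} \<and> W t \<omega> = c \<and> (\<forall>i. L \<le> i \<longrightarrow> i < t \<longrightarrow> W i \<omega> \<notin> {a, b})"
    unfolding first_hit_at_def using L by (metis One_nat_def Suc_le_eq le_trans not_le)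
  also have "\<dots> \<longleftrightarrow> first_pattern t c (segment X 0 t \<omega>)"
    unfolding first_pattern_def using window_prefix[of L _ t X \<omega>] by (auto simp del: window_def)
  finally show ?thesis .
qed

definition "first_prob t c = prob {\<omega> \<in> space M. first_hit_at t c \<omega>}"
definition "sign_prob c = prob {\<omega> \<in> space M. Y 1 \<omega> = sign_of c}"

lemma sets_first_hit: "{\<omega> \<in> space M. first_hit_at t c \<omega>} \<in> sets M"
  unfolding first_hit_at_iff by (rule sets_segment)

lemma sets_two_hits: "{\<omega> \<in> space M. two_hits t c j c' \<omega>} \<in> sets M"
  unfolding two_hits_def by (rule sets.sets_Collect_conj[OF sets_segment[of "\<lambda>u. first_at u c c'"] sets_first_hit])

lemma prob_two_hits: "prob {\<omega> \<in> space M. two_hits t c j c' \<omega>} = first_prob t c * hit j c c'"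
  unfolding two_hits_def first_prob_def first_hit_at_iff
  using markov[of "first_pattern t c" t "\<lambda>u. first_at u c c'" j] by (simp only: word_fraction_first_at)

lemma first_prob_sums: assumes "c \<in> {a, b}" shows "(\<lambda>t. first_prob t c) sums sign_prob c"
proof -
  have "(\<lambda>t. prob {\<omega> \<in> space M. first_hit_at t c \<omega>}) sums prob (\<Union>t. {\<omega> \<in> space M. first_hit_at t c \<omega>})"
    by (rule finite_measure_UNION) (auto simp: sets_first_hit disjoint_family_on_def dest!: first_hitD(1))
  also have "prob (\<Union>t. {\<omega> \<in> space M. first_hit_at t c \<omega>}) = sign_prob c"
    unfolding sign_prob_def
  proof (rule measure_eq_AE)
    show "AE \<omega> in M. \<omega> \<in> (\<Union>t. {\<omega> \<in> space M. first_hit_at t c \<omega>}) \<longleftrightarrow> \<omega> \<in> {\<omega> \<in> space M. Y 1 \<omega> = sign_of c}"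
      using AE_hits_recur
    proof eventually_elim
      case (elim \<omega>)
      then obtain t d where d: "first_hit_at t d \<omega>" using recur_first_hit by blast
      show ?case
        using first_hitD(3,4)[OF d] d sign_of_inj[OF assms, of d] by (auto dest: first_hitD(4))
    qed
  qed (use sets_first_hit sets_hit_sign[of "\<lambda>y. y = sign_of c" 1] in auto)
  finally show ?thesis by (simp add: first_prob_def)
qed

definition "gap_event c j c' = {\<omega> \<in> space M. \<exists>t. two_hits t c j c' \<omega>}"

lemma sets_gap_event: "gap_event c j c' \<in> sets M"
proof -
  have "gap_event c j c' = (\<Union>t. {\<omega> \<in> space M. two_hits t c j c' \<omega>})" by (auto simp: gap_event_def)
  thus ?thesis using sets_two_hits by auto
qed

lemma prob_gap_event: assumes "c \<in> {a, b}" shows "prob (gap_event c j c') = sign_prob c * hit j c c'"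
proof -
  have "(\<lambda>t. prob {\<omega> \<in> space M. two_hits t c j c' \<omega>}) sums prob (\<Union>t. {\<omega> \<in> space M. two_hits t c j c' \<omega>})"
    by (rule finite_measure_UNION) (auto simp: sets_two_hits disjoint_family_on_def dest!: two_hitsD(1))
  moreover have "(\<Union>t. {\<omega> \<in> space M. two_hits t c j c' \<omega>}) = gap_event c j c'" by (auto simp: gap_event_def)
  ultimately have "(\<lambda>t. first_prob t c * hit j c c') sums prob (gap_event c j c')" by (simp add: prob_two_hits)
  moreover have "(\<lambda>t. first_prob t c * hit j c c') sums (sign_prob c * hit j c c')"
    by (rule sums_mult2[OF first_prob_sums[OF assms]])
  ultimately show ?thesis by (rule sums_unique2)
qed

lemma sign_prob_pos: assumes "c \<in> {a, b}" shows "sign_prob c > 0"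
proof -
  have lc: "length c = L" using assms len by auto
  have "first_prob L c = prob {\<omega> \<in> space M. segment X 0 L \<omega> = c}"
  proof -
    have "first_hit_at L c \<omega> \<longleftrightarrow> segment X 0 L \<omega> = c" for \<omega>
      unfolding first_hit_at_iff first_pattern_def using assms by auto
    thus ?thesis unfolding first_prob_def by simp
  qed
  hence p: "first_prob L c > 0" using prob_segment_eq[OF lc] by simp
  have "sign_prob c = (\<Sum>t. first_prob t c)" using first_prob_sums[OF assms] by (simp add: sums_iff)
  also have "\<dots> > 0" using first_prob_sums[OF assms] p
    by (intro suminf_pos2[of _ L]) (auto simp: sums_iff first_prob_def)
  finally show ?thesis .
qed

lemma prob_sign_pair:
  assumes "c \<in> {a, b}" "c' \<in> {a, b}"
  shows "prob {\<omega> \<in> space M. Y 2 \<omega> = sign_of c' \<and> Y 1 \<omega> = sign_of c} = sign_prob c * hitprob c c'"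
proof -
  have "(\<lambda>j. prob (gap_event c j c')) sums prob (\<Union>j. gap_event c j c')"
  proof (rule finite_measure_UNION)
    show "disjoint_family (\<lambda>j. gap_event c j c')"
      by (auto simp: disjoint_family_on_def gap_event_def dest: two_hits_unique(3))
  qed (use sets_gap_event in auto)
  also have "prob (\<Union>j. gap_event c j c') = prob {\<omega> \<in> space M. Y 2 \<omega> = sign_of c' \<and> Y 1 \<omega> = sign_of c}"
  proof (rule measure_eq_AE)
    show "AE \<omega> in M. \<omega> \<in> (\<Union>j. gap_event c j c') \<longleftrightarrow> \<omega> \<in> {\<omega> \<in> space M. Y 2 \<omega> = sign_of c' \<and> Y 1 \<omega> = sign_of c}"
      using AE_hits_recur
    proof eventually_elim
      case (elim \<omega>)
      then obtain t d j d' where d: "two_hits t d j d' \<omega>" using recur_two_hits by blast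
      show ?case
        using two_hitsD(3-6)[OF d] d sign_of_inj assms by (auto simp: gap_event_def dest: two_hitsD(5,6))
    qed
    show "{\<omega> \<in> space M. Y 2 \<omega> = sign_of c' \<and> Y 1 \<omega> = sign_of c} \<in> sets M"
      by (rule sets.sets_Collect_conj[OF sets_hit_sign[of "\<lambda>y. y = sign_of c"] sets_hit_sign[of "\<lambda>y. y = sign_of c'"]])
  qed (use sets_gap_event in auto)
  finally have "(\<lambda>j. sign_prob c * hit j c c') sums prob {\<omega> \<in> space M. Y 2 \<omega> = sign_of c' \<and> Y 1 \<omega> = sign_of c}"
    by (simp add: prob_gap_event[OF assms(1)])
  moreover have "(\<lambda>j. sign_prob c * hit j c c') sums (sign_prob c * hitprob c c')"
    using assms len by (intro sums_mult hit_sums) auto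
  ultimately show ?thesis by (rule sums_unique2)
qed

lemma stay_prob_eq: "stay_prob M X L a b = hitprob a a"
  using prob_sign_pair[of a a] sign_prob_pos[of a]
  unfolding stay_prob_def cond_prob_def sign_prob_def by (simp add: sign_of_def)

text \<open>
  Almost surely the integrand is the sum over \<open>j\<close> of \<open>j\<close> times the indicator of the event that the
  second hit follows \<open>j\<close> steps after the first one.
\<close>
lemma mu_eq:
  assumes "c \<in> {a, b}" "c' \<in> {a, b}"
  shows "mu M X L a b (sign_of c) (sign_of c') = hitmean c c'"
proof -
  define Z where "Z = (\<lambda>\<omega>. (real (T 2 \<omega>) - real (T 1 \<omega>)) * of_bool (Y 2 \<omega> = sign_of c') *
     indicator {\<omega> \<in> space M. Y 1 \<omega> = sign_of c} \<omega>)"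
  have m: "Z \<in> borel_measurable M"
  proof -
    have [measurable]: "T k \<in> M \<rightarrow>\<^sub>M count_space UNIV" "Y k \<in> M \<rightarrow>\<^sub>M count_space UNIV" for k
      by (rule measurable_hit_time, rule measurable_hit_sign)
    show ?thesis unfolding Z_def by measurable
  qed
  have Zeq: "AE \<omega> in M. 0 \<le> Z \<omega> \<and> ennreal (Z \<omega>) = (\<Sum>j. ennreal (real j) * indicator (gap_event c j c') \<omega>)"
    using AE_hits_recur AE_space
  proof eventually_elim
    case (elim \<omega>)
    then obtain t d j0 d' where d: "two_hits t d j0 d' \<omega>" using recur_two_hits by blast
    note D = two_hitsD[OF d]
    have mem: "\<omega> \<in> gap_event c j c' \<longleftrightarrow> j = j0 \<and> d = c \<and> d' = c'" for j
      using d two_hits_unique[OF d] elim unfolding gap_event_def by blast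
    have Zv: "Z \<omega> = (if d = c \<and> d' = c' then real j0 else 0)"
      unfolding Z_def D(1,2,5,6) using elim D sign_of_inj assms by (auto simp: indicator_def)
    have "(\<Sum>j. ennreal (real j) * indicator (gap_event c j c') \<omega>) = (\<Sum>j\<in>{j0}. ennreal (real j) * indicator (gap_event c j c') \<omega>)"
      by (rule suminf_finite) (auto simp: mem indicator_def)
    also have "\<dots> = ennreal (Z \<omega>)" unfolding Zv by (auto simp: mem indicator_def)
    finally show ?case unfolding Zv by auto
  qed
  have sm: "(\<lambda>j. real j * hit j c c') sums hitmean c c'" using assms len hit_sums(2) by auto
  have "(\<integral>\<^sup>+\<omega>. ennreal (Z \<omega>) \<partial>M) = (\<integral>\<^sup>+\<omega>. (\<Sum>j. ennreal (real j) * indicator (gap_event c j c') \<omega>) \<partial>M)"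
    by (rule nn_integral_cong_AE) (use Zeq in \<open>auto elim: eventually_mono\<close>)
  also have "\<dots> = (\<Sum>j. \<integral>\<^sup>+\<omega>. ennreal (real j) * indicator (gap_event c j c') \<omega> \<partial>M)"
    by (rule nn_integral_suminf) (use sets_gap_event in auto)
  also have "\<dots> = (\<Sum>j. ennreal (sign_prob c * (real j * hit j c c')))"
    using sets_gap_event hit_nonneg sign_prob_pos[OF assms(1)]
    by (simp add: nn_integral_cmult_indicator emeasure_eq_measure prob_gap_event[OF assms(1)] ennreal_mult'[symmetric] mult_ac)
  also have "\<dots> = ennreal (\<Sum>j. sign_prob c * (real j * hit j c c'))"
    using hit_nonneg sign_prob_pos[OF assms(1)] sums_mult[OF sm, of "sign_prob c"]
    by (intro suminf_ennreal2) (auto simp: sums_iff)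
  also have "(\<Sum>j. sign_prob c * (real j * hit j c c')) = sign_prob c * hitmean c c'"
    using sums_mult[OF sm, of "sign_prob c"] by (simp add: sums_iff)
  finally have nn: "(\<integral>\<^sup>+\<omega>. ennreal (Z \<omega>) \<partial>M) = ennreal (sign_prob c * hitmean c c')" .
  have "hitmean c c' \<ge> 0" unfolding hitmean_def using sm hit_nonneg by (intro suminf_nonneg) (auto simp: sums_iff)
  hence "(\<integral>\<omega>. Z \<omega> \<partial>M) = sign_prob c * hitmean c c'"
    using sign_prob_pos[OF assms(1)] Zeq
    by (subst integral_eq_nn_integral[OF m]) (auto simp: nn elim: eventually_mono)
  thus ?thesis using sign_prob_pos[OF assms(1)]
    unfolding mu_def cond_expectation_event_def Z_def sign_prob_def by simp
qed

lemma prob_start: assumes "length v = L" shows "prob {\<omega> \<in> space M. W L \<omega> = v} = 1 / 2 ^ L"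
  using prob_segment_eq[OF assms] by (simp add: window_start[OF L])

lemma start_prob_eq:
  assumes v: "length v = L"
  shows "start_prob M X L v a b (- 1) = (if v = b then 1 else if v = a then 0 else hitprob v b)"
proof -
  have start: "Y 1 \<omega> = sign_of v" if "W L \<omega> = v" "v \<in> {a, b}" for \<omega>
  proof -
    have "first_hit_at L v \<omega>" using that L window_hit_ge unfolding first_hit_at_def
      by (metis One_nat_def Suc_le_eq not_le)
    thus ?thesis by (rule first_hitD(4))
  qed
  have "prob {\<omega> \<in> space M. Y 1 \<omega> = - 1 \<and> W L \<omega> = v} =
     (if v = b then 1 else if v = a then 0 else hitprob v b) / 2 ^ L"
  proof -
    consider "v = b" | "v = a" | "v \<notin> {a, b}" by blast
    thus ?thesis
    proof cases
      case 1
      have "{\<omega> \<in> space M. Y 1 \<omega> = - 1 \<and> W L \<omega> = v} = {\<omega> \<in> space M. W L \<omega> = v}"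
        using start 1 ab by (auto simp: sign_of_def)
      thus ?thesis using 1 prob_start[OF v] by simp
    next
      case 2
      have e: "{\<omega> \<in> space M. Y 1 \<omega> = - 1 \<and> W L \<omega> = v} = {}" using start 2 by (auto simp: sign_of_def)
      show ?thesis unfolding e using 2 ab by simp
    next
      case 3
      let ?E = "\<lambda>j. {\<omega> \<in> space M. segment X 0 L \<omega> = v \<and> first_at (segment X L j \<omega>) v b}"
      have E: "?E j \<in> sets M" for j
        by (rule sets.sets_Collect_conj[OF sets_segment[of "\<lambda>u. first_at u v b"] sets_segment_eq])
      have fh: "first_hit_at (L + j) c \<omega>" if "W L \<omega> = v" "first_at (segment X L j \<omega>) v c" for \<omega> j c
      proof -
        note F = that(2)[unfolded first_at_segment_iff[OF order_refl that(1)]]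
        have "W i \<omega> \<notin> {a, b}" if "0 < i" "i < L + j" for i
        proof -
          consider "i < L" | "i = L" | "i > L" by linarith
          thus ?thesis
          proof cases
            case 1 thus ?thesis using window_hit_ge by (meson not_le)
          next
            case 2 thus ?thesis using \<open>W L \<omega> = v\<close> 3 by simp
          next
            case 3
            hence "0 < i - L" "i - L < j" using \<open>i < L + j\<close> by auto
            hence "W (L + (i - L)) \<omega> \<notin> {a, b}" using F by blast
            thus ?thesis using 3 by simp
          qed
        qed
        thus ?thesis using F by (auto simp: first_hit_at_def)
      qed
      have "(\<lambda>j. prob (?E j)) sums prob (\<Union>j. ?E j)"
      proof (rule finite_measure_UNION)
        show "disjoint_family ?E"
        proof -
          have "m = n" if "\<omega> \<in> ?E m" "\<omega> \<in> ?E n" for m n \<omega>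
            using first_hitD(1)[OF fh[of \<omega> m b]] first_hitD(1)[OF fh[of \<omega> n b]] that
            by (simp add: window_start[OF L])
          thus ?thesis unfolding disjoint_family_on_def by blast
        qed
      qed (use E in auto)
      also have "prob (\<Union>j. ?E j) = prob {\<omega> \<in> space M. Y 1 \<omega> = - 1 \<and> W L \<omega> = v}"
      proof (rule measure_eq_AE)
        show "AE \<omega> in M. \<omega> \<in> (\<Union>j. ?E j) \<longleftrightarrow> \<omega> \<in> {\<omega> \<in> space M. Y 1 \<omega> = - 1 \<and> W L \<omega> = v}"
          using AE_hits_recur
        proof eventually_elim
          case (elim \<omega>)
          show ?case
          proof
            assume "\<omega> \<in> (\<Union>j. ?E j)"
            then obtain j where j: "\<omega> \<in> space M" "W L \<omega> = v" "first_at (segment X L j \<omega>) v b"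
              by (auto simp: window_start[OF L])
            thus "\<omega> \<in> {\<omega> \<in> space M. Y 1 \<omega> = - 1 \<and> W L \<omega> = v}"
              using first_hitD(4)[OF fh[OF j(2,3)]] ab by (simp add: sign_of_def)
          next
            assume A: "\<omega> \<in> {\<omega> \<in> space M. Y 1 \<omega> = - 1 \<and> W L \<omega> = v}"
            obtain j c where c: "first_at (segment X L j \<omega>) v c" using next_hit[OF elim order_refl] A by auto
            have "W L \<omega> = v" using A by simp
            note D = first_hitD[OF fh[OF this c]]
            hence "c = b" using A D(3,4) by (auto simp: sign_of_def)
            thus "\<omega> \<in> (\<Union>j. ?E j)" using A c by (auto simp: window_start[OF L])
          qed
        qed
        show "{\<omega> \<in> space M. Y 1 \<omega> = - 1 \<and> W L \<omega> = v} \<in> sets M"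
          by (rule sets.sets_Collect_conj[OF sets_window[of "\<lambda>w. w = v"] sets_hit_sign[of "\<lambda>y. y = -1"]])
      qed (use E in auto)
      finally have s: "(\<lambda>j. prob (?E j)) sums prob {\<omega> \<in> space M. Y 1 \<omega> = - 1 \<and> W L \<omega> = v}" .
      have pE: "prob (?E j) = 1 / 2 ^ L * hit j v b" for j
        using markov[of "\<lambda>u. u = v" L "\<lambda>u. first_at u v b" j] by (simp only: word_fraction_first_at prob_segment_eq[OF v])
      have "(\<lambda>j. prob (?E j)) sums (1 / 2 ^ L * hitprob v b)"
        unfolding pE using v by (intro sums_mult hit_sums) auto
      from sums_unique2[OF s this] show ?thesis using 3 by simp
    qed
  qed
  thus ?thesis unfolding start_prob_def cond_prob_def prob_start[OF v] by simp
qed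

text \<open>
  The first window is complete at time \<open>L\<close>, so a hit at that time is part of the count.
\<close>
lemma occurrences_diff:
  "int (occurrences X (L + n) a \<omega>) - int (occurrences X (L + n) b \<omega>)
     = sgn_word (W L \<omega>) + score (segment X L n \<omega>) (W L \<omega>)"
proof (induction n)
  case 0
  show ?case using ab by (auto simp: occurrences_def len sgn_word_def)
next
  case (Suc n)
  have r: "{L..L + Suc n} = insert (L + Suc n) {L..L + n}" by auto
  have w: "W (L + Suc n) \<omega> = foldl advance (W L \<omega>) (segment X L n \<omega> @ [X (Suc (L + n)) \<omega>])"
    using window_segment[OF L order_refl, of X "Suc n" \<omega>] by (simp only: segment_Suc)
  have "int (occurrences X (L + Suc n) a \<omega>) - int (occurrences X (L + Suc n) b \<omega>) =
     (int (occurrences X (L + n) a \<omega>) - int (occurrences X (L + n) b \<omega>)) + sgn_word (W (L + Suc n) \<omega>)"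
    unfolding occurrences_def len r using ab by (auto simp: sgn_word_def)
  thus ?case unfolding Suc w segment_Suc score_snoc by simp
qed

lemma psi_eq:
  assumes v: "length v = L"
  shows "psi M X L v a b (L + n) = exceed n v (sgn_word v) - 1 / 2"
proof -
  have "{\<omega> \<in> space M. occurrences X (L + n) a \<omega> > occurrences X (L + n) b \<omega> \<and> W L \<omega> = v}
     = {\<omega> \<in> space M. segment X 0 L \<omega> = v \<and> sgn_word v + score (segment X L n \<omega>) v > 0}"
  proof -
    have "occurrences X (L + n) a \<omega> > occurrences X (L + n) b \<omega> \<longleftrightarrow>
       0 < sgn_word (W L \<omega>) + score (segment X L n \<omega>) (W L \<omega>)"
      for \<omega> using occurrences_diff[of n \<omega>] by linarith
    hence "(occurrences X (L + n) b \<omega> < occurrences X (L + n) a \<omega> \<and> W L \<omega> = v) =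
      (segment X 0 L \<omega> = v \<and> 0 < sgn_word v + score (segment X L n \<omega>) v)"
      for \<omega> by (auto simp: window_start[OF L])
    thus ?thesis by (simp only:)
  qed
  hence "prob {\<omega> \<in> space M. occurrences X (L + n) a \<omega> > occurrences X (L + n) b \<omega> \<and> W L \<omega> = v}
    = 1 / 2 ^ L * exceed n v (sgn_word v)"
    using markov[of "\<lambda>u. u = v" L "\<lambda>u. sgn_word v + score u v > 0" n]
    by (simp only: word_fraction_score prob_segment_eq[OF v])
  thus ?thesis unfolding psi_def cond_prob_def prob_start[OF v] by simp
qed

end

section \<open>The asymptotic expansion\<close>

theorem theorem1p2:
  fixes M :: "'w measure" and X :: "nat \<Rightarrow> 'w \<Rightarrow> bool"
    and L :: nat and v a b :: "bool list" and p q :: real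
  assumes "symmetric_bernoulli_process M X"
    and "L \<ge> 1"
    and "length v = L" and "length a = L" and "length b = L"
    and "b \<notin> {a, rev a, conjugate a, rev (conjugate a)}"
    and "p = stay_prob M X L a b" and "q = 1 - p"
  shows "(\<lambda>n. psi M X L v a b n - beta M X L v a b / sqrt (2 ^ (L + 2) * p * q * pi * real n))
           \<in> o(\<lambda>n. 1 / sqrt (real n))"
proof -
  have "prob_space M" using assms(1) by (simp add: symmetric_bernoulli_process_def)
  then interpret prob_space M .
  interpret fair_process M X
  proof
    show "indep_vars (\<lambda>_. count_space UNIV) X {1..}" using assms(1) by (simp add: symmetric_bernoulli_process_def)
    fix i :: nat and e assume "i \<ge> 1"
    thus "prob {\<omega> \<in> space M. X i \<omega> = e} = 1 / 2"
      using assms(1) by (cases e) (auto simp: symmetric_bernoulli_process_def)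
  qed
  interpret generic_pair L a b by unfold_locales (use assms in \<open>auto simp: conjugate_def\<close>)
  interpret fair_pair M X L a b ..
  note v = \<open>length v = L\<close>
  define pb where "pb = (if v = b then 1 else if v = a then 0 else hitprob v b)"
  define \<beta> where "\<beta> = (stay / 2 - pb) * 2 ^ L + (hitmean a b - hitmean b a) / 2"
  have p: "p = stay" using assms(7) by (simp add: stay_prob_eq stay_def)
  have mu: "mu M X L a b 1 (-1) = hitmean a b" "mu M X L a b (-1) 1 = hitmean b a"
    using mu_eq[of a b] mu_eq[of b a] ab by (simp_all add: sign_of_def)
  have beta: "beta M X L v a b = \<beta>"
    unfolding beta_def \<beta>_def pb_def mu start_prob_eq[OF v] stay_prob_eq stay_def ..
  define \<kappa> where "\<kappa> = \<beta> / sqrt (4 * stay * (1 - stay) * 2 ^ L) / sqrt pi"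
  have lead: "beta M X L v a b / sqrt (2 ^ (L + 2) * p * q * pi * real n) = \<kappa> / sqrt (real n)" for n
  proof -
    have "2 ^ (L + 2) * p * q * pi * real n = 4 * stay * (1 - stay) * 2 ^ L * pi * real n"
      using assms(8) p by (simp add: power_add)
    thus ?thesis unfolding beta \<kappa>_def by (simp only: real_sqrt_mult divide_divide_eq_left)
  qed
  have "(\<lambda>n. (exceed n v (sgn_word v) - 1/2) - \<kappa> / sqrt (real n)) \<in> o(\<lambda>n. 1 / sqrt (real n))"
    using exceed_asymptotics[OF v] unfolding \<kappa>_def \<beta>_def pb_def by (simp only: real_sqrt_mult divide_divide_eq_left mult.assoc)
  hence 1: "(\<lambda>n. (exceed (n - L) v (sgn_word v) - 1/2) - \<kappa> / sqrt (real (n - L))) \<in> o(\<lambda>n. 1 / sqrt (real (n - L)))"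
    by (rule landau_o.small.compose) (rule filterlim_minus_const_nat_at_top)
  have ev: "eventually (\<lambda>n. real (n - L) = real n - real L) sequentially"
    using eventually_ge_at_top[of L] by eventually_elim (simp add: of_nat_diff)
  have "(\<lambda>n. 1 / sqrt (real n - real L)) \<in> O(\<lambda>n. 1 / sqrt (real n))" by real_asymp
  hence O: "(\<lambda>n. 1 / sqrt (real (n - L))) \<in> O(\<lambda>n. 1 / sqrt (real n))"
    by (subst landau_o.big.in_cong[OF eventually_mono[OF ev]]) auto
  have "(\<lambda>n. 1 / sqrt (real n - real L) - 1 / sqrt (real n)) \<in> o(\<lambda>n. 1 / sqrt (real n))" by real_asymp
  hence "(\<lambda>n. 1 / sqrt (real (n - L)) - 1 / sqrt (real n)) \<in> o(\<lambda>n. 1 / sqrt (real n))"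
    by (subst landau_o.small.in_cong[OF eventually_mono[OF ev]]) auto
  hence 2: "(\<lambda>n. \<kappa> * (1 / sqrt (real (n - L)) - 1 / sqrt (real n))) \<in> o(\<lambda>n. 1 / sqrt (real n))" by simp
  from sum_in_smallo(1)[OF landau_o.small_big_trans[OF 1 O] 2]
  have 3: "(\<lambda>n. (exceed (n - L) v (sgn_word v) - 1/2) - \<kappa> / sqrt (real n)) \<in> o(\<lambda>n. 1 / sqrt (real n))"
    by (simp add: algebra_simps)
  have "eventually (\<lambda>n. psi M X L v a b n - \<kappa> / sqrt (real n) = (exceed (n - L) v (sgn_word v) - 1/2) - \<kappa> / sqrt (real n)) sequentially"
    using eventually_ge_at_top[of L]
  proof eventually_elim
    case (elim n) thus ?case using psi_eq[OF v, of "n - L"] by simp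
  qed
  from landau_o.small.in_cong[OF this] 3 show ?thesis unfolding lead by blast
qed

end
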